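(* A tuple $(A,\varphi,\widehat{H},\widehat{D})$ is a solution of the domain-decomposed problem (DD) stated in the context if and only if $(A,\varphi)$ is a solution of the weak Maxwell problem (W) stated in the context and, for all $K\in\mathcal{T}_h$ and all times, $$\widehat{H}\times\mathbf{n}|_{\partial K}=H\times\mathbf{n}|_{\partial K},\qquad \widehat{D}\cdot\mathbf{n}|_{\partial K}=D\cdot\mathbf{n}|_{\partial K}.$$ In particular, if $(A,\varphi)$ is a solution of (W), then $(A,\varphi,H,D)$ is a solution of (DD).
   Context: Setting. $\Omega\subset\mathbb{R}^3$ is a bounded polyhedral Lipschitz domain with a triangulation $\mathcal{T}_h$ by tetrahedra $K$; $\mathbf{n}$ denotes outer unit normals. $H^1$, $H(\operatorname{curl})$, $H(\operatorname{div})$ are the usual spaces of $L^2$ functions/fields with $L^2$ gradient, curl, divergence. $\mathring{H}^1(\Omega)$ and $\mathring{H}(\operatorname{curl};\Omega)$ are the subspaces with $u|_{\partial\Omega}=0$, respectively $u\times\mathbf{n}|_{\partial\Omega}=0$. $H^1(\mathcal{T}_h)$ and $H(\operatorname{curl};\mathcal{T}_h)$ are the spaces of $L^2$ functions/fields whose restriction to each $K\in\mathcal{T}_h$ is in $H^1(K)$, respectively $H(\operatorname{curl};K)$. Time $t$ ranges over an interval $I$, and a dot denotes $\partial_t$. The tensors $\epsilon=\epsilon_{ij}(x,t)$ and $\mu=\mu_{ij}(x,t)$ are $L^\infty$, symmetric and uniformly elliptic. The current density $J$ is a given $C^0$ curve in $H(\operatorname{div};\Omega)$ and the charge density $\rho$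 is a given $C^1$ curve in $L^2(\Omega)$, with $\dot\rho+\operatorname{div}J=0$. Given potentials $(A,\varphi)$ one defines (elementwise on each $K$ when the potentials are in broken spaces) $$E=-(\dot A+\operatorname{grad}\varphi),\quad B=\operatorname{curl}A,\quad D=\epsilon E,\quad H=\mu^{-1}B,$$ and only $(A,\varphi)$ for which $D$ is a $C^1$ curve and $H$ is a $C^0$ curve in $L^2(\Omega,\mathbb{R}^3)$ are considered. Boundary integrals are in the trace (duality) sense: $\int_{\partial K}(u\times v)\cdot\mathbf{n}=\int_K(\operatorname{curl}u\cdot v-u\cdot\operatorname{curl}v)$ for $u,v\in H(\operatorname{curl};K)$, and $\int_{\partial K}\psi\,w\cdot\mathbf{n}=\int_K(\operatorname{grad}\psi\cdot w+\psi\operatorname{div}w)$ for $\psi\in H^1(K)$, $w\in H(\operatorname{div};K)$. Problem (W). A solution is a pair $(A,\varphi)$, with $A$ a $C^1$ curve in $\mathring{H}(\operatorname{curl};\Omega)$ and $\varphi$ a $C^0$ curve in $\mathring{H}^1(\Omega)$, such that at all times $$\int_\Omega\bigl(A'\cdot(\dot D+J)-\operatorname{curl}A'\cdot H\bigr)=0\quad\forall A'\in\mathring{H}(\operatorname{curl};\Omega),$$ $$\int_\Omega(\operatorname{grad}\varphi'\cdot D+\varphi'\rho)=0\quad\forall\varphi'\in\mathring{H}^1(\Omega).$$ (For such a solution $H(t)\in H(\operatorname{curl};\Omega)$ and $D(t)\in H(\operatorname{div};\Omega)$, so the traces of $H$ and $D$ on $\partial K$ make sense.) Problem (DD). A solution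 is a tuple $(A,\varphi,\widehat H,\widehat D)$, with $A$ a $C^1$ curve in $H(\operatorname{curl};\mathcal{T}_h)$, $\varphi$ a $C^0$ curve in $H^1(\mathcal{T}_h)$, $\widehat H$ a $C^0$ curve in $H(\operatorname{curl};\Omega)$, $\widehat D$ a $C^0$ curve in $H(\operatorname{div};\Omega)$, such that at all times, with the first two equations holding for every $K\in\mathcal{T}_h$, $$\int_K\bigl(A'\cdot(\dot D+J)-\operatorname{curl}A'\cdot H\bigr)+\int_{\partial K}(A'\times\widehat H)\cdot\mathbf{n}=0\quad\forall A'\in H(\operatorname{curl};K),$$ $$\int_K(\operatorname{grad}\varphi'\cdot D+\varphi'\rho)-\int_{\partial K}\varphi'\,\widehat D\cdot\mathbf{n}=0\quad\forall\varphi'\in H^1(K),$$ $$\sum_{K\in\mathcal{T}_h}\int_{\partial K}(A\times\widehat H')\cdot\mathbf{n}=0\quad\forall\widehat H'\in H(\operatorname{curl};\Omega),$$ $$\sum_{K\in\mathcal{T}_h}\int_{\partial K}\varphi\,\widehat D'\cdot\mathbf{n}=0\quad\forall\widehat D'\in H(\operatorname{div};\Omega).$$ In the claim, $(\widehat H,\widehat D)$ are always $C^0$ curves in $H(\operatorname{curl};\Omega)\times H(\operatorname{div};\Omega)$. *)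

theory Defs
  imports "HOL-Analysis.Analysis"
begin

section \<open>Domain and mesh\<close>

text \<open>
  Near each boundary point the domain lies on one side of a Lipschitz graph over the plane
  orthogonal to the unit vector \<open>\<nu>\<close>; \<open>x - (x \<bullet> \<nu>) *\<^sub>R \<nu>\<close> is the projection of \<open>x\<close> to that plane.
\<close>

definition lipschitz_domain :: "(real^3) set \<Rightarrow> bool" where
  "lipschitz_domain \<Omega> \<longleftrightarrow>
     open \<Omega> \<and> connected \<Omega> \<and> \<Omega> \<noteq> {} \<and>
     (\<forall>p\<in>frontier \<Omega>. \<exists>U \<nu> g L. open U \<and> p \<in> U \<and> norm \<nu> = 1 \<and> L-lipschitz_on UNIV g \<and>
        \<Omega> \<inter> U = {x \<in> U. x \<bullet> \<nu> < g (x - (x \<bullet> \<nu>) *\<^sub>R \<nu>)})"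

text \<open>
  The elements are closed tetrahedra, any two of which meet in a common face (possibly empty).
  The last clause also says that \<open>\<Omega>\<close> is bounded and polyhedral.
\<close>

definition tetrahedral_mesh :: "(real^3) set set \<Rightarrow> (real^3) set \<Rightarrow> bool" where
  "tetrahedral_mesh \<T> \<Omega> \<longleftrightarrow>
     triangulation \<T> \<and> (\<forall>K\<in>\<T>. 3 simplex K) \<and> \<Union>\<T> = closure \<Omega>"


section \<open>Test functions\<close>

definition partial_deriv :: "3 \<Rightarrow> (real^3 \<Rightarrow> 'b::real_normed_vector) \<Rightarrow> real^3 \<Rightarrow> 'b" where
  "partial_deriv i f x = frechet_derivative f (at x) (axis i 1)"

primrec Ck :: "nat \<Rightarrow> (real^3 \<Rightarrow> 'b::real_normed_vector) \<Rightarrow> bool" where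
  "Ck 0 f \<longleftrightarrow> continuous_on UNIV f"
| "Ck (Suc k) f \<longleftrightarrow> (\<forall>x. f differentiable (at x)) \<and> (\<forall>i. Ck k (partial_deriv i f))"

definition test_functions :: "(real^3) set \<Rightarrow> (real^3 \<Rightarrow> 'b::real_normed_vector) set" where
  "test_functions S =
     {f. (\<forall>k. Ck k f) \<and> (\<exists>C. compact C \<and> C \<subseteq> S \<and> (\<forall>x. x \<notin> C \<longrightarrow> f x = 0))}"

definition classical_grad :: "(real^3 \<Rightarrow> real) \<Rightarrow> real^3 \<Rightarrow> real^3" where
  "classical_grad f x = (\<chi> i. partial_deriv i f x)"

definition classical_div :: "(real^3 \<Rightarrow> real^3) \<Rightarrow> real^3 \<Rightarrow> real" where
  "classical_div F x = (\<Sum>i\<in>UNIV. partial_deriv i F x $ i)"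

definition classical_curl :: "(real^3 \<Rightarrow> real^3) \<Rightarrow> real^3 \<Rightarrow> real^3" where
  "classical_curl F x =
     vector [partial_deriv 2 F x $ 3 - partial_deriv 3 F x $ 2,
             partial_deriv 3 F x $ 1 - partial_deriv 1 F x $ 3,
             partial_deriv 1 F x $ 2 - partial_deriv 2 F x $ 1]"


section \<open>Square integrable functions with weak derivatives\<close>

text \<open>
  Elements of the function spaces are represented by functions on the whole of space, of which
  only the values almost everywhere in \<open>S\<close> matter; \<open>S\<close> is always an open set (the domain or
  the interior of an element). The norms are therefore only seminorms on the representatives,
  and identities between elements are to be read almost everywhere in \<open>S\<close>.
\<close>

definition L2 :: "(real^3) set \<Rightarrow> (real^3 \<Rightarrow> 'b::euclidean_space) set" where
  "L2 S = {f. f \<in> borel_measurable (lebesgue_on S) \<and>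
              integrable (lebesgue_on S) (\<lambda>x. (norm (f x))\<^sup>2)}"

definition L2_norm :: "(real^3) set \<Rightarrow> (real^3 \<Rightarrow> 'b::euclidean_space) \<Rightarrow> real" where
  "L2_norm S f = sqrt (LINT x|lebesgue_on S. (norm (f x))\<^sup>2)"

definition has_weak_grad :: "(real^3) set \<Rightarrow> (real^3 \<Rightarrow> real) \<Rightarrow> (real^3 \<Rightarrow> real^3) \<Rightarrow> bool" where
  "has_weak_grad S u g \<longleftrightarrow> u \<in> L2 S \<and> g \<in> L2 S \<and>
     (\<forall>\<psi>\<in>test_functions S.
        (LINT x|lebesgue_on S. u x * classical_div \<psi> x) = - (LINT x|lebesgue_on S. g x \<bullet> \<psi> x))"

definition has_weak_curl :: "(real^3) set \<Rightarrow> (real^3 \<Rightarrow> real^3) \<Rightarrow> (real^3 \<Rightarrow> real^3) \<Rightarrow> bool" where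
  "has_weak_curl S u v \<longleftrightarrow> u \<in> L2 S \<and> v \<in> L2 S \<and>
     (\<forall>\<psi>\<in>test_functions S.
        (LINT x|lebesgue_on S. u x \<bullet> classical_curl \<psi> x) = (LINT x|lebesgue_on S. v x \<bullet> \<psi> x))"

definition has_weak_div :: "(real^3) set \<Rightarrow> (real^3 \<Rightarrow> real^3) \<Rightarrow> (real^3 \<Rightarrow> real) \<Rightarrow> bool" where
  "has_weak_div S u d \<longleftrightarrow> u \<in> L2 S \<and> d \<in> L2 S \<and>
     (\<forall>\<psi>\<in>test_functions S.
        (LINT x|lebesgue_on S. u x \<bullet> classical_grad \<psi> x) = - (LINT x|lebesgue_on S. d x * \<psi> x))"

text \<open>The weak derivatives below are determined up to a null subset of \<open>S\<close>.\<close>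

definition weak_grad :: "(real^3) set \<Rightarrow> (real^3 \<Rightarrow> real) \<Rightarrow> real^3 \<Rightarrow> real^3" where
  "weak_grad S u = (SOME g. has_weak_grad S u g)"

definition weak_curl :: "(real^3) set \<Rightarrow> (real^3 \<Rightarrow> real^3) \<Rightarrow> real^3 \<Rightarrow> real^3" where
  "weak_curl S u = (SOME v. has_weak_curl S u v)"

definition weak_div :: "(real^3) set \<Rightarrow> (real^3 \<Rightarrow> real^3) \<Rightarrow> real^3 \<Rightarrow> real" where
  "weak_div S u = (SOME d. has_weak_div S u d)"

definition H1 :: "(real^3) set \<Rightarrow> (real^3 \<Rightarrow> real) set" where
  "H1 S = {u. \<exists>g. has_weak_grad S u g}"

definition Hcurl :: "(real^3) set \<Rightarrow> (real^3 \<Rightarrow> real^3) set" where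
  "Hcurl S = {u. \<exists>v. has_weak_curl S u v}"

definition Hdiv :: "(real^3) set \<Rightarrow> (real^3 \<Rightarrow> real^3) set" where
  "Hdiv S = {u. \<exists>d. has_weak_div S u d}"

definition H1_norm :: "(real^3) set \<Rightarrow> (real^3 \<Rightarrow> real) \<Rightarrow> real" where
  "H1_norm S u = sqrt ((L2_norm S u)\<^sup>2 + (L2_norm S (weak_grad S u))\<^sup>2)"

definition Hcurl_norm :: "(real^3) set \<Rightarrow> (real^3 \<Rightarrow> real^3) \<Rightarrow> real" where
  "Hcurl_norm S u = sqrt ((L2_norm S u)\<^sup>2 + (L2_norm S (weak_curl S u))\<^sup>2)"

definition Hdiv_norm :: "(real^3) set \<Rightarrow> (real^3 \<Rightarrow> real^3) \<Rightarrow> real" where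
  "Hdiv_norm S u = sqrt ((L2_norm S u)\<^sup>2 + (L2_norm S (weak_div S u))\<^sup>2)"


section \<open>Boundary integrals and traces\<close>

text \<open>\<open>\<integral>\<^bsub>\<partial>S\<^esub> (u \<times> v) \<cdot> n\<close> for \<open>u\<close>, \<open>v\<close> in \<open>Hcurl S\<close>.\<close>

definition bdry_cross :: "(real^3) set \<Rightarrow> (real^3 \<Rightarrow> real^3) \<Rightarrow> (real^3 \<Rightarrow> real^3) \<Rightarrow> real" where
  "bdry_cross S u v =
     (LINT x|lebesgue_on S. weak_curl S u x \<bullet> v x - u x \<bullet> weak_curl S v x)"

text \<open>\<open>\<integral>\<^bsub>\<partial>S\<^esub> \<psi> w \<cdot> n\<close> for \<open>\<psi>\<close> in \<open>H1 S\<close>, \<open>w\<close> in \<open>Hdiv S\<close>.\<close>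

definition bdry_flux :: "(real^3) set \<Rightarrow> (real^3 \<Rightarrow> real) \<Rightarrow> (real^3 \<Rightarrow> real^3) \<Rightarrow> real" where
  "bdry_flux S \<psi> w =
     (LINT x|lebesgue_on S. weak_grad S \<psi> x \<bullet> w x + \<psi> x * weak_div S w x)"

text \<open>
  The traces \<open>v \<times> n\<close>, \<open>w \<cdot> n\<close> and \<open>\<psi>\<close> on \<open>\<partial>S\<close>, as the functionals which the boundary integrals
  define; note that \<open>(u \<times> v) \<cdot> n = u \<cdot> (v \<times> n)\<close>.
\<close>

definition tangential_trace :: "(real^3) set \<Rightarrow> (real^3 \<Rightarrow> real^3) \<Rightarrow> (real^3 \<Rightarrow> real^3) \<Rightarrow> real" where
  "tangential_trace S v = restrict (\<lambda>u. bdry_cross S u v) (Hcurl S)"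

definition normal_trace :: "(real^3) set \<Rightarrow> (real^3 \<Rightarrow> real^3) \<Rightarrow> (real^3 \<Rightarrow> real) \<Rightarrow> real" where
  "normal_trace S w = restrict (\<lambda>\<psi>. bdry_flux S \<psi> w) (H1 S)"

definition scalar_trace :: "(real^3) set \<Rightarrow> (real^3 \<Rightarrow> real) \<Rightarrow> (real^3 \<Rightarrow> real^3) \<Rightarrow> real" where
  "scalar_trace S \<psi> = restrict (\<lambda>w. bdry_flux S \<psi> w) (Hdiv S)"

definition H1_0 :: "(real^3) set \<Rightarrow> (real^3 \<Rightarrow> real) set" where
  "H1_0 S = {u \<in> H1 S. \<forall>w\<in>Hdiv S. scalar_trace S u w = 0}"

definition Hcurl_0 :: "(real^3) set \<Rightarrow> (real^3 \<Rightarrow> real^3) set" where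
  "Hcurl_0 S = {u \<in> Hcurl S. \<forall>v\<in>Hcurl S. tangential_trace S u v = 0}"


section \<open>Broken spaces\<close>

definition broken_H1 :: "(real^3) set \<Rightarrow> (real^3) set set \<Rightarrow> (real^3 \<Rightarrow> real) set" where
  "broken_H1 \<Omega> \<T> = {u \<in> L2 \<Omega>. \<forall>K\<in>\<T>. u \<in> H1 (interior K)}"

definition broken_Hcurl :: "(real^3) set \<Rightarrow> (real^3) set set \<Rightarrow> (real^3 \<Rightarrow> real^3) set" where
  "broken_Hcurl \<Omega> \<T> = {u \<in> L2 \<Omega>. \<forall>K\<in>\<T>. u \<in> Hcurl (interior K)}"

text \<open>
  The elementwise derivatives. The interiors of the elements are pairwise disjoint, so at most one
  summand is nonzero; the value on the (null) union of the element boundaries is zero.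
\<close>

definition broken_grad :: "(real^3) set set \<Rightarrow> (real^3 \<Rightarrow> real) \<Rightarrow> real^3 \<Rightarrow> real^3" where
  "broken_grad \<T> u x = (\<Sum>K\<in>\<T>. indicator (interior K) x *\<^sub>R weak_grad (interior K) u x)"

definition broken_curl :: "(real^3) set set \<Rightarrow> (real^3 \<Rightarrow> real^3) \<Rightarrow> real^3 \<Rightarrow> real^3" where
  "broken_curl \<T> u x = (\<Sum>K\<in>\<T>. indicator (interior K) x *\<^sub>R weak_curl (interior K) u x)"

definition broken_H1_norm :: "(real^3) set \<Rightarrow> (real^3) set set \<Rightarrow> (real^3 \<Rightarrow> real) \<Rightarrow> real" where
  "broken_H1_norm \<Omega> \<T> u =
     sqrt ((L2_norm \<Omega> u)\<^sup>2 + (\<Sum>K\<in>\<T>. (L2_norm (interior K) (weak_grad (interior K) u))\<^sup>2))"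

definition broken_Hcurl_norm :: "(real^3) set \<Rightarrow> (real^3) set set \<Rightarrow> (real^3 \<Rightarrow> real^3) \<Rightarrow> real" where
  "broken_Hcurl_norm \<Omega> \<T> u =
     sqrt ((L2_norm \<Omega> u)\<^sup>2 + (\<Sum>K\<in>\<T>. (L2_norm (interior K) (weak_curl (interior K) u))\<^sup>2))"


section \<open>Curves in function spaces\<close>

text \<open>
  A curve \<open>u\<close> over the time interval \<open>I\<close> in the space \<open>X\<close> with (semi)norm \<open>N\<close>. At the end points
  of \<open>I\<close>, limits and derivatives are one-sided.
\<close>

definition C0_curve ::
  "real set \<Rightarrow> (real^3 \<Rightarrow> 'b::euclidean_space) set \<Rightarrow> ((real^3 \<Rightarrow> 'b) \<Rightarrow> real) \<Rightarrow>
   (real \<Rightarrow> real^3 \<Rightarrow> 'b) \<Rightarrow> bool" where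
  "C0_curve I X N u \<longleftrightarrow>
     (\<forall>t\<in>I. u t \<in> X) \<and> (\<forall>t\<in>I. ((\<lambda>s. N (\<lambda>x. u s x - u t x)) \<longlongrightarrow> 0) (at t within I))"

definition curve_has_deriv ::
  "real set \<Rightarrow> ((real^3 \<Rightarrow> 'b::euclidean_space) \<Rightarrow> real) \<Rightarrow>
   (real \<Rightarrow> real^3 \<Rightarrow> 'b) \<Rightarrow> (real^3 \<Rightarrow> 'b) \<Rightarrow> real \<Rightarrow> bool" where
  "curve_has_deriv I N u v t \<longleftrightarrow>
     ((\<lambda>s. N (\<lambda>x. (u s x - u t x) /\<^sub>R (s - t) - v x)) \<longlongrightarrow> 0) (at t within I)"

definition C1_curve ::
  "real set \<Rightarrow> (real^3 \<Rightarrow> 'b::euclidean_space) set \<Rightarrow> ((real^3 \<Rightarrow> 'b) \<Rightarrow> real) \<Rightarrow>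
   (real \<Rightarrow> real^3 \<Rightarrow> 'b) \<Rightarrow> bool" where
  "C1_curve I X N u \<longleftrightarrow>
     (\<forall>t\<in>I. u t \<in> X) \<and> (\<exists>v. C0_curve I X N v \<and> (\<forall>t\<in>I. curve_has_deriv I N u (v t) t))"

text \<open>
  All time derivatives are taken in \<open>L2 \<Omega>\<close>. For a differentiable curve in one of the spaces above
  this is also its derivative in that space, since the norms of these spaces dominate \<open>L2_norm \<Omega>\<close>.
\<close>

definition time_deriv ::
  "(real^3) set \<Rightarrow> real set \<Rightarrow> (real \<Rightarrow> real^3 \<Rightarrow> 'b::euclidean_space) \<Rightarrow> real \<Rightarrow> real^3 \<Rightarrow> 'b" where
  "time_deriv \<Omega> I u t = (SOME v. v \<in> L2 \<Omega> \<and> curve_has_deriv I (L2_norm \<Omega>) u v t)"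


section \<open>Maxwell's equations\<close>

text \<open>
  Symmetric uniformly elliptic tensors in \<open>L\<^sup>\<infinity>\<close>, with bounds independent of time. Since the
  equations are imposed at all times, the conditions are too (and not merely at almost all times).
\<close>

definition material_tensor :: "(real^3) set \<Rightarrow> real set \<Rightarrow> (real \<Rightarrow> real^3 \<Rightarrow> real^3^3) \<Rightarrow> bool" where
  "material_tensor \<Omega> I m \<longleftrightarrow>
     (\<forall>t\<in>I. m t \<in> borel_measurable (lebesgue_on \<Omega>)) \<and>
     (\<exists>M. \<forall>t\<in>I. AE x in lebesgue_on \<Omega>. norm (m t x) \<le> M) \<and>
     (\<forall>t\<in>I. AE x in lebesgue_on \<Omega>. transpose (m t x) = m t x) \<and>
     (\<exists>c>0. \<forall>t\<in>I. AE x in lebesgue_on \<Omega>. \<forall>\<xi>. c * (norm \<xi>)\<^sup>2 \<le> \<xi> \<bullet> (m t x *v \<xi>))"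

text \<open>
  The fields \<open>D = \<epsilon> E\<close> with \<open>E = - (\<partial>\<^sub>t A + grad \<phi>)\<close>, and \<open>H = \<mu>\<^sup>-\<^sup>1 B\<close> with \<open>B = curl A\<close>. The parameters
  \<open>grd\<close> and \<open>crl\<close> are the gradient and curl on the whole domain or the elementwise ones.
\<close>

definition E_field ::
  "(real^3) set \<Rightarrow> real set \<Rightarrow> ((real^3 \<Rightarrow> real) \<Rightarrow> real^3 \<Rightarrow> real^3) \<Rightarrow>
   (real \<Rightarrow> real^3 \<Rightarrow> real^3) \<Rightarrow> (real \<Rightarrow> real^3 \<Rightarrow> real) \<Rightarrow> real \<Rightarrow> real^3 \<Rightarrow> real^3" where
  "E_field \<Omega> I grd A \<phi> t x = - (time_deriv \<Omega> I A t x + grd (\<phi> t) x)"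

definition D_field ::
  "(real^3) set \<Rightarrow> real set \<Rightarrow> (real \<Rightarrow> real^3 \<Rightarrow> real^3^3) \<Rightarrow>
   ((real^3 \<Rightarrow> real) \<Rightarrow> real^3 \<Rightarrow> real^3) \<Rightarrow>
   (real \<Rightarrow> real^3 \<Rightarrow> real^3) \<Rightarrow> (real \<Rightarrow> real^3 \<Rightarrow> real) \<Rightarrow> real \<Rightarrow> real^3 \<Rightarrow> real^3" where
  "D_field \<Omega> I \<epsilon> grd A \<phi> t x = \<epsilon> t x *v E_field \<Omega> I grd A \<phi> t x"

definition H_field ::
  "(real \<Rightarrow> real^3 \<Rightarrow> real^3^3) \<Rightarrow> ((real^3 \<Rightarrow> real^3) \<Rightarrow> real^3 \<Rightarrow> real^3) \<Rightarrow>
   (real \<Rightarrow> real^3 \<Rightarrow> real^3) \<Rightarrow> real \<Rightarrow> real^3 \<Rightarrow> real^3" where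
  "H_field \<mu> crl A t x = matrix_inv (\<mu> t x) *v crl (A t) x"

text \<open>
  Both problems include the standing requirement on the potentials that \<open>D\<close> is a \<open>C\<^sup>1\<close> curve and
  \<open>H\<close> a \<open>C\<^sup>0\<close> curve of square integrable fields.
\<close>

definition maxwell_weak ::
  "(real^3) set \<Rightarrow> real set \<Rightarrow>
   (real \<Rightarrow> real^3 \<Rightarrow> real^3^3) \<Rightarrow> (real \<Rightarrow> real^3 \<Rightarrow> real^3^3) \<Rightarrow>
   (real \<Rightarrow> real^3 \<Rightarrow> real^3) \<Rightarrow> (real \<Rightarrow> real^3 \<Rightarrow> real) \<Rightarrow>
   (real \<Rightarrow> real^3 \<Rightarrow> real^3) \<Rightarrow> (real \<Rightarrow> real^3 \<Rightarrow> real) \<Rightarrow> bool" where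
  "maxwell_weak \<Omega> I \<epsilon> \<mu> J \<rho> A \<phi> \<longleftrightarrow>
     (let D = D_field \<Omega> I \<epsilon> (weak_grad \<Omega>) A \<phi>; H = H_field \<mu> (weak_curl \<Omega>) A in
      C1_curve I (Hcurl_0 \<Omega>) (Hcurl_norm \<Omega>) A \<and>
      C0_curve I (H1_0 \<Omega>) (H1_norm \<Omega>) \<phi> \<and>
      C1_curve I (L2 \<Omega>) (L2_norm \<Omega>) D \<and>
      C0_curve I (L2 \<Omega>) (L2_norm \<Omega>) H \<and>
      (\<forall>t\<in>I.
        (\<forall>A'\<in>Hcurl_0 \<Omega>.
           (LINT x|lebesgue_on \<Omega>.
              A' x \<bullet> (time_deriv \<Omega> I D t x + J t x) - weak_curl \<Omega> A' x \<bullet> H t x) = 0) \<and>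
        (\<forall>\<phi>'\<in>H1_0 \<Omega>.
           (LINT x|lebesgue_on \<Omega>. weak_grad \<Omega> \<phi>' x \<bullet> D t x + \<phi>' x * \<rho> t x) = 0)))"

definition maxwell_dd ::
  "(real^3) set \<Rightarrow> (real^3) set set \<Rightarrow> real set \<Rightarrow>
   (real \<Rightarrow> real^3 \<Rightarrow> real^3^3) \<Rightarrow> (real \<Rightarrow> real^3 \<Rightarrow> real^3^3) \<Rightarrow>
   (real \<Rightarrow> real^3 \<Rightarrow> real^3) \<Rightarrow> (real \<Rightarrow> real^3 \<Rightarrow> real) \<Rightarrow>
   (real \<Rightarrow> real^3 \<Rightarrow> real^3) \<Rightarrow> (real \<Rightarrow> real^3 \<Rightarrow> real) \<Rightarrow>
   (real \<Rightarrow> real^3 \<Rightarrow> real^3) \<Rightarrow> (real \<Rightarrow> real^3 \<Rightarrow> real^3) \<Rightarrow> bool" where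
  "maxwell_dd \<Omega> \<T> I \<epsilon> \<mu> J \<rho> A \<phi> Hh Dh \<longleftrightarrow>
     (let D = D_field \<Omega> I \<epsilon> (broken_grad \<T>) A \<phi>; H = H_field \<mu> (broken_curl \<T>) A in
      C1_curve I (broken_Hcurl \<Omega> \<T>) (broken_Hcurl_norm \<Omega> \<T>) A \<and>
      C0_curve I (broken_H1 \<Omega> \<T>) (broken_H1_norm \<Omega> \<T>) \<phi> \<and>
      C0_curve I (Hcurl \<Omega>) (Hcurl_norm \<Omega>) Hh \<and>
      C0_curve I (Hdiv \<Omega>) (Hdiv_norm \<Omega>) Dh \<and>
      C1_curve I (L2 \<Omega>) (L2_norm \<Omega>) D \<and>
      C0_curve I (L2 \<Omega>) (L2_norm \<Omega>) H \<and>
      (\<forall>t\<in>I.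
        (\<forall>K\<in>\<T>. \<forall>A'\<in>Hcurl (interior K).
           (LINT x|lebesgue_on (interior K).
              A' x \<bullet> (time_deriv \<Omega> I D t x + J t x) - weak_curl (interior K) A' x \<bullet> H t x)
           + bdry_cross (interior K) A' (Hh t) = 0) \<and>
        (\<forall>K\<in>\<T>. \<forall>\<phi>'\<in>H1 (interior K).
           (LINT x|lebesgue_on (interior K).
              weak_grad (interior K) \<phi>' x \<bullet> D t x + \<phi>' x * \<rho> t x)
           - bdry_flux (interior K) \<phi>' (Dh t) = 0) \<and>
        (\<forall>H'\<in>Hcurl \<Omega>. (\<Sum>K\<in>\<T>. bdry_cross (interior K) (A t) H') = 0) \<and>
        (\<forall>D'\<in>Hdiv \<Omega>. (\<Sum>K\<in>\<T>. bdry_flux (interior K) (\<phi> t) D') = 0)))"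

end

theory Submission
  imports Defs
begin

text \<open>
  Gradient, curl and divergence are instances of one situation: a pair of first order operators
  \<open>P\<close>, \<open>Q\<close> which are formally adjoint up to sign, with the boundary pairing of \<open>u\<close> and \<open>w\<close> defined by
  Green's formula. Testing the element equations with test functions supported in the element shows
  that the field \<open>G\<close> (\<open>H\<close> or \<open>D\<close>) has the weak derivative \<open>F\<close> (\<open>\<partial>\<^sub>t D + J\<close> or \<open>\<rho>\<close>) prescribed by Maxwell's
  equations, and then the element equations say exactly that the traces of \<open>G\<close> and of the hatted
  unknown agree. The jump conditions, tested with test functions on the domain, say that the
  elementwise derivative of the potential is its weak derivative on the whole domain, and then,
  tested with arbitrary fields, that its trace vanishes. Summation over the elements turns the
  element equations into the global weak equations. The time derivative of \<open>A\<close> satisfies the jump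
  conditions because the boundary pairing is continuous in the broken norm.
\<close>

section \<open>Square integrable functions\<close>

text \<open>Weak derivatives are arbitrary choices among representatives, made anew on every open
  set, so \<open>weak_curl\<close> on an element and on the domain agree at best almost everywhere.
  Passing between them rests on uniqueness of weak derivatives, that is, on the fundamental lemma;
  the smooth box bumps are built for it. For the same reason the two problems do not share literally
  the same D and H: integrals, norms, curves and time derivatives have to be transported along
  almost everywhere equality, and this is done without asking for measurability of integrands.

  Since traces are functionals given by Green's formula, neither a trace theorem nor density of
  smooth functions enters: a zero trace is by definition the vanishing of all pairings, and the jump
  terms are sums of such pairings. The geometry enters only through the five facts of the locale
  \<open>mesh\<close>. The delicate one is that element interiors lie in the domain: the elements
  fill the closure, and an open set with a slit is smaller than the interior of its closure. The
  Lipschitz graphs exclude slits.\<close>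

lemma borel_measurable_AE_cong_lebesgue_on:
  fixes f g :: "'a::euclidean_space \<Rightarrow> 'b::euclidean_space"
  assumes S: "S \<in> sets lebesgue" and ae: "AE x in lebesgue_on S. f x = g x"
    and f: "f \<in> borel_measurable (lebesgue_on S)"
  shows "g \<in> borel_measurable (lebesgue_on S)"
proof -
  let ?f = "\<lambda>x. if x \<in> S then f x else 0" and ?g = "\<lambda>x. if x \<in> S then g x else 0"
  have "AE x in lebesgue. x \<in> S \<longrightarrow> f x = g x"
    using ae S by (subst (asm) AE_restrict_space_iff) auto
  then obtain N where N: "negligible N" "\<And>x. x \<in> S - N \<Longrightarrow> f x = g x"
    by (auto simp: eventually_ae_filter_negligible)
  have f': "?f \<in> borel_measurable lebesgue"
    using f S borel_measurable_if by blast
  have "?g \<in> borel_measurable lebesgue"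
  proof (rule borel_measurableI)
    fix T :: "'b set"
    assume "open T"
    then have T: "?f -` T \<in> sets lebesgue"
      using measurable_sets[OF f', of T] by simp
    have "negligible (?g -` T \<inter> N)"
      using N(1) by (meson inf_le2 negligible_subset)
    then have gN: "?g -` T \<inter> N \<in> sets lebesgue"
      by (rule negligible_imp_sets)
    have eq: "?g -` T \<inter> space lebesgue = (?f -` T - N) \<union> (?g -` T \<inter> N)"
      using N(2) by (auto split: if_splits)
    show "?g -` T \<inter> space lebesgue \<in> sets lebesgue"
      unfolding eq by (intro sets.Un sets.Diff T gN negligible_imp_sets N(1))
  qed
  then show ?thesis
    using S borel_measurable_if by blast
qed

text \<open>No measurability is assumed. Lebesgue measure is complete, so null sets cannot spoil
  measurability: \<open>f\<close> and \<open>g\<close> are measurable together, and if neither is,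
  both integrals have the default value 0.\<close>

lemma integral_AE_cong_lebesgue_on:
  fixes f g :: "'a::euclidean_space \<Rightarrow> 'b::euclidean_space"
  assumes S: "S \<in> sets lebesgue" and ae: "AE x in lebesgue_on S. f x = g x"
  shows "(LINT x|lebesgue_on S. f x) = (LINT x|lebesgue_on S. g x)"
proof (cases "f \<in> borel_measurable (lebesgue_on S)")
  case True
  then show ?thesis
    using borel_measurable_AE_cong_lebesgue_on[OF S ae] ae by (intro integral_cong_AE) auto
next
  case False
  moreover have "AE x in lebesgue_on S. g x = f x"
    using ae by eventually_elim simp
  ultimately have "g \<notin> borel_measurable (lebesgue_on S)"
    using borel_measurable_AE_cong_lebesgue_on[OF S] by blast
  then show ?thesis
    using False by (metis borel_measurable_integrable not_integrable_integral_eq)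
qed

lemma AE_lebesgue_on_mono:
  assumes "AE x in lebesgue_on S. P x" "T \<subseteq> S" "S \<in> sets lebesgue" "T \<in> sets lebesgue"
  shows "AE x in lebesgue_on T. P x"
  using assms by (auto simp: AE_restrict_space_iff elim!: eventually_mono)

lemma integrable_lebesgue_on_mono:
  fixes f :: "'a::euclidean_space \<Rightarrow> 'b::{banach, second_countable_topology}"
  assumes "integrable (lebesgue_on S) f" and "T \<subseteq> S" "S \<in> sets lebesgue" "T \<in> sets lebesgue"
  shows "integrable (lebesgue_on T) f"
proof -
  have "integrable lebesgue (\<lambda>x. indicator S x *\<^sub>R f x)"
    using assms by (simp add: integrable_restrict_space)
  then have "integrable lebesgue (\<lambda>x. indicator T x *\<^sub>R indicator S x *\<^sub>R f x)"
    by (rule integrable_mult_indicator[OF assms(4)])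
  moreover have "(\<lambda>x. indicator T x *\<^sub>R indicator S x *\<^sub>R f x) = (\<lambda>x. indicator T x *\<^sub>R f x)"
    using assms(2) by (auto simp: fun_eq_iff split: split_indicator)
  ultimately show ?thesis
    using assms(4) by (simp add: integrable_restrict_space)
qed

section \<open>The vector space of square integrable functions and its seminorm\<close>

lemma L2_measurable: "f \<in> L2 S \<Longrightarrow> f \<in> borel_measurable (lebesgue_on S)"
  by (simp add: L2_def)

lemma L2_integrable: "f \<in> L2 S \<Longrightarrow> integrable (lebesgue_on S) (\<lambda>x. (norm (f x))\<^sup>2)"
  by (simp add: L2_def)

lemma L2_AE_cong:
  assumes S: "S \<in> sets lebesgue" and ae: "AE x in lebesgue_on S. f x = g x" and f: "f \<in> L2 S"
  shows "g \<in> L2 S"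
proof -
  have g: "g \<in> borel_measurable (lebesgue_on S)"
    using borel_measurable_AE_cong_lebesgue_on[OF S ae] f L2_measurable by blast
  moreover have "integrable (lebesgue_on S) (\<lambda>x. (norm (g x))\<^sup>2)"
  proof (rule integrable_cong_AE_imp[OF L2_integrable[OF f]])
    show "AE x in lebesgue_on S. (norm (f x))\<^sup>2 = (norm (g x))\<^sup>2"
      using ae by eventually_elim simp
  qed (use g in simp)
  ultimately show ?thesis
    by (simp add: L2_def)
qed

lemma L2_norm_AE_cong:
  assumes "S \<in> sets lebesgue" and "AE x in lebesgue_on S. f x = g x"
  shows "L2_norm S f = L2_norm S g"
  unfolding L2_norm_def using assms
  by (intro arg_cong[where f=sqrt] integral_AE_cong_lebesgue_on) (auto elim: eventually_mono)

lemma L2_mono: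
  assumes f: "f \<in> L2 S" and "T \<subseteq> S" "S \<in> sets lebesgue" "T \<in> sets lebesgue"
  shows "f \<in> L2 T"
proof -
  have "f \<in> borel_measurable (lebesgue_on T)"
    by (rule measurable_restrict_mono[OF L2_measurable[OF f] assms(2)])
  moreover have "integrable (lebesgue_on T) (\<lambda>x. (norm (f x))\<^sup>2)"
    by (rule integrable_lebesgue_on_mono[OF L2_integrable[OF f] assms(2-4)])
  ultimately show ?thesis
    by (simp add: L2_def)
qed

lemma L2_inner_integrable:
  assumes f: "f \<in> L2 S" and g: "g \<in> L2 S"
  shows "integrable (lebesgue_on S) (\<lambda>x. f x \<bullet> g x)"
proof (rule Bochner_Integration.integrable_bound)
  show "integrable (lebesgue_on S) (\<lambda>x. (norm (f x))\<^sup>2 + (norm (g x))\<^sup>2)"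
    using L2_integrable[OF f] L2_integrable[OF g] by simp
  show "(\<lambda>x. f x \<bullet> g x) \<in> borel_measurable (lebesgue_on S)"
    using L2_measurable[OF f] L2_measurable[OF g] by simp
  have "\<bar>f x \<bullet> g x\<bar> \<le> (norm (f x))\<^sup>2 + (norm (g x))\<^sup>2" for x
  proof -
    have "\<bar>f x \<bullet> g x\<bar> \<le> norm (f x) * norm (g x)"
      by (rule Cauchy_Schwarz_ineq2)
    also have "\<dots> \<le> (norm (f x))\<^sup>2 + (norm (g x))\<^sup>2"
      using sum_squares_bound[of "norm (f x)" "norm (g x)"] mult_nonneg_nonneg[OF norm_ge_zero norm_ge_zero, of "f x" "g x"]
      by linarith
    finally show ?thesis .
  qed
  then show "AE x in lebesgue_on S. norm (f x \<bullet> g x) \<le> norm ((norm (f x))\<^sup>2 + (norm (g x))\<^sup>2)"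
    by (auto intro!: AE_I2 order_trans[OF _ abs_ge_self])
qed

lemma L2_scaleR:
  assumes "f \<in> L2 S"
  shows "(\<lambda>x. c *\<^sub>R f x) \<in> L2 S"
  using assms by (auto simp: L2_def power_mult_distrib)

lemma L2_uminus:
  assumes "f \<in> L2 S"
  shows "(\<lambda>x. - f x) \<in> L2 S"
  using L2_scaleR[OF assms, of "-1"] by simp

lemma L2_add:
  assumes f: "f \<in> L2 S" and g: "g \<in> L2 S"
  shows "(\<lambda>x. f x + g x) \<in> L2 S"
proof -
  have "integrable (lebesgue_on S) (\<lambda>x. (norm (f x))\<^sup>2 + 2 * (f x \<bullet> g x) + (norm (g x))\<^sup>2)"
    using L2_integrable[OF f] L2_integrable[OF g] L2_inner_integrable[OF f g] by auto
  then show ?thesis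
    using f g by (auto simp: L2_def power2_norm_eq_inner inner_add_left inner_add_right
        inner_commute algebra_simps)
qed

lemma L2_diff:
  assumes "f \<in> L2 S" and "g \<in> L2 S"
  shows "(\<lambda>x. f x - g x) \<in> L2 S"
  using L2_add[OF assms(1) L2_uminus[OF assms(2)]] by simp

lemma L2_zero: "(\<lambda>x. 0) \<in> L2 S"
  by (simp add: L2_def)

lemma L2_norm_nonneg: "0 \<le> L2_norm S f"
  by (simp add: L2_norm_def)

lemma L2_norm_power2: "(L2_norm S f)\<^sup>2 = (LINT x|lebesgue_on S. (norm (f x))\<^sup>2)"
  by (simp add: L2_norm_def)

lemma L2_norm_scaleR: "L2_norm S (\<lambda>x. c *\<^sub>R f x) = \<bar>c\<bar> * L2_norm S f"
  by (simp add: L2_norm_def power_mult_distrib real_sqrt_mult)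

lemma L2_norm_minus_commute: "L2_norm S (\<lambda>x. f x - g x) = L2_norm S (\<lambda>x. g x - f x)"
  by (simp add: L2_norm_def norm_minus_commute)

lemma L2_norm_add_power2:
  assumes f: "f \<in> L2 S" and g: "g \<in> L2 S"
  shows "(L2_norm S (\<lambda>x. f x + g x))\<^sup>2 =
    (L2_norm S f)\<^sup>2 + 2 * (LINT x|lebesgue_on S. f x \<bullet> g x) + (L2_norm S g)\<^sup>2"
proof -
  have "(L2_norm S (\<lambda>x. f x + g x))\<^sup>2 =
      (LINT x|lebesgue_on S. (norm (f x))\<^sup>2 + 2 * (f x \<bullet> g x) + (norm (g x))\<^sup>2)"
    by (simp add: L2_norm_power2 power2_norm_eq_inner inner_add_left inner_add_right
        inner_commute algebra_simps)
  then show ?thesis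
    using L2_integrable[OF f] L2_integrable[OF g] L2_inner_integrable[OF f g]
    by (simp add: L2_norm_power2)
qed

text \<open>A quadratic in \<open>t\<close> without negative values cannot have a positive
  discriminant: evaluate it at its vertex \<open>- b / c\<close>. If \<open>c = 0\<close> and
  \<open>b\<close> were nonzero, the chosen \<open>t\<close> would give the value -1.\<close>

lemma discriminant_bound:
  fixes a b c :: real
  assumes "0 \<le> c" and pos: "\<And>t. 0 \<le> a + 2 * t * b + t\<^sup>2 * c"
  shows "b\<^sup>2 \<le> a * c"
proof (cases "c = 0")
  case True
  have "b = 0"
  proof (rule ccontr)
    assume "b \<noteq> 0"
    then show False
      using pos[of "- (a + 1) / (2 * b)"] True by (simp add: field_simps)
  qed
  then show ?thesis
    using True by simp
next
  case False
  then have "0 < c"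
    using assms(1) by simp
  have "2 * (- b / c) * b = - 2 * (b\<^sup>2 / c)" "(- b / c)\<^sup>2 * c = b\<^sup>2 / c"
    using False by (simp_all add: power2_eq_square)
  then have "b\<^sup>2 / c \<le> a"
    using pos[of "- b / c"] by linarith
  then show ?thesis
    using \<open>0 < c\<close> by (simp add: divide_le_eq)
qed

text \<open>The squared seminorm of \<open>f + t g\<close> is a nonnegative quadratic in
  \<open>t\<close>. This also covers \<open>L2_norm S g = 0\<close>, which does not force a
  representative \<open>g\<close> to vanish everywhere.\<close>

lemma L2_Cauchy_Schwarz:
  assumes f: "f \<in> L2 S" and g: "g \<in> L2 S"
  shows "\<bar>LINT x|lebesgue_on S. f x \<bullet> g x\<bar> \<le> L2_norm S f * L2_norm S g"
proof -
  let ?a = "(L2_norm S f)\<^sup>2" and ?b = "LINT x|lebesgue_on S. f x \<bullet> g x" and ?c = "(L2_norm S g)\<^sup>2"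
  have pos: "0 \<le> ?a + 2 * t * ?b + t\<^sup>2 * ?c" for t
  proof -
    have "?a + 2 * t * ?b + t\<^sup>2 * ?c = (L2_norm S (\<lambda>x. f x + t *\<^sub>R g x))\<^sup>2"
      using L2_norm_add_power2[OF f L2_scaleR[OF g, of t]]
      by (simp add: L2_norm_scaleR power_mult_distrib)
    then show ?thesis
      by simp
  qed
  have "?b\<^sup>2 \<le> ?a * ?c"
    by (rule discriminant_bound[OF _ pos]) simp
  then have "?b\<^sup>2 \<le> (L2_norm S f * L2_norm S g)\<^sup>2"
    by (simp add: power_mult_distrib)
  then show ?thesis
    by (metis L2_norm_nonneg abs_le_square_iff abs_of_nonneg mult_nonneg_nonneg)
qed

lemma L2_norm_triangle:
  assumes f: "f \<in> L2 S" and g: "g \<in> L2 S"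
  shows "L2_norm S (\<lambda>x. f x + g x) \<le> L2_norm S f + L2_norm S g"
proof (rule power2_le_imp_le)
  show "(L2_norm S (\<lambda>x. f x + g x))\<^sup>2 \<le> (L2_norm S f + L2_norm S g)\<^sup>2"
    using L2_Cauchy_Schwarz[OF f g] by (simp add: L2_norm_add_power2[OF f g] power2_sum)
qed (simp add: L2_norm_nonneg)

lemma L2_norm_eq_0:
  assumes "f \<in> L2 S" and "L2_norm S f = 0"
  shows "AE x in lebesgue_on S. f x = 0"
  using assms integral_nonneg_eq_0_iff_AE[OF L2_integrable[OF assms(1)]]
  by (simp add: L2_norm_def)

section \<open>Integration by parts for test functions\<close>

lemma partial_deriv_eq: "(f has_derivative f') (at x) \<Longrightarrow> partial_deriv i f x = f' (axis i 1)"
  using frechet_derivative_at by (metis partial_deriv_def)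

lemma C1_differentiable: "Ck (Suc 0) f \<Longrightarrow> f differentiable (at x)"
  by simp

lemma C1_continuous_partial: "Ck (Suc 0) f \<Longrightarrow> continuous_on UNIV (partial_deriv i f)"
  by simp

lemma C1_continuous: "Ck (Suc 0) f \<Longrightarrow> continuous_on UNIV f"
  by (metis C1_differentiable continuous_at_imp_continuous_on differentiable_imp_continuous_within)

text \<open>The complement of \<open>C\<close> is an open neighbourhood of \<open>x\<close> on which
  \<open>f\<close> is constant, which supplies differentiability at \<open>x\<close> too.\<close>

lemma partial_deriv_outside:
  assumes "closed C" and zero: "\<And>x. x \<notin> C \<Longrightarrow> f x = 0" and x: "x \<notin> C"
  shows "partial_deriv i f x = 0"
proof -
  have "((\<lambda>x. 0) has_derivative (\<lambda>x. 0)) (at x)"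
    by simp
  then have "(f has_derivative (\<lambda>x. 0)) (at x)"
    by (rule has_derivative_transform_within_open[of _ _ _ _ "- C"])
       (use assms in \<open>auto simp: open_Compl\<close>)
  then show ?thesis
    by (simp add: partial_deriv_eq)
qed

lemma C1_inner:
  assumes "Ck (Suc 0) f"
  shows "Ck (Suc 0) (\<lambda>x. f x \<bullet> b)"
    and "partial_deriv i (\<lambda>x. f x \<bullet> b) x = partial_deriv i f x \<bullet> b"
proof -
  have d: "((\<lambda>x. f x \<bullet> b) has_derivative (\<lambda>h. frechet_derivative f (at x) h \<bullet> b)) (at x)" for x
    using C1_differentiable[OF assms] frechet_derivative_works
    by (intro has_derivative_inner_left) auto
  have eq: "partial_deriv i (\<lambda>x. f x \<bullet> b) x = partial_deriv i f x \<bullet> b" for i x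
    using partial_deriv_eq[OF d] by (simp add: partial_deriv_def)
  show "partial_deriv i (\<lambda>x. f x \<bullet> b) x = partial_deriv i f x \<bullet> b"
    by (rule eq)
  have "continuous_on UNIV (\<lambda>x. partial_deriv i f x \<bullet> b)" for i
    using C1_continuous_partial[OF assms] by (intro continuous_intros)
  then show "Ck (Suc 0) (\<lambda>x. f x \<bullet> b)"
    using d eq by (auto simp: differentiable_def)
qed

lemma C1_mult:
  fixes f g :: "real^3 \<Rightarrow> real"
  assumes f: "Ck (Suc 0) f" and g: "Ck (Suc 0) g"
  shows "Ck (Suc 0) (\<lambda>x. f x * g x)"
    and "partial_deriv i (\<lambda>x. f x * g x) x = f x * partial_deriv i g x + partial_deriv i f x * g x"
proof -
  have d: "((\<lambda>x. f x * g x) has_derivative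
      (\<lambda>h. f x * frechet_derivative g (at x) h + frechet_derivative f (at x) h * g x)) (at x)" for x
    using C1_differentiable[OF f] C1_differentiable[OF g] frechet_derivative_works
    by (intro has_derivative_mult) auto
  have eq: "partial_deriv i (\<lambda>x. f x * g x) x = f x * partial_deriv i g x + partial_deriv i f x * g x"
    for i x
    using partial_deriv_eq[OF d] by (simp add: partial_deriv_def)
  show "partial_deriv i (\<lambda>x. f x * g x) x = f x * partial_deriv i g x + partial_deriv i f x * g x"
    by (rule eq)
  have "continuous_on UNIV (\<lambda>x. f x * partial_deriv i g x + partial_deriv i f x * g x)" for i
    using C1_continuous_partial[OF f] C1_continuous_partial[OF g] C1_continuous[OF f] C1_continuous[OF g]
    by (intro continuous_intros)
  then show "Ck (Suc 0) (\<lambda>x. f x * g x)"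
    using d eq by (auto simp: differentiable_def fun_eq_iff)
qed

lemma integrable_compact_support:
  fixes f :: "'a::euclidean_space \<Rightarrow> 'b::euclidean_space"
  assumes "continuous_on UNIV f" and "compact C" and "\<And>x. x \<notin> C \<Longrightarrow> f x = 0"
  shows "integrable lborel f"
proof -
  have "integrable lborel (\<lambda>x. indicator C x *\<^sub>R f x)"
    using assms by (intro borel_integrable_compact) (auto intro: continuous_on_subset)
  moreover have "(\<lambda>x. indicator C x *\<^sub>R f x) = f"
    using assms by (auto simp: indicator_def)
  ultimately show ?thesis
    by simp
qed

lemma bounded_compact_support:
  fixes f :: "'a::metric_space \<Rightarrow> 'b::real_normed_vector"
  assumes "continuous_on UNIV f" and "compact C" and "\<And>x. x \<notin> C \<Longrightarrow> f x = 0"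
  obtains M where "0 \<le> M" "\<And>x. norm (f x) \<le> M"
proof -
  have "bounded (f ` C)"
    using assms by (meson compact_continuous_image compact_imp_bounded continuous_on_subset top_greatest)
  then obtain M where M: "\<And>x. x \<in> C \<Longrightarrow> norm (f x) \<le> M" "0 < M"
    by (auto simp: bounded_pos)
  then have "norm (f x) \<le> M" for x
    using assms(3) by (cases "x \<in> C") auto
  then show ?thesis
    using M(2) that by (metis less_imp_le)
qed

text \<open>The difference quotients of \<open>h\<close> have integral zero by translation invariance and converge boundedly.\<close>

lemma integral_partial_deriv:
  fixes h :: "real^3 \<Rightarrow> real"
  assumes h: "Ck (Suc 0) h" and C: "compact C" "\<And>x. x \<notin> C \<Longrightarrow> h x = 0"
  shows "(LINT x|lborel. partial_deriv i h x) = 0"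
proof -
  let ?e = "axis i (1::real) :: real^3"
  let ?D = "partial_deriv i h"
  define q where "q n x = (h (x + inverse (real (Suc n)) *\<^sub>R ?e) - h x) * real (Suc n)" for n x
  have D0: "?D x = 0" if "x \<notin> C" for x
    using partial_deriv_outside[of C h] C that compact_imp_closed by blast
  obtain M where M: "0 \<le> M" "\<And>x. norm (?D x) \<le> M"
    using bounded_compact_support[OF C1_continuous_partial[OF h] C(1) D0] by metis
  obtain R where R: "\<And>x. x \<in> C \<Longrightarrow> norm x \<le> R"
    using compact_imp_bounded[OF C(1)] by (auto simp: bounded_iff)
  have line: "((\<lambda>t. h (x + t *\<^sub>R ?e)) has_real_derivative ?D (x + t *\<^sub>R ?e)) (at t)" for x t
  proof -
    have "(h has_derivative frechet_derivative h (at (x + t *\<^sub>R ?e))) (at (x + t *\<^sub>R ?e))"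
      using C1_differentiable[OF h] frechet_derivative_works by blast
    moreover have "((\<lambda>t. x + t *\<^sub>R ?e) has_derivative (\<lambda>s. s *\<^sub>R ?e)) (at t)"
      by (auto intro!: derivative_eq_intros)
    ultimately have "((\<lambda>t. h (x + t *\<^sub>R ?e)) has_derivative
        (\<lambda>s. frechet_derivative h (at (x + t *\<^sub>R ?e)) (s *\<^sub>R ?e))) (at t)"
      using has_derivative_compose by fastforce
    moreover have "linear (frechet_derivative h (at (x + t *\<^sub>R ?e)))"
      using C1_differentiable[OF h] linear_frechet_derivative by blast
    ultimately show ?thesis
      by (simp add: has_field_derivative_def partial_deriv_def linear_scale mult_commute_abs)
  qed
  \<comment> \<open>The radius grows by 1 because the step \<open>1/(n+1)\<close> is at most 1:
    outside the larger ball both \<open>x\<close> and the shifted point miss \<open>C\<close>.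
    Inside, the mean value theorem bounds the quotient by \<open>M\<close>.\<close>
  have bound: "\<bar>q n x\<bar> \<le> M * indicator (cball 0 (R + 1)) x" for n x
  proof (cases "x \<in> cball 0 (R + 1)")
    case True
    let ?d = "inverse (real (Suc n))"
    obtain z where "h (x + ?d *\<^sub>R ?e) - h (x + 0 *\<^sub>R ?e) = (?d - 0) * ?D (x + z *\<^sub>R ?e)"
      using MVT2[of 0 ?d "\<lambda>t. h (x + t *\<^sub>R ?e)" "\<lambda>t. ?D (x + t *\<^sub>R ?e)"] line by auto
    then have "q n x = ?D (x + z *\<^sub>R ?e)"
      by (simp add: q_def field_simps)
    then show ?thesis
      using True M(2)[of "x + z *\<^sub>R ?e"] by simp
  next
    case False
    have "norm (inverse (real (Suc n)) *\<^sub>R ?e) \<le> 1"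
      by (simp add: norm_axis_1 inverse_le_1_iff)
    then have "norm (x + inverse (real (Suc n)) *\<^sub>R ?e) \<ge> norm x - 1"
      using norm_diff_ineq[of x "inverse (real (Suc n)) *\<^sub>R ?e"] by linarith
    then have "x + inverse (real (Suc n)) *\<^sub>R ?e \<notin> C" "x \<notin> C"
      using False R by (force simp: dist_norm)+
    then show ?thesis
      using C(2) M(1) by (simp add: q_def)
  qed
  have lim: "(\<lambda>n. q n x) \<longlonglongrightarrow> ?D x" for x
  proof -
    have "((\<lambda>t. (h (x + t *\<^sub>R ?e) - h x) / t) \<longlongrightarrow> ?D x) (at 0)"
      using line[of x 0] by (simp add: has_field_derivative_iff)
    moreover have "filterlim (\<lambda>n. inverse (real (Suc n))) (at 0) sequentially"
      using LIMSEQ_inverse_real_of_nat by (auto simp: filterlim_at)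
    ultimately have "(\<lambda>n. (h (x + inverse (real (Suc n)) *\<^sub>R ?e) - h x) / inverse (real (Suc n))) \<longlonglongrightarrow> ?D x"
      by (rule filterlim_compose)
    then show ?thesis
      by (simp add: q_def field_simps)
  qed
  have hint: "integrable lborel h"
    by (rule integrable_compact_support[OF C1_continuous[OF h] C])
  have [measurable]: "h \<in> borel_measurable borel" "?D \<in> borel_measurable borel"
    using C1_continuous[OF h] C1_continuous_partial[OF h] borel_measurable_continuous_onI by blast+
  have shift: "(LINT x|lborel. h (x + a)) = (LINT x|lborel. h x)" "integrable lborel (\<lambda>x. h (x + a))" for a
  proof -
    have "(LINT x|lborel. h x) = (LINT x|distr lborel borel ((+) a). h x)"
      by (simp add: lborel_distr_plus)
    also have "\<dots> = (LINT x|lborel. h (a + x))"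
      by (subst integral_distr) auto
    finally show "(LINT x|lborel. h (x + a)) = (LINT x|lborel. h x)"
      by (simp add: add.commute)
    have "integrable (distr lborel borel ((+) a)) h"
      using hint by (simp add: lborel_distr_plus)
    then show "integrable lborel (\<lambda>x. h (x + a))"
      by (subst (asm) integrable_distr_eq) (auto simp: add.commute)
  qed
  have "(\<lambda>n. LINT x|lborel. q n x) \<longlonglongrightarrow> (LINT x|lborel. ?D x)"
  proof (rule integral_dominated_convergence)
    show "integrable lborel (\<lambda>x. M * indicator (cball 0 (R + 1)) x :: real)"
      by (intro integrable_mult_right integrable_real_indicator) (auto simp: emeasure_lborel_cball_finite[unfolded infinity_ennreal_def])
    show "AE x in lborel. norm (q n x) \<le> M * indicator (cball 0 (R + 1)) x" for n
      using bound by auto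
    show "q n \<in> borel_measurable lborel" for n
      unfolding q_def by measurable
  qed (use lim in auto)
  moreover have "(LINT x|lborel. q n x) = 0" for n
    unfolding q_def using hint shift by simp
  ultimately show ?thesis
    by (simp add: LIMSEQ_const_iff)
qed

text \<open>Support of \<open>g\<close> in a compact set carries over to the product
  \<open>f g\<close>, whose partial derivative has integral zero; expand it by the product
  rule.\<close>

lemma integral_by_parts_partial_deriv:
  fixes f g :: "real^3 \<Rightarrow> real"
  assumes f: "Ck (Suc 0) f" and g: "Ck (Suc 0) g" and C: "compact C" "\<And>x. x \<notin> C \<Longrightarrow> g x = 0"
  shows "integrable lborel (\<lambda>x. f x * partial_deriv i g x)"
    and "integrable lborel (\<lambda>x. partial_deriv i f x * g x)"
    and "(LINT x|lborel. f x * partial_deriv i g x) = - (LINT x|lborel. partial_deriv i f x * g x)"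
proof -
  have g0: "partial_deriv i g x = 0" if "x \<notin> C" for x
    using partial_deriv_outside[of C g] C that compact_imp_closed by blast
  show i1: "integrable lborel (\<lambda>x. f x * partial_deriv i g x)"
    using C g0 C1_continuous[OF f] C1_continuous_partial[OF g]
    by (intro integrable_compact_support[of _ C] continuous_intros) auto
  show i2: "integrable lborel (\<lambda>x. partial_deriv i f x * g x)"
    using C C1_continuous_partial[OF f] C1_continuous[OF g]
    by (intro integrable_compact_support[of _ C] continuous_intros) auto
  have "(LINT x|lborel. f x * partial_deriv i g x + partial_deriv i f x * g x) = 0"
    using integral_partial_deriv[OF C1_mult(1)[OF f g] C(1)] C(2) by (simp add: C1_mult(2)[OF f g])
  then show "(LINT x|lborel. f x * partial_deriv i g x) = - (LINT x|lborel. partial_deriv i f x * g x)"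
    using i1 i2 by simp
qed

section \<open>Test functions as square integrable functions, and integration by parts on a
  subset\<close>

lemma test_functions_C1: "f \<in> test_functions S \<Longrightarrow> Ck (Suc 0) f"
  unfolding test_functions_def by blast

lemma test_functions_support:
  assumes "f \<in> test_functions S"
  obtains C where "compact C" "C \<subseteq> S" "\<And>x. x \<notin> C \<Longrightarrow> f x = 0"
  using assms unfolding test_functions_def by blast

lemma test_functions_mono: "S \<subseteq> T \<Longrightarrow> f \<in> test_functions S \<Longrightarrow> f \<in> test_functions T"
  unfolding test_functions_def by blast

lemma test_functions_outside: "f \<in> test_functions S \<Longrightarrow> x \<notin> S \<Longrightarrow> f x = 0"
  unfolding test_functions_def by blast

lemma partial_deriv_test_outside:
  assumes "f \<in> test_functions S" "x \<notin> S"
  shows "partial_deriv i f x = 0"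
proof -
  obtain C where "compact C" "C \<subseteq> S" "\<And>x. x \<notin> C \<Longrightarrow> f x = 0"
    using assms(1) test_functions_support by metis
  then show ?thesis
    using assms(2) partial_deriv_outside[of C f x] compact_imp_closed by blast
qed

lemma L2_compact_support:
  fixes f :: "real^3 \<Rightarrow> 'b::euclidean_space"
  assumes f: "continuous_on UNIV f" and C: "compact C" "\<And>x. x \<notin> C \<Longrightarrow> f x = 0"
    and S: "S \<in> sets lebesgue"
  shows "f \<in> L2 S"
proof -
  have "f \<in> borel_measurable borel"
    using f by (rule borel_measurable_continuous_onI)
  then have "f \<in> borel_measurable lebesgue"
    by (simp add: measurable_completion)
  moreover have "integrable lborel (\<lambda>x. (norm (f x))\<^sup>2)"
    using f C by (intro integrable_compact_support[of _ C] continuous_intros) auto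
  then have "integrable lebesgue (\<lambda>x. (norm (f x))\<^sup>2)"
    by (subst integrable_completion) (auto dest: borel_measurable_integrable)
  ultimately show ?thesis
    using S integrable_lebesgue_on_mono[of UNIV "\<lambda>x. (norm (f x))\<^sup>2" S]
    by (auto simp: L2_def measurable_restrict_space1 lebesgue_on_UNIV_eq)
qed

lemma L2_test_functions:
  assumes "f \<in> test_functions UNIV" and "S \<in> sets lebesgue"
  shows "f \<in> L2 S" and "partial_deriv i f \<in> L2 S"
proof -
  obtain C where C: "compact C" "\<And>x. x \<notin> C \<Longrightarrow> f x = 0"
    using assms test_functions_support by metis
  have f: "Ck (Suc 0) f"
    by (rule test_functions_C1[OF assms(1)])
  show "f \<in> L2 S"
    by (rule L2_compact_support[OF C1_continuous[OF f] C assms(2)])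
  show "partial_deriv i f \<in> L2 S"
    using L2_compact_support[OF C1_continuous_partial[OF f] C(1) _ assms(2)] partial_deriv_outside[of C f]
      C compact_imp_closed by blast
qed

lemma integral_lebesgue_on_lborel:
  fixes f :: "real^3 \<Rightarrow> real"
  assumes "S \<in> sets lebesgue" and "integrable lborel f" and "\<And>x. x \<notin> S \<Longrightarrow> f x = 0"
  shows "(LINT x|lebesgue_on S. f x) = (LINT x|lborel. f x)" and "integrable (lebesgue_on S) f"
proof -
  have eq: "(\<lambda>x. indicator S x * f x) = f"
    using assms(3) by (auto simp: fun_eq_iff split: split_indicator)
  have b: "f \<in> borel_measurable lborel"
    using assms(2) by (rule borel_measurable_integrable)
  show "(LINT x|lebesgue_on S. f x) = (LINT x|lborel. f x)"
    using assms(1) b by (simp add: integral_restrict_space eq integral_completion)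
  show "integrable (lebesgue_on S) f"
    using assms(1,2) b by (simp add: integrable_restrict_space eq integrable_completion)
qed

text \<open>Pairing with fixed vectors \<open>b\<close> and \<open>c\<close> reduces vector fields
  to scalar functions. With axis vectors, or the number 1 for scalar fields, this yields each single
  term of gradient, curl and divergence.\<close>

lemma test_functions_by_parts:
  assumes f: "Ck (Suc 0) f" and g: "g \<in> test_functions S" and S: "S \<in> sets lebesgue"
  shows "integrable (lebesgue_on S) (\<lambda>x. (f x \<bullet> b) * (partial_deriv i g x \<bullet> c))"
    and "integrable (lebesgue_on S) (\<lambda>x. (partial_deriv i f x \<bullet> b) * (g x \<bullet> c))"
    and "(LINT x|lebesgue_on S. (f x \<bullet> b) * (partial_deriv i g x \<bullet> c)) =
      - (LINT x|lebesgue_on S. (partial_deriv i f x \<bullet> b) * (g x \<bullet> c))"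
proof -
  obtain C where C: "compact C" "C \<subseteq> S" "\<And>x. x \<notin> C \<Longrightarrow> g x = 0"
    using g test_functions_support by metis
  have g': "Ck (Suc 0) g"
    by (rule test_functions_C1[OF g])
  note * = integral_by_parts_partial_deriv[OF C1_inner(1)[OF f, of b] C1_inner(1)[OF g', of c] C(1),
      unfolded C1_inner(2)[OF f] C1_inner(2)[OF g']]
  note ** = integral_lebesgue_on_lborel[OF S]
  have 1: "integrable lborel (\<lambda>x. (f x \<bullet> b) * (partial_deriv i g x \<bullet> c))"
    and 2: "integrable lborel (\<lambda>x. (partial_deriv i f x \<bullet> b) * (g x \<bullet> c))"
    and 3: "(LINT x|lborel. (f x \<bullet> b) * (partial_deriv i g x \<bullet> c)) =
      - (LINT x|lborel. (partial_deriv i f x \<bullet> b) * (g x \<bullet> c))"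
    using * C(3) by auto
  show "integrable (lebesgue_on S) (\<lambda>x. (f x \<bullet> b) * (partial_deriv i g x \<bullet> c))"
    using **(2)[OF 1] partial_deriv_test_outside[OF g] by simp
  show "integrable (lebesgue_on S) (\<lambda>x. (partial_deriv i f x \<bullet> b) * (g x \<bullet> c))"
    using **(2)[OF 2] test_functions_outside[OF g] by simp
  show "(LINT x|lebesgue_on S. (f x \<bullet> b) * (partial_deriv i g x \<bullet> c)) =
      - (LINT x|lebesgue_on S. (partial_deriv i f x \<bullet> b) * (g x \<bullet> c))"
    using **(1)[OF 1] **(1)[OF 2] 3 partial_deriv_test_outside[OF g] test_functions_outside[OF g] by simp
qed

section \<open>Smooth cut-off functions for boxes\<close>

text \<open>Differentiability \<open>k\<close> times, with no continuity asked of the last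
  derivative; holding for all \<open>k\<close> it means smoothness. The recursion on the derivative
  makes the closure properties plain inductions on \<open>k\<close>.\<close>

primrec diff_upto :: "nat \<Rightarrow> (real \<Rightarrow> real) \<Rightarrow> bool" where
  "diff_upto 0 f \<longleftrightarrow> True"
| "diff_upto (Suc k) f \<longleftrightarrow> (\<exists>f'. (\<forall>x. (f has_real_derivative f' x) (at x)) \<and> diff_upto k f')"

lemma diff_upto_SucD: "diff_upto (Suc k) f \<Longrightarrow> diff_upto k f"
  by (induction k arbitrary: f) auto

lemma diff_upto_SucI:
  "(\<And>x. (f has_real_derivative f' x) (at x)) \<Longrightarrow> diff_upto k f' \<Longrightarrow> diff_upto (Suc k) f"
  by auto

lemma diff_upto_add:
  assumes "diff_upto k f" "diff_upto k g"
  shows "diff_upto k (\<lambda>x. f x + g x)"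
  using assms
proof (induction k arbitrary: f g)
  case (Suc k)
  obtain f' where f': "\<And>x. (f has_real_derivative f' x) (at x)" "diff_upto k f'"
    using Suc.prems(1) by auto
  obtain g' where g': "\<And>x. (g has_real_derivative g' x) (at x)" "diff_upto k g'"
    using Suc.prems(2) by auto
  have "((\<lambda>x. f x + g x) has_real_derivative f' x + g' x) (at x)" for x
    by (intro DERIV_add f' g')
  then show ?case
    by (rule diff_upto_SucI) (rule Suc.IH[OF f'(2) g'(2)])
qed simp

lemma diff_upto_mult:
  assumes "diff_upto k f" "diff_upto k g"
  shows "diff_upto k (\<lambda>x. f x * g x)"
  using assms
proof (induction k arbitrary: f g)
  case (Suc k)
  obtain f' where f': "\<And>x. (f has_real_derivative f' x) (at x)" "diff_upto k f'"
    using Suc.prems(1) by auto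
  obtain g' where g': "\<And>x. (g has_real_derivative g' x) (at x)" "diff_upto k g'"
    using Suc.prems(2) by auto
  have "((\<lambda>x. f x * g x) has_real_derivative f' x * g x + g' x * f x) (at x)" for x
    by (intro DERIV_mult f' g')
  \<comment> \<open>The product rule leaves undifferentiated factors, which the induction hypothesis
    wants at the lower order.\<close>
  moreover have fg: "diff_upto k f" "diff_upto k g"
    using Suc.prems by (auto dest: diff_upto_SucD simp del: diff_upto.simps)
  have "diff_upto k (\<lambda>x. f' x * g x + g' x * f x)"
    by (rule diff_upto_add[OF Suc.IH[OF f'(2) fg(2)] Suc.IH[OF g'(2) fg(1)]])
  ultimately show ?case
    by (rule diff_upto_SucI)
qed simp

text \<open>The factor \<open>r\<close> absorbs the powers of \<open>a\<close> produced by the chain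
  rule; without it the induction would not close.\<close>

lemma diff_upto_affine:
  assumes "diff_upto k f"
  shows "diff_upto k (\<lambda>x. r * f (a * x + b))"
  using assms
proof (induction k arbitrary: f r)
  case (Suc k)
  obtain f' where f': "\<And>x. (f has_real_derivative f' x) (at x)" "diff_upto k f'"
    using Suc.prems(1) by auto
  have "((\<lambda>x. r * f (a * x + b)) has_real_derivative (r * a) * f' (a * x + b)) (at x)" for x
    by (auto intro!: derivative_eq_intros DERIV_chain2[OF f'(1)])
  then show ?case
    by (rule diff_upto_SucI) (rule Suc.IH[OF f'(2)])
qed simp

lemma poly_div_exp_tendsto_0: "((\<lambda>x::real. poly p x / exp x) \<longlongrightarrow> 0) at_top"
proof -
  have "((\<lambda>x::real. \<Sum>i\<le>degree p. coeff p i * (x ^ i / exp x)) \<longlongrightarrow> (\<Sum>i\<le>degree p. coeff p i * 0)) at_top"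
    by (intro tendsto_sum tendsto_mult tendsto_const tendsto_power_div_exp_0)
  then show ?thesis
    by (simp add: poly_altdef sum_divide_distrib)
qed

text \<open>The case \<open>p = 1\<close> is the classical flat function \<open>exp (- 1/x)\<close>
  extended by 0. The polynomial factor makes the family closed under differentiation, so smoothness
  is an induction with \<open>p\<close> arbitrary.\<close>

definition poly_exp_inverse :: "real poly \<Rightarrow> real \<Rightarrow> real" where
  "poly_exp_inverse p x = (if x > 0 then poly p (inverse x) * exp (- inverse x) else 0)"

text \<open>With \<open>y = 1/x\<close>, the derivative of \<open>p(y) e\<^sup>-\<^sup>y\<close> with respect to \<open>x\<close> is \<open>y\<^sup>2 (p(y) - p'(y)) e\<^sup>-\<^sup>y\<close>.\<close>

lemma poly_exp_inverse_deriv: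
  "(poly_exp_inverse p has_real_derivative
     poly_exp_inverse (monom 1 2 * (p - pderiv p)) x) (at x)"
proof -
  consider "x > 0" | "x < 0" | "x = 0"
    by linarith
  then show ?thesis
  proof cases
    case 1
    have "((\<lambda>x. poly p (inverse x) * exp (- inverse x)) has_real_derivative
        poly_exp_inverse (monom 1 2 * (p - pderiv p)) x) (at x)"
      using 1
      by (auto intro!: derivative_eq_intros DERIV_chain2[OF poly_DERIV]
          simp: poly_exp_inverse_def poly_monom algebra_simps power2_eq_square)
    then show ?thesis
      by (rule has_field_derivative_transform_within_open[of _ _ _ "{0<..}"])
         (use 1 in \<open>auto simp: poly_exp_inverse_def\<close>)
  next
    case 2
    have "((\<lambda>x. 0) has_real_derivative poly_exp_inverse (monom 1 2 * (p - pderiv p)) x) (at x)"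
      using 2 by (simp add: poly_exp_inverse_def)
    then show ?thesis
      by (rule has_field_derivative_transform_within_open[of _ _ _ "{..<0}"])
         (use 2 in \<open>auto simp: poly_exp_inverse_def\<close>)
  next
    case 3
    \<comment> \<open>From the right, the difference quotient at 0 is
      \<open>z p(z) exp (- z)\<close> with \<open>z = 1/y\<close>, and \<open>pCons 0 p\<close> is
      the polynomial \<open>z p(z)\<close>.\<close>
    have "((\<lambda>y. poly (pCons 0 p) (inverse y) / exp (inverse y)) \<longlongrightarrow> 0) (at_right 0)"
      by (rule filterlim_compose[OF poly_div_exp_tendsto_0 filterlim_inverse_at_top_right])
    then have "((\<lambda>y. (poly_exp_inverse p y - poly_exp_inverse p 0) / (y - 0)) \<longlongrightarrow> 0) (at_right 0)"
      by (rule Lim_transform_eventually)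
         (auto simp: eventually_at_filter poly_exp_inverse_def exp_minus divide_simps)
    moreover have "((\<lambda>y. (poly_exp_inverse p y - poly_exp_inverse p 0) / (y - 0)) \<longlongrightarrow> 0) (at_left 0)"
      by (rule Lim_transform_eventually[OF tendsto_const])
         (auto simp: eventually_at_filter poly_exp_inverse_def)
    ultimately show ?thesis
      using 3 by (simp add: has_field_derivative_iff filterlim_split_at poly_exp_inverse_def)
  qed
qed

lemma diff_upto_poly_exp_inverse: "diff_upto k (poly_exp_inverse p)"
proof (induction k arbitrary: p)
  case (Suc k)
  show ?case
    by (rule diff_upto_SucI[OF poly_exp_inverse_deriv Suc.IH])
qed simp

text \<open>The derivatives witnessing \<open>diff_upto k f\<close> might depend on
  \<open>k\<close>. Uniqueness of derivatives identifies them all with iterates of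
  \<open>deriv\<close>, which gives one sequence for all orders.\<close>

lemma higher_deriv_sequence:
  assumes "\<And>k. diff_upto k f"
  obtains F where "F 0 = f" "\<And>n x. (F n has_real_derivative F (Suc n) x) (at x)"
proof
  have *: "\<forall>k. diff_upto k ((deriv ^^ n) f)" for n
  proof (induction n)
    case (Suc n)
    show ?case
    proof
      fix k
      obtain f' where f': "\<And>x. ((deriv ^^ n) f has_real_derivative f' x) (at x)" "diff_upto k f'"
        using spec[OF Suc, of "Suc k"] by auto
      have "deriv ((deriv ^^ n) f) = f'"
        using f'(1) DERIV_imp_deriv by blast
      then show "diff_upto k ((deriv ^^ Suc n) f)"
        using f'(2) by simp
    qed
  qed (use assms in simp)
  show "((deriv ^^ n) f has_real_derivative (deriv ^^ Suc n) f x) (at x)" for n x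
  proof -
    obtain f' where f': "\<And>x. ((deriv ^^ n) f has_real_derivative f' x) (at x)"
      using spec[OF *[of n], of "Suc 0"] by auto
    then show ?thesis
      using DERIV_imp_deriv[OF f'] by simp
  qed
qed simp

text \<open>Smooth, positive exactly on \<open>(a, b)\<close>, and increasing to the indicator of \<open>(a, b)\<close> as \<open>n\<close> grows.\<close>

definition interval_bump :: "nat \<Rightarrow> real \<Rightarrow> real \<Rightarrow> real \<Rightarrow> real" where
  "interval_bump n a b x = poly_exp_inverse 1 (real (Suc n) * (x - a)) * poly_exp_inverse 1 (real (Suc n) * (b - x))"

lemma diff_upto_interval_bump: "diff_upto k (interval_bump n a b)"
proof -
  let ?f = "poly_exp_inverse 1" and ?m = "real (Suc n)"
  have "interval_bump n a b = (\<lambda>x. (1 * ?f (?m * x + - (?m * a))) * (1 * ?f (- ?m * x + ?m * b)))"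
    by (simp add: interval_bump_def fun_eq_iff algebra_simps)
  moreover note diff_upto_mult[OF
      diff_upto_affine[OF diff_upto_poly_exp_inverse, of k 1 1 ?m "- (?m * a)"]
      diff_upto_affine[OF diff_upto_poly_exp_inverse, of k 1 1 "- ?m" "?m * b"]]
  ultimately show ?thesis
    by (simp only:)
qed

lemma interval_bump_bounds: "0 \<le> interval_bump n a b x" "interval_bump n a b x \<le> 1"
proof -
  have "0 \<le> poly_exp_inverse 1 y" "poly_exp_inverse 1 y \<le> 1" for y
    by (auto simp: poly_exp_inverse_def)
  then show "0 \<le> interval_bump n a b x" "interval_bump n a b x \<le> 1"
    unfolding interval_bump_def by (auto intro: mult_le_one)
qed

lemma interval_bump_outside: "x \<notin> {a<..<b} \<Longrightarrow> interval_bump n a b x = 0"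
  by (auto simp: interval_bump_def poly_exp_inverse_def zero_less_mult_iff)

lemma interval_bump_tendsto:
  assumes "x \<in> {a<..<b}"
  shows "(\<lambda>n. interval_bump n a b x) \<longlonglongrightarrow> 1"
proof -
  have "(\<lambda>n. exp (- (inverse (real (Suc n)) * inverse y))) \<longlonglongrightarrow> exp (- (0 * inverse y))" for y :: real
    by (intro tendsto_intros LIMSEQ_inverse_real_of_nat)
  then have *: "(\<lambda>n. poly_exp_inverse 1 (real (Suc n) * y)) \<longlonglongrightarrow> 1" if "0 < y" for y :: real
    using that by (simp add: poly_exp_inverse_def)
  have "(\<lambda>n. interval_bump n a b x) \<longlonglongrightarrow> 1 * 1"
    unfolding interval_bump_def using assms by (intro tendsto_mult *) auto
  then show ?thesis
    by simp
qed

text \<open>Letting the order \<open>j i\<close> of differentiation vary with the coordinate makes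
  the statement stable under partial derivatives: direction \<open>m\<close> just raises
  \<open>j m\<close> by one.\<close>

lemma Ck_coordinate_product:
  fixes F :: "3 \<Rightarrow> nat \<Rightarrow> real \<Rightarrow> real" and c :: "'b::real_normed_vector"
  assumes F: "\<And>i n x. (F i n has_real_derivative F i (Suc n) x) (at x)"
  shows "Ck k (\<lambda>x. (\<Prod>i\<in>UNIV. F i (j i) (x $ i)) *\<^sub>R c)"
proof (induction k arbitrary: j)
  have D: "((\<lambda>x. (\<Prod>i\<in>UNIV. F i (j i) (x $ i)) *\<^sub>R c) has_derivative
      (\<lambda>h. (\<Sum>i\<in>UNIV. (h $ i * F i (Suc (j i)) (x $ i)) * (\<Prod>m\<in>UNIV - {i}. F m (j m) (x $ m))) *\<^sub>R c)) (at x)"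
    for j x
  proof (intro has_derivative_scaleR_left has_derivative_prod)
    fix i :: 3
    have "((\<lambda>x. x $ i) has_derivative (\<lambda>h. h $ i)) (at x)"
      by (rule bounded_linear_imp_has_derivative[OF bounded_linear_vec_nth])
    then have "((\<lambda>x. F i (j i) (x $ i)) has_derivative (\<lambda>h. F i (Suc (j i)) (x $ i) * h $ i)) (at x)"
      using has_derivative_compose[of "\<lambda>x. x $ i" "\<lambda>h. h $ i" x UNIV "F i (j i)" "(*) (F i (Suc (j i)) (x $ i))"]
        F[of i "j i" "x $ i"] by (simp add: has_field_derivative_def)
    then show "((\<lambda>x. F i (j i) (x $ i)) has_derivative (\<lambda>h. h $ i * F i (Suc (j i)) (x $ i))) (at x)"
      by (simp add: mult.commute)
  qed
  {
    case 0
    show ?case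
      unfolding Ck.simps by (intro continuous_at_imp_continuous_on ballI has_derivative_continuous[OF D])
  next
    case (Suc k)
    have "partial_deriv m (\<lambda>x. (\<Prod>i\<in>UNIV. F i (j i) (x $ i)) *\<^sub>R c) =
        (\<lambda>x. (\<Prod>i\<in>UNIV. F i ((j(m := Suc (j m))) i) (x $ i)) *\<^sub>R c)" for m
    proof
      fix x
      have "(\<Sum>i\<in>UNIV. (axis m 1 $ i * F i (Suc (j i)) (x $ i)) * (\<Prod>m\<in>UNIV - {i}. F m (j m) (x $ m))) =
          F m (Suc (j m)) (x $ m) * (\<Prod>i\<in>UNIV - {m}. F i (j i) (x $ i))"
        by (subst sum.remove[of _ m]) (auto simp: axis_def intro!: sum.neutral)
      also have "\<dots> = (\<Prod>i\<in>UNIV. F i ((j(m := Suc (j m))) i) (x $ i))"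
        by (subst prod.remove[of UNIV m]) (auto intro!: prod.cong)
      finally show "partial_deriv m (\<lambda>x. (\<Prod>i\<in>UNIV. F i (j i) (x $ i)) *\<^sub>R c) x =
          (\<Prod>i\<in>UNIV. F i ((j(m := Suc (j m))) i) (x $ i)) *\<^sub>R c"
        using partial_deriv_eq[OF D[of j x]] by simp
    qed
    then show ?case
      using D Suc.IH by (auto simp: differentiable_def)
  }
qed

text \<open>The cut-offs live on boxes because products of one-dimensional bumps converge to
  indicators of boxes, and vanishing integrals over boxes are what the differentiation argument for
  the fundamental lemma starts from.\<close>

definition box_bump :: "nat \<Rightarrow> real^3 \<Rightarrow> real^3 \<Rightarrow> real^3 \<Rightarrow> real" where
  "box_bump n a b x = (\<Prod>i\<in>UNIV. interval_bump n (a $ i) (b $ i) (x $ i))"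

lemma box_bump_bounds: "0 \<le> box_bump n a b x" "box_bump n a b x \<le> 1"
  unfolding box_bump_def by (auto intro: prod_nonneg prod_le_1 interval_bump_bounds)

lemma box_bump_outside: "x \<notin> box a b \<Longrightarrow> box_bump n a b x = 0"
proof -
  assume "x \<notin> box a b"
  then obtain i where "x $ i \<notin> {a $ i<..<b $ i}"
    by (auto simp: mem_box_cart)
  then have "interval_bump n (a $ i) (b $ i) (x $ i) = 0"
    by (rule interval_bump_outside)
  then show "box_bump n a b x = 0"
    unfolding box_bump_def by (intro prod_zero) auto
qed

lemma box_bump_tendsto: "(\<lambda>n. box_bump n a b x) \<longlonglongrightarrow> indicator (box a b) x"
proof (cases "x \<in> box a b")
  case True
  then have "(\<lambda>n. box_bump n a b x) \<longlonglongrightarrow> (\<Prod>i\<in>(UNIV::3 set). 1)"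
    unfolding box_bump_def by (intro tendsto_prod interval_bump_tendsto) (auto simp: mem_box_cart)
  then show ?thesis
    using True by simp
qed (simp add: box_bump_outside)

lemma box_bump_test_function:
  fixes c :: "'b::real_normed_vector"
  assumes "cbox a b \<subseteq> S"
  shows "(\<lambda>x. box_bump n a b x *\<^sub>R c) \<in> test_functions S"
proof -
  have "\<exists>F. F 0 = interval_bump n (a $ i) (b $ i) \<and> (\<forall>m x. (F m has_real_derivative F (Suc m) x) (at x))" for i
    using higher_deriv_sequence[OF diff_upto_interval_bump] by metis
  then obtain F where F: "\<And>i. F i 0 = interval_bump n (a $ i) (b $ i)"
    "\<And>i m x. (F i m has_real_derivative F i (Suc m) x) (at x)"
    by metis
  have "Ck k (\<lambda>x. box_bump n a b x *\<^sub>R c)" for k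
    using Ck_coordinate_product[of F k "\<lambda>_. 0" c, OF F(2)] by (simp add: box_bump_def F(1))
  moreover have "box_bump n a b x *\<^sub>R c = 0" if "x \<notin> cbox a b" for x
    using that box_subset_cbox[of a b] box_bump_outside[of x a b n] by auto
  ultimately show ?thesis
    using assms compact_cbox[of a b] by (auto simp: test_functions_def intro!: exI[of _ "cbox a b"])
qed

section \<open>The fundamental lemma of the calculus of variations\<close>

text \<open>Lebesgue differentiation: outside a null set, \<open>f x\<close> is the limit of the
  averages over cubes with corner \<open>x\<close>. Small cubes lie in the open set
  \<open>U\<close>, where these averages are 0.\<close>

lemma has_integral_cbox_zero_imp_zero:
  fixes f :: "real^3 \<Rightarrow> real"
  assumes int: "\<And>a b. f integrable_on cbox a b"
    and zero: "\<And>a b. cbox a b \<subseteq> U \<Longrightarrow> integral (cbox a b) f = 0" and U: "open U"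
  shows "\<exists>N. negligible N \<and> (\<forall>x\<in>U - N. f x = 0)"
proof -
  obtain N where N: "negligible N"
    "\<And>x e. \<lbrakk>x \<notin> N; 0 < e\<rbrakk> \<Longrightarrow> \<exists>d>0. \<forall>h. 0 < h \<and> h < d \<longrightarrow>
        norm (integral (cbox x (x + h *\<^sub>R One)) f /\<^sub>R h ^ DIM(real^3) - f x) < e"
    using integrable_ccontinuous_explicit[of f] int by metis
  have "f x = 0" if x: "x \<in> U - N" for x
  proof (rule ccontr)
    assume "f x \<noteq> 0"
    then obtain d where d: "0 < d" "\<And>h. 0 < h \<Longrightarrow> h < d \<Longrightarrow>
        norm (integral (cbox x (x + h *\<^sub>R One)) f /\<^sub>R h ^ DIM(real^3) - f x) < \<bar>f x\<bar>"
      using N(2)[of x "\<bar>f x\<bar>"] x by auto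
    obtain r where r: "0 < r" "cball x r \<subseteq> U"
      using U x open_contains_cball by blast
    let ?One = "One :: real^3"
    \<comment> \<open>Half of \<open>d\<close> makes \<open>h < d\<close> strict; the other bound
      keeps the diagonal of the cube at most \<open>r\<close>.\<close>
    define h where "h = min (d / 2) (r / norm ?One)"
    have One: "norm ?One > 0"
      by simp
    then have h: "0 < h" "h < d" "h * norm ?One \<le> r"
      using d(1) r(1) by (auto simp: h_def min_def field_simps)
    have "cbox x (x + h *\<^sub>R ?One) \<subseteq> cball x r"
    proof
      fix y assume y: "y \<in> cbox x (x + h *\<^sub>R ?One)"
      have "norm (y - x) \<le> norm (h *\<^sub>R ?One)"
        by (rule norm_le_componentwise) (use y h(1) in \<open>auto simp: mem_box inner_diff_left inner_add_left\<close>)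
      then show "y \<in> cball x r"
        using h by (simp add: dist_norm norm_minus_commute)
    qed
    then have "integral (cbox x (x + h *\<^sub>R ?One)) f = 0"
      using zero r(2) by blast
    then show False
      using d(2)[OF h(1,2)] by simp
  qed
  then show ?thesis
    using N(1) by auto
qed

text \<open>A box has finite measure, so the constant 1 is square integrable on it, and
  \<open>f\<close> is a product of two square integrable functions.\<close>

lemma L2_cbox_integrable:
  fixes f :: "real^3 \<Rightarrow> real"
  assumes "f \<in> L2 S" "cbox a b \<subseteq> S" "S \<in> sets lebesgue"
  shows "integrable (lebesgue_on (cbox a b)) f"
proof -
  have "integrable (lebesgue_on (cbox a b)) (\<lambda>x. 1 :: real)"
    by (intro finite_measure.integrable_const finite_measure_lebesgue_on lmeasurable_cbox)
  then have "(\<lambda>x. 1 :: real) \<in> L2 (cbox a b)"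
    by (simp add: L2_def)
  moreover have "f \<in> L2 (cbox a b)"
    using L2_mono[OF assms] by simp
  ultimately show ?thesis
    using L2_inner_integrable[of f "cbox a b" "\<lambda>x. 1"] by simp
qed

text \<open>By dominated convergence the integrals against bumps become integrals over boxes, so the
  latter vanish and \<open>f\<close> is zero almost everywhere in each box. Countably many boxes
  fill \<open>S\<close>, and their exceptional sets add up to a null set.\<close>

lemma AE_zero_of_box_bumps:
  fixes f :: "real^3 \<Rightarrow> real"
  assumes f: "f \<in> L2 S" and S: "open S"
    and zero: "\<And>n a b. cbox a b \<subseteq> S \<Longrightarrow> (LINT x|lebesgue_on S. f x * box_bump n a b x) = 0"
  shows "AE x in lebesgue_on S. f x = 0"
proof -
  have S': "S \<in> sets lebesgue"
    using S by simp
  have int0: "integral (cbox a b) f = 0" if ab: "cbox a b \<subseteq> S" for a b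
  proof -
    have fint: "integrable (lebesgue_on (cbox a b)) f"
      by (rule L2_cbox_integrable[OF f ab S'])
    have "(LINT x|lebesgue_on (cbox a b). f x * box_bump n a b x) = 0" for n
    proof -
      have "indicator S x *\<^sub>R (f x * box_bump n a b x) =
          indicator (cbox a b) x *\<^sub>R (f x * box_bump n a b x)" for x
        using ab box_bump_outside[of x a b n] subsetD[OF box_subset_cbox, of x a b]
        by (cases "x \<in> box a b") (auto split: split_indicator)
      then have "(\<lambda>x. indicator S x *\<^sub>R (f x * box_bump n a b x)) =
          (\<lambda>x. indicator (cbox a b) x *\<^sub>R (f x * box_bump n a b x))"
        by (rule ext)
      then show ?thesis
        using zero[OF ab, of n] S' by (simp add: integral_restrict_space)
    qed
    moreover have "(\<lambda>n. LINT x|lebesgue_on (cbox a b). f x * box_bump n a b x) \<longlonglongrightarrow>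
        (LINT x|lebesgue_on (cbox a b). f x * indicator (box a b) x)"
    proof (rule integral_dominated_convergence)
      show "integrable (lebesgue_on (cbox a b)) (\<lambda>x. norm (f x))"
        using fint by simp
      have "box_bump n a b \<in> borel_measurable (lebesgue_on (cbox a b))" for n
      proof -
        have "box_bump n a b \<in> L2 (cbox a b)"
          using L2_test_functions(1)[OF box_bump_test_function[of a b UNIV n "1::real"], of "cbox a b"] by simp
        then show ?thesis
          by (rule L2_measurable)
      qed
      then show "(\<lambda>x. f x * box_bump n a b x) \<in> borel_measurable (lebesgue_on (cbox a b))" for n
        using fint by (intro borel_measurable_times) (auto simp: borel_measurable_integrable)
      show "(\<lambda>x. f x * indicator (box a b) x) \<in> borel_measurable (lebesgue_on (cbox a b))"
        using fint by (intro borel_measurable_times borel_measurable_indicator)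
          (auto simp: borel_measurable_integrable sets_restrict_space_iff box_subset_cbox)
      show "AE x in lebesgue_on (cbox a b). (\<lambda>n. f x * box_bump n a b x) \<longlonglongrightarrow> f x * indicator (box a b) x"
        by (intro AE_I2 tendsto_mult tendsto_const box_bump_tendsto)
      show "AE x in lebesgue_on (cbox a b). norm (f x * box_bump n a b x) \<le> norm (f x)" for n
        using box_bump_bounds by (auto simp: abs_mult intro!: AE_I2 mult_left_le)
    qed
    ultimately have "(LINT x|lebesgue_on (cbox a b). f x * indicator (box a b) x) = 0"
      by (simp add: LIMSEQ_const_iff)
    moreover have "(LINT x|lebesgue_on (cbox a b). f x * indicator (box a b) x) = (LINT x|lebesgue_on (cbox a b). f x)"
    proof (rule integral_AE_cong_lebesgue_on)
      have "negligible (cbox a b - box a b)"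
        by (simp add: negligible_frontier_interval)
      then have "AE x in lebesgue. x \<notin> cbox a b - box a b"
        by (auto simp: eventually_ae_filter_negligible)
      then show "AE x in lebesgue_on (cbox a b). f x * indicator (box a b) x = f x"
        by (auto simp: AE_restrict_space_iff split: split_indicator elim!: eventually_mono)
    qed simp
    ultimately show ?thesis
      using lebesgue_integral_eq_integral[OF fint] by simp
  qed
  obtain \<D> :: "(real^3) set set" where \<D>: "countable \<D>" "\<D> \<subseteq> Pow S"
      "\<And>X. X \<in> \<D> \<Longrightarrow> \<exists>a b. X = cbox a b" "\<Union>\<D> = S"
    by (rule open_countable_Union_open_cbox[OF S]) (rule that; simp)
  have box: "\<exists>N. negligible N \<and> (\<forall>x\<in>X - N. f x = 0)" if "X \<in> \<D>" for X
  proof -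
    obtain a b where X: "X = cbox a b" "cbox a b \<subseteq> S"
      using \<D>(2) \<D>(3)[OF \<open>X \<in> \<D>\<close>] \<open>X \<in> \<D>\<close> by blast
    have fint: "f integrable_on cbox a b"
      using integrable_on_lebesgue_on[OF L2_cbox_integrable[OF f X(2) S']] by simp
    \<comment> \<open>The differentiation lemma wants integrability over every box of the space,
      whereas \<open>f\<close> is controlled only inside \<open>S\<close>; hence the extension by
      zero from one box.\<close>
    let ?f = "\<lambda>x. if x \<in> cbox a b then f x else 0"
    have fint': "?f integrable_on cbox c d" for c d
    proof -
      have "f integrable_on cbox a b \<inter> cbox c d"
        unfolding Int_interval
        by (rule integrable_on_subcbox[OF fint]) (simp flip: Int_interval)
      then show ?thesis
        by (simp add: integrable_restrict_Int)
    qed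
    have zero': "integral (cbox c d) ?f = 0" if "cbox c d \<subseteq> box a b" for c d
    proof -
      have sub: "cbox c d \<subseteq> cbox a b"
        using that box_subset_cbox by blast
      then have "integral (cbox c d) ?f = integral (cbox c d) f"
        by (intro integral_cong) auto
      then show ?thesis
        using int0 sub X(2) by simp
    qed
    have "\<exists>N. negligible N \<and> (\<forall>x\<in>box a b - N. ?f x = 0)"
      by (rule has_integral_cbox_zero_imp_zero[OF fint' zero' open_box])
    then obtain N where N: "negligible N" "\<forall>x\<in>box a b - N. ?f x = 0"
      by auto
    \<comment> \<open>The local result covers the open box only, so the boundary of the box joins
      the exceptional set.\<close>
    have "negligible (N \<union> (cbox a b - box a b))"
      using N(1) by (intro negligible_Un negligible_frontier_interval)
    moreover have "\<forall>x\<in>X - (N \<union> (cbox a b - box a b)). f x = 0"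
    proof
      fix x
      assume "x \<in> X - (N \<union> (cbox a b - box a b))"
      then have "x \<in> box a b - N" "x \<in> cbox a b"
        using X(1) by auto
      then show "f x = 0"
        using bspec[OF N(2), of x] by simp
    qed
    ultimately show ?thesis
      by blast
  qed
  have "\<exists>\<N>. \<forall>X\<in>\<D>. negligible (\<N> X) \<and> (\<forall>x\<in>X - \<N> X. f x = 0)"
    by (intro bchoice ballI box)
  then obtain \<N> where \<N>: "\<forall>X\<in>\<D>. negligible (\<N> X) \<and> (\<forall>x\<in>X - \<N> X. f x = 0)" ..
  have "negligible (\<Union>(\<N> ` \<D>))"
    using \<D>(1) \<N> by (intro negligible_countable_Union) auto
  moreover have "{x. \<not> (x \<in> S \<longrightarrow> f x = 0)} \<subseteq> \<Union>(\<N> ` \<D>)"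
  proof
    fix x
    assume "x \<in> {x. \<not> (x \<in> S \<longrightarrow> f x = 0)}"
    then have x: "x \<in> S" "f x \<noteq> 0"
      by auto
    then obtain X where "X \<in> \<D>" "x \<in> X"
      using \<D>(4) by auto
    then show "x \<in> \<Union>(\<N> ` \<D>)"
      using \<N> x by auto
  qed
  ultimately have "AE x in lebesgue. x \<in> S \<longrightarrow> f x = 0"
    unfolding eventually_ae_filter_negligible by (intro exI conjI)
  then show ?thesis
    using S' by (simp add: AE_restrict_space_iff)
qed

text \<open>A scalar bump times a constant vector \<open>c\<close> tests the component
  \<open>f x \<bullet> c\<close>; the finitely many basis vectors then determine \<open>f x\<close>
  off one null set.\<close>

lemma fundamental_lemma:
  fixes f :: "real^3 \<Rightarrow> 'b::euclidean_space"
  assumes f: "f \<in> L2 S" and S: "open S"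
    and zero: "\<And>\<psi>. \<psi> \<in> test_functions S \<Longrightarrow> (LINT x|lebesgue_on S. f x \<bullet> \<psi> x) = 0"
  shows "AE x in lebesgue_on S. f x = 0"
proof -
  have "AE x in lebesgue_on S. f x \<bullet> c = 0" for c
  proof (rule AE_zero_of_box_bumps[OF _ S])
    have "integrable (lebesgue_on S) (\<lambda>x. (f x \<bullet> c)\<^sup>2)"
    proof (rule Bochner_Integration.integrable_bound)
      show "integrable (lebesgue_on S) (\<lambda>x. (norm c)\<^sup>2 * (norm (f x))\<^sup>2)"
        using L2_integrable[OF f] by simp
      show "(\<lambda>x. (f x \<bullet> c)\<^sup>2) \<in> borel_measurable (lebesgue_on S)"
        using L2_measurable[OF f] by simp
      have "(f x \<bullet> c)\<^sup>2 \<le> (norm c)\<^sup>2 * (norm (f x))\<^sup>2" for x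
        using Cauchy_Schwarz_ineq[of "f x" c] by (simp add: power2_norm_eq_inner mult.commute)
      then show "AE x in lebesgue_on S. norm ((f x \<bullet> c)\<^sup>2) \<le> norm ((norm c)\<^sup>2 * (norm (f x))\<^sup>2)"
        by (intro AE_I2) simp
    qed
    then show "(\<lambda>x. f x \<bullet> c) \<in> L2 S"
      using L2_measurable[OF f] by (simp add: L2_def)
    show "(LINT x|lebesgue_on S. (f x \<bullet> c) * box_bump n a b x) = 0" if "cbox a b \<subseteq> S" for n a b
      using zero[OF box_bump_test_function[OF that, of n c]] by (simp add: mult.commute)
  qed
  then have "AE x in lebesgue_on S. \<forall>c\<in>Basis. f x \<bullet> c = 0"
    by (simp add: AE_finite_all)
  then show ?thesis
    by (simp only: euclidean_all_zero_iff)
qed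

section \<open>Pairs of formally adjoint first order operators\<close>

text \<open>
  Gradient, curl and divergence are treated at once: \<open>P\<close> is the operator which acts on the test
  functions in the definition of a weak derivative.
\<close>

definition has_weak ::
  "(real^3) set \<Rightarrow> ((real^3 \<Rightarrow> 'b) \<Rightarrow> real^3 \<Rightarrow> 'a) \<Rightarrow> (real^3 \<Rightarrow> 'a::euclidean_space) \<Rightarrow>
   (real^3 \<Rightarrow> 'b::euclidean_space) \<Rightarrow> bool" where
  "has_weak S P u v \<longleftrightarrow> u \<in> L2 S \<and> v \<in> L2 S \<and>
     (\<forall>\<psi>\<in>test_functions S. (LINT x|lebesgue_on S. u x \<bullet> P \<psi> x) = (LINT x|lebesgue_on S. v x \<bullet> \<psi> x))"

definition weak :: "(real^3) set \<Rightarrow> ((real^3 \<Rightarrow> 'b) \<Rightarrow> real^3 \<Rightarrow> 'a) \<Rightarrow>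
    (real^3 \<Rightarrow> 'a::euclidean_space) \<Rightarrow> real^3 \<Rightarrow> 'b::euclidean_space" where
  "weak S P u = (SOME v. has_weak S P u v)"

definition weak_dom :: "(real^3) set \<Rightarrow> ((real^3 \<Rightarrow> 'b::euclidean_space) \<Rightarrow> real^3 \<Rightarrow> 'a) \<Rightarrow>
    (real^3 \<Rightarrow> 'a::euclidean_space) set" where
  "weak_dom S P = {u. \<exists>v. has_weak S P u v}"

definition graph_norm :: "(real^3) set \<Rightarrow> ((real^3 \<Rightarrow> 'b::euclidean_space) \<Rightarrow> real^3 \<Rightarrow> 'a) \<Rightarrow>
    (real^3 \<Rightarrow> 'a::euclidean_space) \<Rightarrow> real" where
  "graph_norm S P u = sqrt ((L2_norm S u)\<^sup>2 + (L2_norm S (weak S P u))\<^sup>2)"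

text \<open>Green's formula as a definition. With both operators the curl and \<open>s = -1\<close>
  it is \<open>bdry_cross\<close>; with \<open>P\<close> minus divergence, \<open>Q\<close> minus
  gradient and \<open>s = 1\<close> it is \<open>bdry_flux\<close>.\<close>

definition bdry :: "(real^3) set \<Rightarrow> ((real^3 \<Rightarrow> 'b::euclidean_space) \<Rightarrow> real^3 \<Rightarrow> 'a::euclidean_space) \<Rightarrow>
    ((real^3 \<Rightarrow> 'a) \<Rightarrow> real^3 \<Rightarrow> 'b) \<Rightarrow> real \<Rightarrow> (real^3 \<Rightarrow> 'a) \<Rightarrow> (real^3 \<Rightarrow> 'b) \<Rightarrow> real" where
  "bdry S P Q s u w = (LINT x|lebesgue_on S. weak S P u x \<bullet> w x + s * (u x \<bullet> weak S Q w x))"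

definition weak_dom_0 :: "(real^3) set \<Rightarrow> ((real^3 \<Rightarrow> 'b::euclidean_space) \<Rightarrow> real^3 \<Rightarrow> 'a::euclidean_space) \<Rightarrow>
    ((real^3 \<Rightarrow> 'a) \<Rightarrow> real^3 \<Rightarrow> 'b) \<Rightarrow> real \<Rightarrow> (real^3 \<Rightarrow> 'a) set" where
  "weak_dom_0 S P Q s = {u \<in> weak_dom S P. \<forall>w\<in>weak_dom S Q. bdry S P Q s u w = 0}"

section \<open>Uniqueness of weak derivatives and independence of the chosen representatives\<close>

lemma has_weak_L2: "has_weak S P u v \<Longrightarrow> u \<in> L2 S" "has_weak S P u v \<Longrightarrow> v \<in> L2 S"
  by (simp_all add: has_weak_def)

lemma has_weakD: "has_weak S P u v \<Longrightarrow> \<psi> \<in> test_functions S \<Longrightarrow>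
    (LINT x|lebesgue_on S. u x \<bullet> P \<psi> x) = (LINT x|lebesgue_on S. v x \<bullet> \<psi> x)"
  by (simp add: has_weak_def)

lemma has_weak_weak: "u \<in> weak_dom S P \<Longrightarrow> has_weak S P u (weak S P u)"
  unfolding weak_def weak_dom_def using someI_ex[of "has_weak S P u"] by simp

lemma weak_domI: "has_weak S P u v \<Longrightarrow> u \<in> weak_dom S P"
  by (auto simp: weak_dom_def)

lemma weak_dom_L2: "u \<in> weak_dom S P \<Longrightarrow> u \<in> L2 S" "u \<in> weak_dom S P \<Longrightarrow> weak S P u \<in> L2 S"
  using has_weak_weak[of u S P] has_weak_L2 by auto

lemma weak_dom_0D: "u \<in> weak_dom_0 S P Q s \<Longrightarrow> u \<in> weak_dom S P"
  by (simp add: weak_dom_0_def)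

lemma test_functions_L2: "\<psi> \<in> test_functions S \<Longrightarrow> S \<in> sets lebesgue \<Longrightarrow> \<psi> \<in> L2 S"
  using L2_test_functions(1) test_functions_mono[of S UNIV] by blast

lemma has_weak_unique:
  assumes v: "has_weak S P u v" and v': "has_weak S P u v'" and S: "open S"
  shows "AE x in lebesgue_on S. v x = v' x"
proof -
  have "AE x in lebesgue_on S. v x - v' x = 0"
  proof (rule fundamental_lemma[OF _ S])
    show "(\<lambda>x. v x - v' x) \<in> L2 S"
      by (intro L2_diff has_weak_L2(2)[OF v] has_weak_L2(2)[OF v'])
    fix \<psi> :: "real^3 \<Rightarrow> 'a"
    assume \<psi>: "\<psi> \<in> test_functions S"
    have "\<psi> \<in> L2 S"
      using test_functions_L2[OF \<psi>] S by simp
    then have "integrable (lebesgue_on S) (\<lambda>x. v x \<bullet> \<psi> x)" "integrable (lebesgue_on S) (\<lambda>x. v' x \<bullet> \<psi> x)"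
      using has_weak_L2(2)[OF v] has_weak_L2(2)[OF v'] by (simp_all add: L2_inner_integrable)
    then show "(LINT x|lebesgue_on S. (v x - v' x) \<bullet> \<psi> x) = 0"
      using has_weakD[OF v \<psi>] has_weakD[OF v' \<psi>] by (simp add: inner_diff_left)
  qed
  then show ?thesis
    by simp
qed

lemma has_weak_AE_weak: "has_weak S P u v \<Longrightarrow> open S \<Longrightarrow> AE x in lebesgue_on S. weak S P u x = v x"
  by (rule has_weak_unique[OF has_weak_weak[OF weak_domI]])

text \<open>Frees the boundary pairing from the choices made by \<open>weak\<close>: any weak
  derivatives at hand may be inserted.\<close>

lemma bdry_eq:
  assumes S: "open S" and u: "has_weak S P u v" and w: "has_weak S Q w d"
  shows "bdry S P Q s u w = (LINT x|lebesgue_on S. v x \<bullet> w x + s * (u x \<bullet> d x))"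
  unfolding bdry_def
proof (rule integral_AE_cong_lebesgue_on)
  show "AE x in lebesgue_on S. weak S P u x \<bullet> w x + s * (u x \<bullet> weak S Q w x) = v x \<bullet> w x + s * (u x \<bullet> d x)"
    using has_weak_AE_weak[OF u S] has_weak_AE_weak[OF w S] by eventually_elim simp
qed (use S in simp)

lemma bdry_integrable:
  assumes "u \<in> L2 S" "v \<in> L2 S" "w \<in> L2 S" "d \<in> L2 S"
  shows "integrable (lebesgue_on S) (\<lambda>x. v x \<bullet> w x + s * (u x \<bullet> d x))"
  using assms by (intro Bochner_Integration.integrable_add integrable_mult_right L2_inner_integrable)

text \<open>Square integrability makes the two sides of the defining identity genuine integrals, and
  locality allows a test function on a subset to be used on the larger set.\<close>

locale weak_operator =
  fixes P :: "(real^3 \<Rightarrow> 'b::euclidean_space) \<Rightarrow> real^3 \<Rightarrow> 'a::euclidean_space"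
  assumes op_L2: "\<psi> \<in> test_functions UNIV \<Longrightarrow> S \<in> sets lebesgue \<Longrightarrow> P \<psi> \<in> L2 S"
    and op_outside: "\<psi> \<in> test_functions S \<Longrightarrow> x \<notin> S \<Longrightarrow> P \<psi> x = 0"
begin

lemma op_test_L2: "\<psi> \<in> test_functions S \<Longrightarrow> S \<in> sets lebesgue \<Longrightarrow> P \<psi> \<in> L2 S"
  using op_L2 test_functions_mono[of S UNIV] by blast

lemma has_weak_lincomb:
  assumes S: "S \<in> sets lebesgue" and u: "has_weak S P u v" and u': "has_weak S P u' v'"
  shows "has_weak S P (\<lambda>x. c *\<^sub>R u x + u' x) (\<lambda>x. c *\<^sub>R v x + v' x)"
  unfolding has_weak_def
proof (intro conjI ballI)
  show "(\<lambda>x. c *\<^sub>R u x + u' x) \<in> L2 S" "(\<lambda>x. c *\<^sub>R v x + v' x) \<in> L2 S"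
    by (intro L2_add L2_scaleR has_weak_L2[OF u] has_weak_L2[OF u'])+
  fix \<psi> :: "real^3 \<Rightarrow> 'b"
  assume \<psi>: "\<psi> \<in> test_functions S"
  have "integrable (lebesgue_on S) (\<lambda>x. u x \<bullet> P \<psi> x)" "integrable (lebesgue_on S) (\<lambda>x. u' x \<bullet> P \<psi> x)"
    "integrable (lebesgue_on S) (\<lambda>x. v x \<bullet> \<psi> x)" "integrable (lebesgue_on S) (\<lambda>x. v' x \<bullet> \<psi> x)"
    by (intro L2_inner_integrable has_weak_L2[OF u] has_weak_L2[OF u'] op_test_L2[OF \<psi> S]
        test_functions_L2[OF \<psi> S])+
  then show "(LINT x|lebesgue_on S. (c *\<^sub>R u x + u' x) \<bullet> P \<psi> x) =
      (LINT x|lebesgue_on S. (c *\<^sub>R v x + v' x) \<bullet> \<psi> x)"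
    using has_weakD[OF u \<psi>] has_weakD[OF u' \<psi>] by (simp add: inner_add_left)
qed

lemma has_weak_diff:
  assumes "S \<in> sets lebesgue" and "has_weak S P u v" and "has_weak S P u' v'"
  shows "has_weak S P (\<lambda>x. u x - u' x) (\<lambda>x. v x - v' x)"
  using has_weak_lincomb[OF assms(1,3,2), of "-1"] by simp

text \<open>Every test function on \<open>T\<close> is one on \<open>S\<close>, and by locality of
  \<open>P\<close> both integrands vanish outside \<open>T\<close>.\<close>

lemma has_weak_mono:
  assumes u: "has_weak S P u v" and T: "T \<subseteq> S" "S \<in> sets lebesgue" "T \<in> sets lebesgue"
  shows "has_weak T P u v"
  unfolding has_weak_def
proof (intro conjI ballI)
  show "u \<in> L2 T" "v \<in> L2 T"
    using L2_mono[OF _ T] has_weak_L2[OF u] by auto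
  fix \<psi> :: "real^3 \<Rightarrow> 'b"
  assume \<psi>: "\<psi> \<in> test_functions T"
  then have \<psi>': "\<psi> \<in> test_functions S"
    using test_functions_mono[OF T(1)] by blast
  have *: "(LINT x|lebesgue_on T. f x) = (LINT x|lebesgue_on S. f x)" if "\<And>x. x \<notin> T \<Longrightarrow> f x = 0"
    for f :: "real^3 \<Rightarrow> real"
  proof -
    have "indicator T x *\<^sub>R f x = indicator S x *\<^sub>R f x" for x
      using that[of x] T(1) by (auto split: split_indicator)
    then have "(\<lambda>x. indicator T x *\<^sub>R f x) = (\<lambda>x. indicator S x *\<^sub>R f x)"
      by (rule ext)
    then show ?thesis
      using T(2,3) by (simp add: integral_restrict_space)
  qed
  show "(LINT x|lebesgue_on T. u x \<bullet> P \<psi> x) = (LINT x|lebesgue_on T. v x \<bullet> \<psi> x)"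
    using *[of "\<lambda>x. u x \<bullet> P \<psi> x"] *[of "\<lambda>x. v x \<bullet> \<psi> x"] op_outside[OF \<psi>] test_functions_outside[OF \<psi>]
      has_weakD[OF u \<psi>'] by simp
qed

lemma weak_dom_lincomb:
  assumes "S \<in> sets lebesgue" and "u \<in> weak_dom S P" and "u' \<in> weak_dom S P"
  shows "(\<lambda>x. c *\<^sub>R u x + u' x) \<in> weak_dom S P"
  by (rule weak_domI[OF has_weak_lincomb[OF assms(1) has_weak_weak[OF assms(2)] has_weak_weak[OF assms(3)]]])

lemma weak_dom_diff:
  assumes "S \<in> sets lebesgue" and "u \<in> weak_dom S P" and "u' \<in> weak_dom S P"
  shows "(\<lambda>x. u x - u' x) \<in> weak_dom S P"
  by (rule weak_domI[OF has_weak_diff[OF assms(1) has_weak_weak[OF assms(2)] has_weak_weak[OF assms(3)]]])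

end

text \<open>\<open>P\<close> and \<open>Q\<close> are formally adjoint up to the factor
  \<open>- s\<close>, and \<open>sign\<close> says that \<open>s\<close> is 1 or -1. In each
  identity one factor is supported in \<open>S\<close> while the other is a test function of the
  whole space, possibly nonzero near the boundary of \<open>S\<close>.\<close>

locale green_pair = P: weak_operator P + Q: weak_operator Q
  for P :: "(real^3 \<Rightarrow> 'b::euclidean_space) \<Rightarrow> real^3 \<Rightarrow> 'a::euclidean_space"
    and Q :: "(real^3 \<Rightarrow> 'a) \<Rightarrow> real^3 \<Rightarrow> 'b" +
  fixes s :: real
  assumes sign: "s * s = 1"
    and green_P: "\<phi> \<in> test_functions UNIV \<Longrightarrow> \<psi> \<in> test_functions S \<Longrightarrow> S \<in> sets lebesgue \<Longrightarrow>
      (LINT x|lebesgue_on S. \<phi> x \<bullet> P \<psi> x) = - s * (LINT x|lebesgue_on S. Q \<phi> x \<bullet> \<psi> x)"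
    and green_Q: "\<psi> \<in> test_functions UNIV \<Longrightarrow> \<phi> \<in> test_functions S \<Longrightarrow> S \<in> sets lebesgue \<Longrightarrow>
      (LINT x|lebesgue_on S. \<psi> x \<bullet> Q \<phi> x) = - s * (LINT x|lebesgue_on S. P \<psi> x \<bullet> \<phi> x)"
begin

text \<open>The weak derivative of a test function is the classical one: \<open>- s Q\<close> is the
  classical gradient or curl, since \<open>P\<close> itself is the operator on the testing
  side.\<close>

lemma has_weak_test_P:
  assumes \<phi>: "\<phi> \<in> test_functions UNIV" and S: "S \<in> sets lebesgue"
  shows "has_weak S P \<phi> (\<lambda>x. - s *\<^sub>R Q \<phi> x)"
  unfolding has_weak_def
  using L2_test_functions(1)[OF \<phi> S] L2_scaleR[OF Q.op_L2[OF \<phi> S], of "- s"] green_P[OF \<phi> _ S] by auto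

lemma has_weak_test_Q:
  assumes \<psi>: "\<psi> \<in> test_functions UNIV" and S: "S \<in> sets lebesgue"
  shows "has_weak S Q \<psi> (\<lambda>x. - s *\<^sub>R P \<psi> x)"
  unfolding has_weak_def
  using L2_test_functions(1)[OF \<psi> S] L2_scaleR[OF P.op_L2[OF \<psi> S], of "- s"] green_Q[OF \<psi> _ S] by auto

text \<open>The bracket on the right is the defect in the identity defining
  \<open>has_weak S Q G F\<close>. An equation tested with test functions is therefore the same as
  weak differentiability of \<open>G\<close>.\<close>

lemma integral_test_P:
  assumes S: "open S" and \<phi>: "\<phi> \<in> test_functions S" and G: "G \<in> L2 S" and F: "F \<in> L2 S"
  shows "(LINT x|lebesgue_on S. weak S P \<phi> x \<bullet> G x + s * (\<phi> x \<bullet> F x)) =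
    s * ((LINT x|lebesgue_on S. F x \<bullet> \<phi> x) - (LINT x|lebesgue_on S. G x \<bullet> Q \<phi> x))"
proof -
  have S': "S \<in> sets lebesgue"
    using S by simp
  have \<phi>': "\<phi> \<in> test_functions UNIV"
    using \<phi> test_functions_mono[of S UNIV] by blast
  have "(LINT x|lebesgue_on S. weak S P \<phi> x \<bullet> G x + s * (\<phi> x \<bullet> F x)) =
      (LINT x|lebesgue_on S. s * (F x \<bullet> \<phi> x) - s * (G x \<bullet> Q \<phi> x))"
  proof (rule integral_AE_cong_lebesgue_on[OF S'])
    show "AE x in lebesgue_on S. weak S P \<phi> x \<bullet> G x + s * (\<phi> x \<bullet> F x) = s * (F x \<bullet> \<phi> x) - s * (G x \<bullet> Q \<phi> x)"
      using has_weak_AE_weak[OF has_weak_test_P[OF \<phi>' S'] S]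
      by eventually_elim (simp add: inner_commute)
  qed
  moreover have "integrable (lebesgue_on S) (\<lambda>x. F x \<bullet> \<phi> x)" "integrable (lebesgue_on S) (\<lambda>x. G x \<bullet> Q \<phi> x)"
    by (intro L2_inner_integrable F G test_functions_L2[OF \<phi> S'] Q.op_test_L2[OF \<phi> S'])+
  ultimately show ?thesis
    by (simp add: right_diff_distrib)
qed

lemma bdry_test_left:
  assumes S: "open S" and \<phi>: "\<phi> \<in> test_functions S" and w: "w \<in> weak_dom S Q"
  shows "bdry S P Q s \<phi> w = 0"
  using integral_test_P[OF S \<phi> weak_dom_L2[OF w]] has_weakD[OF has_weak_weak[OF w] \<phi>]
  by (simp add: bdry_def)

lemma test_functions_weak_dom_0:
  assumes S: "open S" and \<phi>: "\<phi> \<in> test_functions S"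
  shows "\<phi> \<in> weak_dom_0 S P Q s"
proof -
  have "\<phi> \<in> test_functions UNIV"
    using \<phi> test_functions_mono[of S UNIV] by blast
  then have "\<phi> \<in> weak_dom S P"
    using weak_domI[OF has_weak_test_P] S by simp
  then show ?thesis
    using bdry_test_left[OF S \<phi>] by (simp add: weak_dom_0_def)
qed

lemma has_weak_if_test:
  assumes S: "open S" and G: "G \<in> L2 S" and F: "F \<in> L2 S"
    and eq: "\<And>\<phi>. \<phi> \<in> test_functions S \<Longrightarrow> (LINT x|lebesgue_on S. weak S P \<phi> x \<bullet> G x + s * (\<phi> x \<bullet> F x)) = 0"
  shows "has_weak S Q G F"
proof -
  have "s \<noteq> 0"
    using sign by auto
  then have "(LINT x|lebesgue_on S. G x \<bullet> Q \<phi> x) = (LINT x|lebesgue_on S. F x \<bullet> \<phi> x)"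
    if "\<phi> \<in> test_functions S" for \<phi>
    using integral_test_P[OF S that G F] eq[OF that] by simp
  then show ?thesis
    using G F by (simp add: has_weak_def)
qed

text \<open>A test function has no boundary pairing with \<open>w\<close>, so the equation forces
  \<open>F\<close> to be the weak derivative of \<open>G\<close>. Then its right side is the pairing
  with \<open>G\<close>, and what remains is equality of the functionals.\<close>

lemma local_equation_iff:
  assumes K: "open K" and w: "w \<in> weak_dom K Q" and G: "G \<in> L2 K" and F: "F \<in> L2 K"
  shows "(\<forall>u\<in>weak_dom K P. bdry K P Q s u w = (LINT x|lebesgue_on K. weak K P u x \<bullet> G x + s * (u x \<bullet> F x)))
    \<longleftrightarrow> has_weak K Q G F \<and> (\<forall>u\<in>weak_dom K P. bdry K P Q s u w = bdry K P Q s u G)"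
    (is "?L \<longleftrightarrow> ?R")
proof -
  have eq: "bdry K P Q s u G = (LINT x|lebesgue_on K. weak K P u x \<bullet> G x + s * (u x \<bullet> F x))"
    if "has_weak K Q G F" "u \<in> weak_dom K P" for u
    by (rule bdry_eq[OF K has_weak_weak[OF that(2)] that(1)])
  have "has_weak K Q G F" if L: ?L
  proof (rule has_weak_if_test[OF K G F])
    fix \<phi> :: "real^3 \<Rightarrow> 'a"
    assume \<phi>: "\<phi> \<in> test_functions K"
    have "\<phi> \<in> weak_dom K P"
      by (rule weak_dom_0D[OF test_functions_weak_dom_0[OF K \<phi>]])
    then show "(LINT x|lebesgue_on K. weak K P \<phi> x \<bullet> G x + s * (\<phi> x \<bullet> F x)) = 0"
      using bspec[OF L] bdry_test_left[OF K \<phi> w] by simp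
  qed
  then show ?thesis
    using eq by auto
qed

lemma global_equation_imp_has_weak:
  assumes S: "open S" and G: "G \<in> L2 S" and F: "F \<in> L2 S"
    and eq: "\<And>u. u \<in> weak_dom_0 S P Q s \<Longrightarrow> (LINT x|lebesgue_on S. weak S P u x \<bullet> G x + s * (u x \<bullet> F x)) = 0"
  shows "has_weak S Q G F"
  using test_functions_weak_dom_0[OF S] by (intro has_weak_if_test[OF S G F] eq)

lemma bdry_lincomb:
  assumes S: "open S" and u: "u \<in> weak_dom S P" and u': "u' \<in> weak_dom S P" and w: "w \<in> weak_dom S Q"
  shows "bdry S P Q s (\<lambda>x. c *\<^sub>R u x + u' x) w = c * bdry S P Q s u w + bdry S P Q s u' w"
proof -
  have S': "S \<in> sets lebesgue"
    using S by simp
  note hu = has_weak_weak[OF u] and hu' = has_weak_weak[OF u'] and hw = has_weak_weak[OF w]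
  have "bdry S P Q s (\<lambda>x. c *\<^sub>R u x + u' x) w =
      (LINT x|lebesgue_on S. (c *\<^sub>R weak S P u x + weak S P u' x) \<bullet> w x + s * ((c *\<^sub>R u x + u' x) \<bullet> weak S Q w x))"
    by (rule bdry_eq[OF S P.has_weak_lincomb[OF S' hu hu'] hw])
  also have "\<dots> = (LINT x|lebesgue_on S. c * (weak S P u x \<bullet> w x + s * (u x \<bullet> weak S Q w x)) +
      (weak S P u' x \<bullet> w x + s * (u' x \<bullet> weak S Q w x)))"
    by (rule Bochner_Integration.integral_cong) (simp_all add: algebra_simps)
  also have "\<dots> = c * bdry S P Q s u w + bdry S P Q s u' w"
    unfolding bdry_def
    using bdry_integrable[OF weak_dom_L2[OF u] weak_dom_L2[OF w], of s]
      bdry_integrable[OF weak_dom_L2[OF u'] weak_dom_L2[OF w], of s]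
    by (simp only: Bochner_Integration.integral_add integrable_mult_right integral_mult_right_zero)
  finally show ?thesis .
qed

lemma weak_dom_0_lincomb:
  assumes S: "open S" and u: "u \<in> weak_dom_0 S P Q s" and u': "u' \<in> weak_dom_0 S P Q s"
  shows "(\<lambda>x. c *\<^sub>R u x + u' x) \<in> weak_dom_0 S P Q s"
proof -
  have d: "u \<in> weak_dom S P" "u' \<in> weak_dom S P"
    using u u' by (simp_all add: weak_dom_0_def)
  then have "(\<lambda>x. c *\<^sub>R u x + u' x) \<in> weak_dom S P"
    using P.weak_dom_lincomb S by simp
  then show ?thesis
    using u u' bdry_lincomb[OF S d] by (simp add: weak_dom_0_def)
qed

text \<open>Cauchy-Schwarz on both terms, with \<open>s\<close> of modulus 1. This is the continuity
  of the pairing on which closedness of the zero trace space rests.\<close>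

lemma bdry_bound:
  assumes u: "u \<in> weak_dom S P" and w: "w \<in> weak_dom S Q"
  shows "\<bar>bdry S P Q s u w\<bar> \<le> L2_norm S (weak S P u) * L2_norm S w + L2_norm S u * L2_norm S (weak S Q w)"
proof -
  have "\<bar>s\<bar> = 1"
    using sign by (metis abs_1 abs_mult_self_eq abs_square_eq_1 power2_eq_square)
  have "bdry S P Q s u w = (LINT x|lebesgue_on S. weak S P u x \<bullet> w x) + s * (LINT x|lebesgue_on S. u x \<bullet> weak S Q w x)"
    unfolding bdry_def using weak_dom_L2[OF u] weak_dom_L2[OF w] by (simp add: L2_inner_integrable)
  also have "\<bar>\<dots>\<bar> \<le> \<bar>LINT x|lebesgue_on S. weak S P u x \<bullet> w x\<bar> + \<bar>s * (LINT x|lebesgue_on S. u x \<bullet> weak S Q w x)\<bar>"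
    by (rule abs_triangle_ineq)
  also have "\<dots> \<le> L2_norm S (weak S P u) * L2_norm S w + L2_norm S u * L2_norm S (weak S Q w)"
    unfolding abs_mult \<open>\<bar>s\<bar> = 1\<close> mult_1_left
    by (intro add_mono L2_Cauchy_Schwarz weak_dom_L2[OF u] weak_dom_L2[OF w])
  finally show ?thesis .
qed

end

section \<open>Gradient, curl and divergence\<close>

lemma vector_3_axis:
  "(vector [a, b, c] :: real^3) = a *\<^sub>R axis 1 1 + b *\<^sub>R axis 2 1 + c *\<^sub>R axis 3 1"
  by (simp add: vec_eq_iff forall_3 axis_def)

lemma continuous_partial_component:
  fixes f :: "real^3 \<Rightarrow> real^3"
  assumes "Ck (Suc 0) f"
  shows "continuous_on UNIV (\<lambda>x. partial_deriv i f x $ j)"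
  by (intro continuous_on_component C1_continuous_partial[OF assms])

lemma L2_test_operator:
  fixes \<psi> :: "real^3 \<Rightarrow> 'a::real_normed_vector" and P :: "(real^3 \<Rightarrow> 'a) \<Rightarrow> real^3 \<Rightarrow> 'b::euclidean_space"
  assumes \<psi>: "\<psi> \<in> test_functions UNIV" and S: "S \<in> sets lebesgue" and cont: "continuous_on UNIV (P \<psi>)"
    and outside: "\<And>S x. \<psi> \<in> test_functions S \<Longrightarrow> x \<notin> S \<Longrightarrow> P \<psi> x = 0"
  shows "P \<psi> \<in> L2 S"
proof -
  obtain C where C: "compact C" "\<And>x. x \<notin> C \<Longrightarrow> \<psi> x = 0"
    using \<psi> test_functions_support by metis
  \<comment> \<open>The set in \<open>test_functions\<close> need not be open, so the compact set
    \<open>C\<close> itself may be inserted, and \<open>outside\<close> gives vanishing off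
    \<open>C\<close>.\<close>
  then have "\<psi> \<in> test_functions C"
    using \<psi> by (auto simp: test_functions_def)
  then show ?thesis
    using L2_compact_support[OF cont C(1) _ S] outside by auto
qed

interpretation curl_op: weak_operator classical_curl
proof
  fix \<psi> :: "real^3 \<Rightarrow> real^3" and S :: "(real^3) set" and x
  show outside: "classical_curl \<psi> x = 0" if "\<psi> \<in> test_functions S" "x \<notin> S" for S x
    using partial_deriv_test_outside[OF that] by (simp add: classical_curl_def vector_3_axis)
  assume \<psi>: "\<psi> \<in> test_functions UNIV" and S: "S \<in> sets lebesgue"
  have "continuous_on UNIV (classical_curl \<psi>)"
    unfolding classical_curl_def vector_3_axis
    by (intro continuous_intros continuous_partial_component test_functions_C1[OF \<psi>])
  then show "classical_curl \<psi> \<in> L2 S"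
    using L2_test_operator[OF \<psi> S, of classical_curl] outside by blast
qed

text \<open>The minus sign absorbs the one in \<open>has_weak_grad\<close>, which thereby becomes an
  instance of \<open>has_weak\<close>; likewise for \<open>grad_op\<close> and
  \<open>has_weak_div\<close>.\<close>

interpretation div_op: weak_operator "\<lambda>\<psi> x. - classical_div \<psi> x"
proof
  fix \<psi> :: "real^3 \<Rightarrow> real^3" and S :: "(real^3) set" and x
  show outside: "- classical_div \<psi> x = 0" if "\<psi> \<in> test_functions S" "x \<notin> S" for S x
    using partial_deriv_test_outside[OF that] by (simp add: classical_div_def)
  assume \<psi>: "\<psi> \<in> test_functions UNIV" and S: "S \<in> sets lebesgue"
  have "continuous_on UNIV (\<lambda>x. - classical_div \<psi> x)"
    unfolding classical_div_def
    by (intro continuous_intros continuous_partial_component test_functions_C1[OF \<psi>])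
  then show "(\<lambda>x. - classical_div \<psi> x) \<in> L2 S"
    using L2_test_operator[OF \<psi> S, of "\<lambda>\<psi> x. - classical_div \<psi> x"] outside by blast
qed

interpretation grad_op: weak_operator "\<lambda>\<psi> x. - classical_grad \<psi> x"
proof
  fix \<psi> :: "real^3 \<Rightarrow> real" and S :: "(real^3) set" and x
  show outside: "- classical_grad \<psi> x = 0" if "\<psi> \<in> test_functions S" "x \<notin> S" for S x
    using partial_deriv_test_outside[OF that] by (simp add: classical_grad_def vec_eq_iff)
  assume \<psi>: "\<psi> \<in> test_functions UNIV" and S: "S \<in> sets lebesgue"
  have "continuous_on UNIV (\<lambda>x. - classical_grad \<psi> x)"
    unfolding classical_grad_def
    by (intro continuous_on_minus continuous_on_vec_lambda C1_continuous_partial test_functions_C1[OF \<psi>])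
  then show "(\<lambda>x. - classical_grad \<psi> x) \<in> L2 S"
    using L2_test_operator[OF \<psi> S, of "\<lambda>\<psi> x. - classical_grad \<psi> x"] outside by blast
qed

lemma inner_classical_curl:
  fixes f :: "real^3 \<Rightarrow> real^3"
  shows "y \<bullet> classical_curl f x =
    y $ 1 * partial_deriv 2 f x $ 3 - y $ 1 * partial_deriv 3 f x $ 2 +
    (y $ 2 * partial_deriv 3 f x $ 1 - y $ 2 * partial_deriv 1 f x $ 3) +
    (y $ 3 * partial_deriv 1 f x $ 2 - y $ 3 * partial_deriv 2 f x $ 1)"
  by (simp add: classical_curl_def inner_vec_def sum_3 algebra_simps)

text \<open>Integration by parts changes the sign of each of the six terms, and regrouping them by
  components of \<open>\<psi>\<close> changes it back, because the curl is antisymmetric in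
  derivative and component.\<close>

lemma integral_classical_curl:
  fixes \<phi> :: "real^3 \<Rightarrow> real^3"
  assumes \<phi>: "\<phi> \<in> test_functions UNIV" and \<psi>: "\<psi> \<in> test_functions S" and S: "S \<in> sets lebesgue"
  shows "(LINT x|lebesgue_on S. \<phi> x \<bullet> classical_curl \<psi> x) = (LINT x|lebesgue_on S. classical_curl \<phi> x \<bullet> \<psi> x)"
proof -
  note parts = test_functions_by_parts[OF test_functions_C1[OF \<phi>] \<psi> S]
  have i1: "integrable (lebesgue_on S) (\<lambda>x. \<phi> x $ i * partial_deriv k \<psi> x $ j)" for i j k
    using parts(1)[of "axis i 1" k "axis j 1"] by (simp add: inner_axis)
  have i2: "integrable (lebesgue_on S) (\<lambda>x. \<psi> x $ j * partial_deriv k \<phi> x $ i)" for i j k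
    using parts(2)[of k "axis i 1" "axis j 1"] by (simp add: inner_axis mult.commute)
  have eq: "(LINT x|lebesgue_on S. \<phi> x $ i * partial_deriv k \<psi> x $ j) =
      - (LINT x|lebesgue_on S. \<psi> x $ j * partial_deriv k \<phi> x $ i)" for i j k
    using parts(3)[of "axis i 1" k "axis j 1"] by (simp add: inner_axis mult.commute)
  have "(LINT x|lebesgue_on S. \<phi> x \<bullet> classical_curl \<psi> x) = (LINT x|lebesgue_on S. \<psi> x \<bullet> classical_curl \<phi> x)"
    unfolding inner_classical_curl by (simp add: i1 i2 eq)
  then show ?thesis
    by (simp add: inner_commute)
qed

interpretation curl: green_pair classical_curl classical_curl "-1"
  by unfold_locales (simp_all add: integral_classical_curl)

lemma integral_classical_div:
  fixes \<phi> :: "real^3 \<Rightarrow> real"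
  assumes \<phi>: "\<phi> \<in> test_functions UNIV" and \<psi>: "\<psi> \<in> test_functions S" and S: "S \<in> sets lebesgue"
  shows "(LINT x|lebesgue_on S. \<phi> x * classical_div \<psi> x) = - (LINT x|lebesgue_on S. classical_grad \<phi> x \<bullet> \<psi> x)"
proof -
  note parts = test_functions_by_parts[OF test_functions_C1[OF \<phi>] \<psi> S]
  have i1: "integrable (lebesgue_on S) (\<lambda>x. \<phi> x * partial_deriv k \<psi> x $ k)" for k
    using parts(1)[of 1 k "axis k 1"] by (simp add: inner_axis)
  have i2: "integrable (lebesgue_on S) (\<lambda>x. partial_deriv k \<phi> x * \<psi> x $ k)" for k
    using parts(2)[of k 1 "axis k 1"] by (simp add: inner_axis)
  have eq: "(LINT x|lebesgue_on S. \<phi> x * partial_deriv k \<psi> x $ k) =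
      - (LINT x|lebesgue_on S. partial_deriv k \<phi> x * \<psi> x $ k)" for k
    using parts(3)[of 1 k "axis k 1"] by (simp add: inner_axis)
  show ?thesis
    by (simp add: classical_div_def classical_grad_def inner_vec_def sum_distrib_left i1 i2 eq sum_negf)
qed

lemma integral_classical_grad:
  fixes \<psi> :: "real^3 \<Rightarrow> real^3"
  assumes \<psi>: "\<psi> \<in> test_functions UNIV" and \<phi>: "\<phi> \<in> test_functions S" and S: "S \<in> sets lebesgue"
  shows "(LINT x|lebesgue_on S. \<psi> x \<bullet> classical_grad \<phi> x) = - (LINT x|lebesgue_on S. classical_div \<psi> x * \<phi> x)"
proof -
  note parts = test_functions_by_parts[OF test_functions_C1[OF \<psi>] \<phi> S]
  have i1: "integrable (lebesgue_on S) (\<lambda>x. \<psi> x $ k * partial_deriv k \<phi> x)" for k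
    using parts(1)[of "axis k 1" k 1] by (simp add: inner_axis)
  have i2: "integrable (lebesgue_on S) (\<lambda>x. partial_deriv k \<psi> x $ k * \<phi> x)" for k
    using parts(2)[of k "axis k 1" 1] by (simp add: inner_axis)
  have eq: "(LINT x|lebesgue_on S. \<psi> x $ k * partial_deriv k \<phi> x) =
      - (LINT x|lebesgue_on S. partial_deriv k \<psi> x $ k * \<phi> x)" for k
    using parts(3)[of "axis k 1" k 1] by (simp add: inner_axis)
  show ?thesis
    by (simp add: classical_div_def classical_grad_def inner_vec_def sum_distrib_right i1 i2 eq sum_negf)
qed

interpretation flux: green_pair "\<lambda>\<psi> x. - classical_div \<psi> x" "\<lambda>\<psi> x. - classical_grad \<psi> x" 1
  by unfold_locales (simp_all add: integral_classical_div integral_classical_grad)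

section \<open>Meshes\<close>

locale mesh =
  fixes \<Omega> :: "(real^3) set" and \<T> :: "(real^3) set set"
  assumes open_domain: "open \<Omega>" and finite_mesh: "finite \<T>"
    and interior_subset_domain: "K \<in> \<T> \<Longrightarrow> interior K \<subseteq> \<Omega>"
    and interiors_disjoint: "K \<in> \<T> \<Longrightarrow> K' \<in> \<T> \<Longrightarrow> K \<noteq> K' \<Longrightarrow> interior K \<inter> interior K' = {}"
    and negligible_skeleton: "negligible (\<Omega> - (\<Union>K\<in>\<T>. interior K))"
begin

lemma domain_measurable: "\<Omega> \<in> sets lebesgue"
  using open_domain by simp

lemma interior_measurable: "interior K \<in> sets lebesgue"
  by simp

lemma sum_indicator_interior:
  fixes g :: "(real^3) set \<Rightarrow> 'b::real_vector"
  assumes K: "K \<in> \<T>" and x: "x \<in> interior K"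
  shows "(\<Sum>L\<in>\<T>. indicator (interior L) x *\<^sub>R g L) = g K"
proof -
  have "indicator (interior L) x *\<^sub>R g L = 0" if "L \<in> \<T> - {K}" for L
    using interiors_disjoint[of L K] K x that by (auto split: split_indicator)
  then have "(\<Sum>L\<in>\<T> - {K}. indicator (interior L) x *\<^sub>R g L) = 0"
    by (intro sum.neutral ballI)
  moreover have "(\<Sum>L\<in>\<T>. indicator (interior L) x *\<^sub>R g L) =
      indicator (interior K) x *\<^sub>R g K + (\<Sum>L\<in>\<T> - {K}. indicator (interior L) x *\<^sub>R g L)"
    by (rule sum.remove[OF finite_mesh K])
  ultimately show ?thesis
    using x by simp
qed

lemma AE_skeleton: "AE x in lebesgue_on \<Omega>. x \<in> (\<Union>K\<in>\<T>. interior K)"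
proof -
  have "AE x in lebesgue. x \<in> \<Omega> \<longrightarrow> x \<in> (\<Union>K\<in>\<T>. interior K)"
    unfolding eventually_ae_filter_negligible using negligible_skeleton by (intro exI conjI) auto
  then show ?thesis
    using domain_measurable by (simp add: AE_restrict_space_iff)
qed

lemma AE_mesh:
  assumes "\<And>K. K \<in> \<T> \<Longrightarrow> AE x in lebesgue_on (interior K). R x"
  shows "AE x in lebesgue_on \<Omega>. R x"
proof -
  have "AE x in lebesgue. \<forall>K\<in>\<T>. x \<in> interior K \<longrightarrow> R x"
    using assms by (intro AE_finite_allI finite_mesh) (simp add: AE_restrict_space_iff)
  then have "AE x in lebesgue_on \<Omega>. \<forall>K\<in>\<T>. x \<in> interior K \<longrightarrow> R x"
    using domain_measurable by (simp add: AE_restrict_space_iff eventually_mono)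
  with AE_skeleton show ?thesis
    by eventually_elim auto
qed

lemma integral_mesh:
  fixes f :: "real^3 \<Rightarrow> real"
  assumes f: "integrable (lebesgue_on \<Omega>) f"
  shows "(LINT x|lebesgue_on \<Omega>. f x) = (\<Sum>K\<in>\<T>. LINT x|lebesgue_on (interior K). f x)"
proof -
  have i: "integrable (lebesgue_on \<Omega>) (\<lambda>x. indicator (interior K) x *\<^sub>R f x)" if "K \<in> \<T>" for K
    using f interior_subset_domain[OF that]
    by (intro integrable_mult_indicator) (simp_all add: sets_restrict_space_iff domain_measurable)
  have "(LINT x|lebesgue_on \<Omega>. f x) = (LINT x|lebesgue_on \<Omega>. (\<Sum>K\<in>\<T>. indicator (interior K) x *\<^sub>R f x))"
  proof (rule integral_AE_cong_lebesgue_on[OF domain_measurable])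
    show "AE x in lebesgue_on \<Omega>. f x = (\<Sum>K\<in>\<T>. indicator (interior K) x *\<^sub>R f x)"
      using AE_skeleton
    proof eventually_elim
      case (elim x)
      then obtain K where "K \<in> \<T>" "x \<in> interior K"
        by auto
      then show ?case
        using sum_indicator_interior[of K x "\<lambda>_. f x"] by simp
    qed
  qed
  also have "\<dots> = (\<Sum>K\<in>\<T>. LINT x|lebesgue_on \<Omega>. indicator (interior K) x *\<^sub>R f x)"
    by (rule Bochner_Integration.integral_sum) (rule i)
  also have "\<dots> = (\<Sum>K\<in>\<T>. LINT x|lebesgue_on (interior K). f x)"
  proof (rule sum.cong[OF refl])
    fix K
    assume K: "K \<in> \<T>"
    have "indicator \<Omega> x *\<^sub>R indicator (interior K) x *\<^sub>R f x = indicator (interior K) x *\<^sub>R f x" for x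
      using interior_subset_domain[OF K] by (auto split: split_indicator)
    then have eq: "(\<lambda>x. indicator \<Omega> x *\<^sub>R indicator (interior K) x *\<^sub>R f x) = (\<lambda>x. indicator (interior K) x *\<^sub>R f x)"
      by (rule ext)
    show "(LINT x|lebesgue_on \<Omega>. indicator (interior K) x *\<^sub>R f x) = (LINT x|lebesgue_on (interior K). f x)"
      using domain_measurable interior_measurable[of K]
      by (simp only: integral_restrict_space eq space_completion space_lborel space_borel Int_UNIV_right)
  qed
  finally show ?thesis .
qed

lemma L2_indicator:
  fixes f :: "real^3 \<Rightarrow> 'b::euclidean_space"
  assumes f: "f \<in> L2 (interior K)"
  shows "(\<lambda>x. indicator (interior K) x *\<^sub>R f x) \<in> L2 \<Omega>"
proof -
  have "(\<lambda>x. indicator (interior K) x *\<^sub>R f x) \<in> L2 UNIV"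
  proof -
    have "(norm (indicator (interior K) x *\<^sub>R f x))\<^sup>2 = indicator (interior K) x *\<^sub>R (norm (f x))\<^sup>2" for x
      by (auto split: split_indicator)
    then have eq: "(\<lambda>x. (norm (indicator (interior K) x *\<^sub>R f x))\<^sup>2) = (\<lambda>x. indicator (interior K) x *\<^sub>R (norm (f x))\<^sup>2)"
      by (rule ext)
    have "(\<lambda>x. indicator (interior K) x *\<^sub>R f x) \<in> borel_measurable lebesgue"
      using L2_measurable[OF f] by (subst (asm) borel_measurable_restrict_space_iff) auto
    moreover have "integrable lebesgue (\<lambda>x. indicator (interior K) x *\<^sub>R (norm (f x))\<^sup>2)"
      using L2_integrable[OF f] by (subst (asm) integrable_restrict_space) auto
    ultimately show ?thesis
      unfolding L2_def lebesgue_on_UNIV_eq mem_Collect_eq eq by (rule conjI)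
  qed
  then show ?thesis
    by (rule L2_mono) (simp_all add: domain_measurable)
qed

end

text \<open>Next to a frontier point there are points strictly above the Lipschitz graph. They have
  neighbourhoods that miss the domain, so the frontier point is not interior to the closure.\<close>

lemma lipschitz_domain_interior_closure:
  assumes "lipschitz_domain \<Omega>"
  shows "interior (closure \<Omega>) \<subseteq> \<Omega>"
proof
  fix p
  assume p: "p \<in> interior (closure \<Omega>)"
  have "open \<Omega>"
    using assms by (simp add: lipschitz_domain_def)
  show "p \<in> \<Omega>"
  proof (rule ccontr)
    assume np: "p \<notin> \<Omega>"
    then have "p \<in> frontier \<Omega>"
      using p \<open>open \<Omega>\<close> interior_subset by (auto simp: frontier_def interior_open)
    then obtain U \<nu> g L where U: "open U" "p \<in> U" and \<nu>: "norm \<nu> = 1" and L: "L-lipschitz_on UNIV g"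
      and eq: "\<Omega> \<inter> U = {x \<in> U. x \<bullet> \<nu> < g (x - (x \<bullet> \<nu>) *\<^sub>R \<nu>)}"
      using assms unfolding lipschitz_domain_def by blast
    \<comment> \<open>Height above the graph; inside \<open>U\<close> the domain is where it is
      negative.\<close>
    let ?q = "\<lambda>x. x \<bullet> \<nu> - g (x - (x \<bullet> \<nu>) *\<^sub>R \<nu>)"
    have g: "continuous_on UNIV g"
      using lipschitz_on_continuous_on[OF L] .
    have q: "continuous_on UNIV ?q"
      by (intro continuous_intros continuous_on_compose2[OF g]) auto
    have q0: "0 \<le> ?q p"
    proof (rule ccontr)
      assume "\<not> 0 \<le> ?q p"
      then have "p \<in> \<Omega> \<inter> U"
        unfolding eq using U(2) by simp
      then show False
        using np by simp
    qed
    have "open (U \<inter> interior (closure \<Omega>))" "p \<in> U \<inter> interior (closure \<Omega>)"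
      using U p by auto
    then obtain r where r: "0 < r" "ball p r \<subseteq> U \<inter> interior (closure \<Omega>)"
      by (rule openE)
    \<comment> \<open>Moving along \<open>\<nu>\<close> does not change the projection to the
      orthogonal plane, so the height grows by exactly \<open>r / 2\<close> while \<open>y\<close>
      stays in the ball.\<close>
    define y where "y = p + (r / 2) *\<^sub>R \<nu>"
    have "y \<in> ball p r"
      using r(1) \<nu> by (simp add: y_def dist_norm)
    then have y: "y \<in> U" "y \<in> closure \<Omega>"
      using subsetD[OF r(2) \<open>y \<in> ball p r\<close>] subsetD[OF interior_subset, of y "closure \<Omega>"] by auto
    have \<nu>\<nu>: "\<nu> \<bullet> \<nu> = 1"
      using \<nu> by (simp add: norm_eq_1)
    then have "y \<bullet> \<nu> = p \<bullet> \<nu> + r / 2" "y - (y \<bullet> \<nu>) *\<^sub>R \<nu> = p - (p \<bullet> \<nu>) *\<^sub>R \<nu>"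
      by (simp_all add: y_def inner_add_left scaleR_add_left)
    then have "?q y = ?q p + r / 2"
      by simp
    then have "0 < ?q y"
      using q0 r(1) by simp
    let ?V = "U \<inter> {x. 0 < ?q x}"
    have "open ?V"
      using U(1) q by (intro open_Int open_Collect_less continuous_on_const)
    moreover have "y \<in> ?V"
      using y(1) \<open>0 < ?q y\<close> by simp
    moreover have "?V \<inter> \<Omega> = {}"
    proof -
      have "x \<notin> \<Omega>" if "x \<in> ?V" for x
      proof
        assume "x \<in> \<Omega>"
        then have "x \<in> \<Omega> \<inter> U"
          using that by simp
        then show False
          unfolding eq using that by simp
      qed
      then show ?thesis
        by auto
    qed
    ultimately show False
      using y(2) open_Int_closure_eq_empty[of ?V \<Omega>] by auto
  qed
qed

lemma mesh_tetrahedral_mesh: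
  assumes \<Omega>: "lipschitz_domain \<Omega>" and \<T>: "tetrahedral_mesh \<T> \<Omega>"
  shows "mesh \<Omega> \<T>"
proof
  show "open \<Omega>"
    using \<Omega> by (simp add: lipschitz_domain_def)
  have tri: "triangulation \<T>" and simp3: "\<And>K. K \<in> \<T> \<Longrightarrow> 3 simplex K" and un: "\<Union>\<T> = closure \<Omega>"
    using \<T> by (auto simp: tetrahedral_mesh_def)
  show fin: "finite \<T>"
    using tri by (simp add: triangulation_def)
  show "interior K \<subseteq> \<Omega>" if "K \<in> \<T>" for K
  proof -
    have "interior K \<subseteq> interior (closure \<Omega>)"
      using that un by (intro interior_mono) auto
    then show ?thesis
      using lipschitz_domain_interior_closure[OF \<Omega>] by simp
  qed
  show "interior K \<inter> interior K' = {}" if K: "K \<in> \<T>" "K' \<in> \<T>" "K \<noteq> K'" for K K'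
  proof (rule ccontr)
    assume "interior K \<inter> interior K' \<noteq> {}"
    then obtain x where x: "x \<in> interior K" "x \<in> interior K'"
      by auto
    have f: "(K \<inter> K') face_of K" "(K' \<inter> K) face_of K'"
      using tri K by (auto simp: triangulation_def)
    \<comment> \<open>A proper face misses the interior. Since \<open>x\<close> is interior to both
      elements, the common face is all of each, and the elements coincide.\<close>
    have "K \<inter> K' = K"
      using face_of_disjoint_interior[OF f(1)] x interior_subset by auto
    moreover have "K' \<inter> K = K'"
      using face_of_disjoint_interior[OF f(2)] x interior_subset by auto
    ultimately show False
      using K(3) by auto
  qed
  have "negligible (\<Union>K\<in>\<T>. frontier K)"
    using fin simp3 convex_simplex by (intro negligible_Union) (auto intro!: negligible_convex_frontier)
  moreover have "\<Omega> - (\<Union>K\<in>\<T>. interior K) \<subseteq> (\<Union>K\<in>\<T>. frontier K)"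
  proof
    fix x
    assume x: "x \<in> \<Omega> - (\<Union>K\<in>\<T>. interior K)"
    then have "x \<in> \<Union>\<T>"
      using un closure_subset by auto
    then obtain K where "K \<in> \<T>" "x \<in> K"
      by auto
    then show "x \<in> (\<Union>K\<in>\<T>. frontier K)"
      using x closure_subset by (auto simp: frontier_def)
  qed
  ultimately show "negligible (\<Omega> - (\<Union>K\<in>\<T>. interior K))"
    by (rule negligible_subset)
qed

section \<open>Broken spaces\<close>

definition broken_dom :: "(real^3) set \<Rightarrow> (real^3) set set \<Rightarrow> ((real^3 \<Rightarrow> 'b::euclidean_space) \<Rightarrow> real^3 \<Rightarrow> 'a) \<Rightarrow>
    (real^3 \<Rightarrow> 'a::euclidean_space) set" where
  "broken_dom \<Omega> \<T> P = {u \<in> L2 \<Omega>. \<forall>K\<in>\<T>. u \<in> weak_dom (interior K) P}"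

definition broken_weak :: "(real^3) set set \<Rightarrow> ((real^3 \<Rightarrow> 'b::euclidean_space) \<Rightarrow> real^3 \<Rightarrow> 'a) \<Rightarrow>
    (real^3 \<Rightarrow> 'a::euclidean_space) \<Rightarrow> real^3 \<Rightarrow> 'b" where
  "broken_weak \<T> P u x = (\<Sum>K\<in>\<T>. indicator (interior K) x *\<^sub>R weak (interior K) P u x)"

definition broken_norm :: "(real^3) set \<Rightarrow> (real^3) set set \<Rightarrow> ((real^3 \<Rightarrow> 'b::euclidean_space) \<Rightarrow> real^3 \<Rightarrow> 'a) \<Rightarrow>
    (real^3 \<Rightarrow> 'a::euclidean_space) \<Rightarrow> real" where
  "broken_norm \<Omega> \<T> P u =
     sqrt ((L2_norm \<Omega> u)\<^sup>2 + (\<Sum>K\<in>\<T>. (L2_norm (interior K) (weak (interior K) P u))\<^sup>2))"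

lemma L2_norm_mono:
  assumes "u \<in> L2 S" and T: "T \<subseteq> S" "S \<in> sets lebesgue" "T \<in> sets lebesgue"
  shows "L2_norm T u \<le> L2_norm S u"
proof -
  have i: "integrable lebesgue (\<lambda>x. indicator S x *\<^sub>R (norm (u x))\<^sup>2)"
      "integrable lebesgue (\<lambda>x. indicator T x *\<^sub>R (norm (u x))\<^sup>2)"
    using L2_integrable[OF assms(1)] L2_integrable[OF L2_mono[OF assms]] T
    by (simp_all add: integrable_restrict_space)
  have "(LINT x|lebesgue. indicator T x *\<^sub>R (norm (u x))\<^sup>2) \<le> (LINT x|lebesgue. indicator S x *\<^sub>R (norm (u x))\<^sup>2)"
    using T(1) by (intro integral_mono i) (auto split: split_indicator)
  then show ?thesis
    using T by (simp add: L2_norm_def integral_restrict_space)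
qed

locale weak_mesh = weak_operator P + mesh \<Omega> \<T>
  for P :: "(real^3 \<Rightarrow> 'b::euclidean_space) \<Rightarrow> real^3 \<Rightarrow> 'a::euclidean_space" and \<Omega> \<T>
begin

lemma broken_weak_eq: "K \<in> \<T> \<Longrightarrow> x \<in> interior K \<Longrightarrow> broken_weak \<T> P u x = weak (interior K) P u x"
  unfolding broken_weak_def by (rule sum_indicator_interior)

lemma broken_weak_L2:
  assumes "\<And>K. K \<in> \<T> \<Longrightarrow> u \<in> weak_dom (interior K) P"
  shows "broken_weak \<T> P u \<in> L2 \<Omega>"
proof -
  have "(\<lambda>x. \<Sum>K\<in>A. indicator (interior K) x *\<^sub>R weak (interior K) P u x) \<in> L2 \<Omega>" if "A \<subseteq> \<T>" for A
    using finite_subset[OF that finite_mesh] that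
  proof (induction A rule: finite_induct)
    case empty
    show ?case
      by (simp add: L2_zero)
  next
    case (insert K A)
    then have "weak (interior K) P u \<in> L2 (interior K)"
      by (intro weak_dom_L2(2) assms) simp
    then show ?case
      unfolding sum.insert[OF insert.hyps(1,2)] using insert.prems
      by (intro L2_add L2_indicator insert.IH) simp_all
  qed
  then show ?thesis
    unfolding broken_weak_def[abs_def] by simp
qed

lemma has_weak_element:
  assumes "has_weak \<Omega> P u v" and "K \<in> \<T>"
  shows "has_weak (interior K) P u v"
  by (rule has_weak_mono[OF assms(1) interior_subset_domain[OF assms(2)] domain_measurable interior_measurable])

lemma weak_dom_element: "u \<in> weak_dom \<Omega> P \<Longrightarrow> K \<in> \<T> \<Longrightarrow> u \<in> weak_dom (interior K) P"
  by (rule weak_domI[OF has_weak_element[OF has_weak_weak]])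

lemma weak_dom_imp_broken_dom: "u \<in> weak_dom \<Omega> P \<Longrightarrow> u \<in> broken_dom \<Omega> \<T> P"
  using weak_dom_L2(1) weak_dom_element by (simp add: broken_dom_def)

lemma weak_element_AE:
  assumes "u \<in> weak_dom \<Omega> P" and "K \<in> \<T>"
  shows "AE x in lebesgue_on (interior K). weak (interior K) P u x = weak \<Omega> P u x"
  by (rule has_weak_AE_weak[OF has_weak_element[OF has_weak_weak]]) (use assms in simp_all)

lemma broken_weak_AE:
  assumes u: "u \<in> weak_dom \<Omega> P"
  shows "AE x in lebesgue_on \<Omega>. broken_weak \<T> P u x = weak \<Omega> P u x"
proof (rule AE_mesh)
  fix K
  assume K: "K \<in> \<T>"
  have "AE x in lebesgue_on (interior K). x \<in> interior K"
    by (rule AE_I2) simp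
  with weak_element_AE[OF u K] show "AE x in lebesgue_on (interior K). broken_weak \<T> P u x = weak \<Omega> P u x"
    by eventually_elim (simp add: broken_weak_eq[OF K])
qed

text \<open>For fields with a weak derivative on the whole domain the two norms are equal, not
  merely equivalent. Continuity and differentiability of curves of such fields thus mean the same in
  both.\<close>

lemma broken_norm_eq_graph_norm:
  assumes u: "u \<in> weak_dom \<Omega> P"
  shows "broken_norm \<Omega> \<T> P u = graph_norm \<Omega> P u"
proof -
  have "(\<Sum>K\<in>\<T>. (L2_norm (interior K) (weak (interior K) P u))\<^sup>2) =
      (\<Sum>K\<in>\<T>. LINT x|lebesgue_on (interior K). (norm (weak \<Omega> P u x))\<^sup>2)"
    using L2_norm_AE_cong[OF interior_measurable weak_element_AE[OF u]]
    by (intro sum.cong refl) (simp add: L2_norm_power2)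
  also have "\<dots> = (L2_norm \<Omega> (weak \<Omega> P u))\<^sup>2"
    unfolding L2_norm_power2 by (rule integral_mesh[symmetric]) (rule L2_integrable[OF weak_dom_L2(2)[OF u]])
  finally show ?thesis
    by (simp add: broken_norm_def graph_norm_def)
qed

lemma L2_norm_le_broken_norm: "L2_norm \<Omega> u \<le> broken_norm \<Omega> \<T> P u"
  unfolding broken_norm_def by (rule real_le_rsqrt) (simp add: sum_nonneg)

lemma L2_norm_weak_le_broken_norm:
  assumes "K \<in> \<T>"
  shows "L2_norm (interior K) (weak (interior K) P u) \<le> broken_norm \<Omega> \<T> P u"
  unfolding broken_norm_def
proof (rule real_le_rsqrt)
  have "(L2_norm (interior K) (weak (interior K) P u))\<^sup>2 \<le>
      (\<Sum>K\<in>\<T>. (L2_norm (interior K) (weak (interior K) P u))\<^sup>2)"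
    by (rule member_le_sum[OF assms _ finite_mesh]) simp
  then show "(L2_norm (interior K) (weak (interior K) P u))\<^sup>2 \<le> (L2_norm \<Omega> u)\<^sup>2 +
      (\<Sum>K\<in>\<T>. (L2_norm (interior K) (weak (interior K) P u))\<^sup>2)"
    by (simp add: add_increasing)
qed

lemma broken_dom_lincomb:
  assumes "u \<in> broken_dom \<Omega> \<T> P" and "u' \<in> broken_dom \<Omega> \<T> P"
  shows "(\<lambda>x. c *\<^sub>R u x + u' x) \<in> broken_dom \<Omega> \<T> P"
  using assms weak_dom_lincomb[OF interior_measurable] by (simp add: broken_dom_def L2_add L2_scaleR)

end

locale green_mesh = green_pair P Q s + mesh \<Omega> \<T>
  for P :: "(real^3 \<Rightarrow> 'b::euclidean_space) \<Rightarrow> real^3 \<Rightarrow> 'a::euclidean_space"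
    and Q :: "(real^3 \<Rightarrow> 'a) \<Rightarrow> real^3 \<Rightarrow> 'b" and s :: real and \<Omega> \<T>
begin

sublocale PM: weak_mesh P \<Omega> \<T> ..
sublocale QM: weak_mesh Q \<Omega> \<T> ..

text \<open>\<open>w\<close> has a weak derivative on the whole domain, and its restriction serves
  in every element; so only \<open>u\<close> retains an elementwise derivative after
  summation.\<close>

lemma sum_bdry_eq:
  assumes u: "u \<in> broken_dom \<Omega> \<T> P" and w: "w \<in> weak_dom \<Omega> Q"
  shows "(\<Sum>K\<in>\<T>. bdry (interior K) P Q s u w) =
    (LINT x|lebesgue_on \<Omega>. broken_weak \<T> P u x \<bullet> w x + s * (u x \<bullet> weak \<Omega> Q w x))"
proof -
  have uK: "u \<in> weak_dom (interior K) P" if "K \<in> \<T>" for K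
    using u that by (simp add: broken_dom_def)
  have "bdry (interior K) P Q s u w =
      (LINT x|lebesgue_on (interior K). broken_weak \<T> P u x \<bullet> w x + s * (u x \<bullet> weak \<Omega> Q w x))"
    if K: "K \<in> \<T>" for K
  proof -
    have "bdry (interior K) P Q s u w =
        (LINT x|lebesgue_on (interior K). weak (interior K) P u x \<bullet> w x + s * (u x \<bullet> weak \<Omega> Q w x))"
      by (rule bdry_eq[OF open_interior has_weak_weak[OF uK[OF K]] QM.has_weak_element[OF has_weak_weak[OF w] K]])
    also have "\<dots> = (LINT x|lebesgue_on (interior K). broken_weak \<T> P u x \<bullet> w x + s * (u x \<bullet> weak \<Omega> Q w x))"
      by (rule Bochner_Integration.integral_cong) (simp_all add: PM.broken_weak_eq[OF K])
    finally show ?thesis .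
  qed
  moreover have "integrable (lebesgue_on \<Omega>) (\<lambda>x. broken_weak \<T> P u x \<bullet> w x + s * (u x \<bullet> weak \<Omega> Q w x))"
    by (rule bdry_integrable[OF _ PM.broken_weak_L2[OF uK] weak_dom_L2[OF w]]) (use u in \<open>simp_all add: broken_dom_def\<close>)
  ultimately show ?thesis
    by (simp add: integral_mesh)
qed

lemma sum_bdry:
  assumes u: "u \<in> weak_dom \<Omega> P" and w: "w \<in> weak_dom \<Omega> Q"
  shows "(\<Sum>K\<in>\<T>. bdry (interior K) P Q s u w) = bdry \<Omega> P Q s u w"
  unfolding sum_bdry_eq[OF PM.weak_dom_imp_broken_dom[OF u] w] bdry_def[of \<Omega>]
proof (rule integral_AE_cong_lebesgue_on[OF domain_measurable])
  show "AE x in lebesgue_on \<Omega>. broken_weak \<T> P u x \<bullet> w x + s * (u x \<bullet> weak \<Omega> Q w x) =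
      weak \<Omega> P u x \<bullet> w x + s * (u x \<bullet> weak \<Omega> Q w x)"
    using PM.broken_weak_AE[OF u] by eventually_elim simp
qed

text \<open>Testing with test functions shows that the elementwise derivative is the weak derivative on the whole domain.\<close>

lemma weak_dom_0_iff:
  "u \<in> weak_dom_0 \<Omega> P Q s \<longleftrightarrow>
   u \<in> broken_dom \<Omega> \<T> P \<and> (\<forall>w\<in>weak_dom \<Omega> Q. (\<Sum>K\<in>\<T>. bdry (interior K) P Q s u w) = 0)"
    (is "?L \<longleftrightarrow> ?R")
proof
  assume ?L
  then show ?R
    using sum_bdry PM.weak_dom_imp_broken_dom by (simp add: weak_dom_0_def)
next
  assume ?R
  then have u: "u \<in> broken_dom \<Omega> \<T> P"
    and zero: "\<And>w. w \<in> weak_dom \<Omega> Q \<Longrightarrow> (\<Sum>K\<in>\<T>. bdry (interior K) P Q s u w) = 0"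
    by auto
  have uL2: "u \<in> L2 \<Omega>" and W: "broken_weak \<T> P u \<in> L2 \<Omega>"
    using u PM.broken_weak_L2 by (simp_all add: broken_dom_def)
  have "(LINT x|lebesgue_on \<Omega>. u x \<bullet> P \<psi> x) = (LINT x|lebesgue_on \<Omega>. broken_weak \<T> P u x \<bullet> \<psi> x)"
    if \<psi>: "\<psi> \<in> test_functions \<Omega>" for \<psi>
  proof -
    have "\<psi> \<in> test_functions UNIV"
      using \<psi> test_functions_mono[of \<Omega> UNIV] by simp
    then have h: "has_weak \<Omega> Q \<psi> (\<lambda>x. - s *\<^sub>R P \<psi> x)"
      by (rule has_weak_test_Q[OF _ domain_measurable])
    have "0 = (LINT x|lebesgue_on \<Omega>. broken_weak \<T> P u x \<bullet> \<psi> x + s * (u x \<bullet> weak \<Omega> Q \<psi> x))"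
      using zero[OF weak_domI[OF h]] sum_bdry_eq[OF u weak_domI[OF h]] by simp
    also have "\<dots> = (LINT x|lebesgue_on \<Omega>. broken_weak \<T> P u x \<bullet> \<psi> x - u x \<bullet> P \<psi> x)"
    proof (rule integral_AE_cong_lebesgue_on[OF domain_measurable])
      \<comment> \<open>The weak derivative of \<open>\<psi>\<close> is \<open>- s P \<psi>\<close>,
        and together with the factor \<open>s\<close> of the pairing it leaves
        \<open>- P \<psi>\<close>.\<close>
      have ss: "s * (s * y) = y" for y
        using sign by (simp flip: mult.assoc)
      show "AE x in lebesgue_on \<Omega>. broken_weak \<T> P u x \<bullet> \<psi> x + s * (u x \<bullet> weak \<Omega> Q \<psi> x) =
          broken_weak \<T> P u x \<bullet> \<psi> x - u x \<bullet> P \<psi> x"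
        using has_weak_AE_weak[OF h open_domain] by eventually_elim (simp add: ss)
    qed
    also have "\<dots> = (LINT x|lebesgue_on \<Omega>. broken_weak \<T> P u x \<bullet> \<psi> x) - (LINT x|lebesgue_on \<Omega>. u x \<bullet> P \<psi> x)"
      by (intro Bochner_Integration.integral_diff L2_inner_integrable W uL2
          test_functions_L2[OF \<psi> domain_measurable] P.op_test_L2[OF \<psi> domain_measurable])
    finally show ?thesis
      by simp
  qed
  then have "has_weak \<Omega> P u (broken_weak \<T> P u)"
    using uL2 W by (simp add: has_weak_def)
  then have "u \<in> weak_dom \<Omega> P"
    by (rule weak_domI)
  then show ?L
    using zero sum_bdry by (simp add: weak_dom_0_def)
qed

text \<open>The factor beside the broken norm depends on \<open>w\<close> alone, so for fixed
  \<open>w\<close> the jump functional is continuous in \<open>z\<close>.\<close>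

lemma sum_bdry_bound:
  assumes z: "z \<in> broken_dom \<Omega> \<T> P" and w: "w \<in> weak_dom \<Omega> Q"
  shows "\<bar>\<Sum>K\<in>\<T>. bdry (interior K) P Q s z w\<bar> \<le>
    broken_norm \<Omega> \<T> P z * (\<Sum>K\<in>\<T>. L2_norm (interior K) w + L2_norm (interior K) (weak (interior K) Q w))"
proof -
  have "\<bar>bdry (interior K) P Q s z w\<bar> \<le>
      broken_norm \<Omega> \<T> P z * (L2_norm (interior K) w + L2_norm (interior K) (weak (interior K) Q w))"
    if K: "K \<in> \<T>" for K
  proof -
    have zK: "z \<in> weak_dom (interior K) P" and wK: "w \<in> weak_dom (interior K) Q" and zL: "z \<in> L2 \<Omega>"
      using z K QM.weak_dom_element[OF w K] by (simp_all add: broken_dom_def)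
    have "L2_norm (interior K) z \<le> broken_norm \<Omega> \<T> P z"
      using L2_norm_mono[OF zL interior_subset_domain[OF K] domain_measurable interior_measurable] PM.L2_norm_le_broken_norm[of z] by linarith
    then have "L2_norm (interior K) (weak (interior K) P z) * L2_norm (interior K) w +
        L2_norm (interior K) z * L2_norm (interior K) (weak (interior K) Q w)
      \<le> broken_norm \<Omega> \<T> P z * L2_norm (interior K) w + broken_norm \<Omega> \<T> P z * L2_norm (interior K) (weak (interior K) Q w)"
      by (intro add_mono mult_right_mono PM.L2_norm_weak_le_broken_norm[OF K] L2_norm_nonneg)
    then show ?thesis
      using bdry_bound[OF zK wK] by (simp add: distrib_left)
  qed
  then have "(\<Sum>K\<in>\<T>. \<bar>bdry (interior K) P Q s z w\<bar>) \<le>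
      (\<Sum>K\<in>\<T>. broken_norm \<Omega> \<T> P z * (L2_norm (interior K) w + L2_norm (interior K) (weak (interior K) Q w)))"
    by (rule sum_mono)
  then show ?thesis
    unfolding sum_distrib_left using sum_abs[of "\<lambda>K. bdry (interior K) P Q s z w" \<T>] by linarith
qed

text \<open>By \<open>weak_dom_0_iff\<close> the zero trace space is the common kernel, inside the
  broken space, of the jump functionals, each of which is continuous. The filter is arbitrary so
  that the lemma applies to difference quotients.\<close>

lemma weak_dom_0_closed:
  assumes F: "F \<noteq> bot" and u: "\<forall>\<^sub>F t in F. u t \<in> weak_dom_0 \<Omega> P Q s" and v: "v \<in> broken_dom \<Omega> \<T> P"
    and lim: "((\<lambda>t. broken_norm \<Omega> \<T> P (\<lambda>x. u t x - v x)) \<longlongrightarrow> 0) F"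
  shows "v \<in> weak_dom_0 \<Omega> P Q s"
  unfolding weak_dom_0_iff
proof (intro conjI ballI v)
  fix w
  assume w: "w \<in> weak_dom \<Omega> Q"
  let ?c = "\<Sum>K\<in>\<T>. bdry (interior K) P Q s v w"
  let ?C = "\<Sum>K\<in>\<T>. L2_norm (interior K) w + L2_norm (interior K) (weak (interior K) Q w)"
  have "\<forall>\<^sub>F t in F. \<bar>?c\<bar> \<le> broken_norm \<Omega> \<T> P (\<lambda>x. u t x - v x) * ?C"
    using u
  proof eventually_elim
    case (elim t)
    then have ut: "u t \<in> broken_dom \<Omega> \<T> P" and zero: "(\<Sum>K\<in>\<T>. bdry (interior K) P Q s (u t) w) = 0"
      using w by (simp_all add: weak_dom_0_iff)
    have d: "(\<lambda>x. u t x - v x) \<in> broken_dom \<Omega> \<T> P"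
      using PM.broken_dom_lincomb[OF v ut, of "-1"] by simp
    have "bdry (interior K) P Q s (\<lambda>x. u t x - v x) w = - bdry (interior K) P Q s v w + bdry (interior K) P Q s (u t) w"
      if "K \<in> \<T>" for K
      using bdry_lincomb[OF open_interior, of v K "u t" w "-1"] v ut that QM.weak_dom_element[OF w that]
      by (simp add: broken_dom_def)
    then have "(\<Sum>K\<in>\<T>. bdry (interior K) P Q s (\<lambda>x. u t x - v x) w) = - ?c"
      using zero by (simp add: sum_subtractf)
    then show ?case
      using sum_bdry_bound[OF d w] by simp
  qed
  moreover have "((\<lambda>t. broken_norm \<Omega> \<T> P (\<lambda>x. u t x - v x) * ?C) \<longlongrightarrow> 0 * ?C) F"
    by (intro tendsto_mult lim tendsto_const)
  ultimately have "\<bar>?c\<bar> \<le> 0 * ?C"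
    by (intro tendsto_lowerbound[OF _ _ F])
  then show "?c = 0"
    by simp
qed

text \<open>Left to right, the boundary terms cancel in the sum because \<open>u\<close> satisfies
  the jump conditions against \<open>w\<close>. Right to left, the global equation yields the weak
  derivative of \<open>G\<close> on the domain; it restricts to the elements, where
  \<open>local_equation_iff\<close> applies.\<close>

lemma equations_iff:
  assumes w: "w \<in> weak_dom \<Omega> Q" and G: "G \<in> L2 \<Omega>" and F: "F \<in> L2 \<Omega>"
  shows "(\<forall>K\<in>\<T>. \<forall>u\<in>weak_dom (interior K) P. bdry (interior K) P Q s u w =
        (LINT x|lebesgue_on (interior K). weak (interior K) P u x \<bullet> G x + s * (u x \<bullet> F x))) \<longleftrightarrow>
    (\<forall>u\<in>weak_dom_0 \<Omega> P Q s. (LINT x|lebesgue_on \<Omega>. weak \<Omega> P u x \<bullet> G x + s * (u x \<bullet> F x)) = 0) \<and>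
    (\<forall>K\<in>\<T>. \<forall>u\<in>weak_dom (interior K) P. bdry (interior K) P Q s u w = bdry (interior K) P Q s u G)"
    (is "?L \<longleftrightarrow> ?W \<and> ?T")
proof -
  have local: "(\<forall>u\<in>weak_dom (interior K) P. bdry (interior K) P Q s u w =
        (LINT x|lebesgue_on (interior K). weak (interior K) P u x \<bullet> G x + s * (u x \<bullet> F x))) \<longleftrightarrow>
      has_weak (interior K) Q G F \<and>
      (\<forall>u\<in>weak_dom (interior K) P. bdry (interior K) P Q s u w = bdry (interior K) P Q s u G)"
    if K: "K \<in> \<T>" for K
    by (rule local_equation_iff[OF open_interior QM.weak_dom_element[OF w K]
          L2_mono[OF G interior_subset_domain[OF K] domain_measurable interior_measurable] L2_mono[OF F interior_subset_domain[OF K] domain_measurable interior_measurable]])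
  have "(LINT x|lebesgue_on \<Omega>. weak \<Omega> P u x \<bullet> G x + s * (u x \<bullet> F x)) = 0"
    if L: ?L and u: "u \<in> weak_dom_0 \<Omega> P Q s" for u
  proof -
    have ud: "u \<in> weak_dom \<Omega> P"
      by (rule weak_dom_0D[OF u])
    have "(LINT x|lebesgue_on \<Omega>. weak \<Omega> P u x \<bullet> G x + s * (u x \<bullet> F x)) =
        (\<Sum>K\<in>\<T>. LINT x|lebesgue_on (interior K). weak \<Omega> P u x \<bullet> G x + s * (u x \<bullet> F x))"
      by (rule integral_mesh[OF bdry_integrable[OF weak_dom_L2[OF ud] G F]])
    also have "\<dots> = (\<Sum>K\<in>\<T>. bdry (interior K) P Q s u w)"
    proof (rule sum.cong[OF refl])
      fix K
      assume K: "K \<in> \<T>"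
      have "bdry (interior K) P Q s u w =
          (LINT x|lebesgue_on (interior K). weak (interior K) P u x \<bullet> G x + s * (u x \<bullet> F x))"
        using L K PM.weak_dom_element[OF ud K] by simp
      also have "\<dots> = (LINT x|lebesgue_on (interior K). weak \<Omega> P u x \<bullet> G x + s * (u x \<bullet> F x))"
      proof (rule integral_AE_cong_lebesgue_on[OF interior_measurable])
        show "AE x in lebesgue_on (interior K). weak (interior K) P u x \<bullet> G x + s * (u x \<bullet> F x) =
            weak \<Omega> P u x \<bullet> G x + s * (u x \<bullet> F x)"
          using PM.weak_element_AE[OF ud K] by eventually_elim simp
      qed
      finally show "(LINT x|lebesgue_on (interior K). weak \<Omega> P u x \<bullet> G x + s * (u x \<bullet> F x)) =
          bdry (interior K) P Q s u w" ..
    qed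
    also have "\<dots> = 0"
      using u w by (simp add: weak_dom_0_iff)
    finally show ?thesis .
  qed
  then have "?L \<Longrightarrow> ?W \<and> ?T"
    using local by simp
  moreover have ?L if W: ?W and T: ?T
  proof -
    have "has_weak \<Omega> Q G F"
      by (rule global_equation_imp_has_weak[OF open_domain G F]) (use W in simp)
    then show ?thesis
      using local T QM.has_weak_element by simp
  qed
  ultimately show ?thesis
    by (intro iffI) simp_all
qed

end

section \<open>Curves\<close>

text \<open>A connected set other than a single point has no isolated points. At an isolated time
  every limit would hold vacuously and any field would be a derivative.\<close>

lemma at_within_interval_neq_bot:
  fixes I :: "real set"
  assumes "is_interval I" and "interior I \<noteq> {}" and "t \<in> I"
  shows "at t within I \<noteq> bot"
proof -
  have "\<nexists>a. I = {a}"
    using assms(2) by (auto simp: interior_singleton)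
  then have "t islimpt I"
    using assms by (intro connected_imp_perfect) (auto simp: is_interval_connected)
  then show ?thesis
    by (simp add: trivial_limit_within)
qed

lemma eventually_in_within: "\<forall>\<^sub>F s in at t within I. s \<in> I \<and> s \<noteq> t"
  by (simp add: eventually_at_filter)

lemma C0_curveD: "C0_curve I X N u \<Longrightarrow> t \<in> I \<Longrightarrow> u t \<in> X"
  "C0_curve I X N u \<Longrightarrow> t \<in> I \<Longrightarrow> ((\<lambda>s. N (\<lambda>x. u s x - u t x)) \<longlongrightarrow> 0) (at t within I)"
  by (simp_all add: C0_curve_def)

lemma C1_curveD: "C1_curve I X N u \<Longrightarrow> t \<in> I \<Longrightarrow> u t \<in> X"
  by (simp add: C1_curve_def)

text \<open>Changes of space, of seminorm and of representatives in one rule. Only times in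
  \<open>I\<close> matter, as the limits are taken within \<open>I\<close>.\<close>

lemma C0_curve_transfer:
  assumes u: "C0_curve I X N u" and X: "\<And>t. t \<in> I \<Longrightarrow> u t \<in> X'"
    and N: "\<And>s t. s \<in> I \<Longrightarrow> t \<in> I \<Longrightarrow> N (\<lambda>x. u s x - u t x) = N' (\<lambda>x. u' s x - u' t x)"
    and X': "\<And>t. t \<in> I \<Longrightarrow> u' t \<in> X'"
  shows "C0_curve I X' N' u'"
  unfolding C0_curve_def
proof (intro conjI ballI X')
  fix t
  assume t: "t \<in> I"
  have "\<forall>\<^sub>F s in at t within I. N (\<lambda>x. u s x - u t x) = N' (\<lambda>x. u' s x - u' t x)"
    using eventually_in_within[of I t] by eventually_elim (simp add: N t)
  then show "((\<lambda>s. N' (\<lambda>x. u' s x - u' t x)) \<longlongrightarrow> 0) (at t within I)"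
    by (rule Lim_transform_eventually[OF C0_curveD(2)[OF u t]])
qed

lemma curve_has_deriv_transfer:
  assumes "curve_has_deriv I N u v t"
    and "\<And>s. s \<in> I \<Longrightarrow> N (\<lambda>x. (u s x - u t x) /\<^sub>R (s - t) - v x) = N' (\<lambda>x. (u' s x - u' t x) /\<^sub>R (s - t) - v x)"
  shows "curve_has_deriv I N' u' v t"
  unfolding curve_has_deriv_def
proof (rule Lim_transform_eventually[OF assms(1)[unfolded curve_has_deriv_def]])
  show "\<forall>\<^sub>F s in at t within I. N (\<lambda>x. (u s x - u t x) /\<^sub>R (s - t) - v x) =
      N' (\<lambda>x. (u' s x - u' t x) /\<^sub>R (s - t) - v x)"
    using eventually_in_within[of I t] by eventually_elim (simp add: assms(2))
qed

lemma curve_has_deriv_AE_cong: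
  assumes S: "S \<in> sets lebesgue" and ae: "\<And>t. t \<in> I \<Longrightarrow> AE x in lebesgue_on S. u t x = u' t x"
    and t: "t \<in> I" and u: "curve_has_deriv I (L2_norm S) u v t"
  shows "curve_has_deriv I (L2_norm S) u' v t"
proof (rule curve_has_deriv_transfer[OF u])
  fix r
  assume r: "r \<in> I"
  show "L2_norm S (\<lambda>x. (u r x - u t x) /\<^sub>R (r - t) - v x) = L2_norm S (\<lambda>x. (u' r x - u' t x) /\<^sub>R (r - t) - v x)"
    by (rule L2_norm_AE_cong[OF S]) (use ae[OF r] ae[OF t] in eventually_elim, simp)
qed

text \<open>The equality is literal, not almost everywhere: the property under \<open>SOME\<close>
  depends on the curve only up to null sets, so the same choice is made for both.\<close>

lemma time_deriv_AE_cong: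
  assumes S: "S \<in> sets lebesgue" and ae: "\<And>t. t \<in> I \<Longrightarrow> AE x in lebesgue_on S. u t x = u' t x"
    and t: "t \<in> I"
  shows "time_deriv S I u t = time_deriv S I u' t"
proof -
  have ae': "AE x in lebesgue_on S. u' t x = u t x" if "t \<in> I" for t
    using ae[OF that] by eventually_elim simp
  have "curve_has_deriv I (L2_norm S) u v t = curve_has_deriv I (L2_norm S) u' v t" for v
    using curve_has_deriv_AE_cong[OF S ae t] curve_has_deriv_AE_cong[OF S ae' t] by (rule iffI)
  then show ?thesis
    by (simp add: time_deriv_def)
qed

lemma C0_curve_L2_AE_cong:
  assumes S: "S \<in> sets lebesgue" and ae: "\<And>t. t \<in> I \<Longrightarrow> AE x in lebesgue_on S. u t x = u' t x"
    and u: "C0_curve I (L2 S) (L2_norm S) u"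
  shows "C0_curve I (L2 S) (L2_norm S) u'"
proof (rule C0_curve_transfer[OF u C0_curveD(1)[OF u]])
  show "u' t \<in> L2 S" if "t \<in> I" for t
    by (rule L2_AE_cong[OF S ae[OF that] C0_curveD(1)[OF u that]])
  show "L2_norm S (\<lambda>x. u r x - u t x) = L2_norm S (\<lambda>x. u' r x - u' t x)" if "r \<in> I" "t \<in> I" for r t
    by (rule L2_norm_AE_cong[OF S]) (use ae[OF that(1)] ae[OF that(2)] in eventually_elim, simp)
qed

lemma C1_curve_L2_AE_cong:
  assumes S: "S \<in> sets lebesgue" and ae: "\<And>t. t \<in> I \<Longrightarrow> AE x in lebesgue_on S. u t x = u' t x"
    and u: "C1_curve I (L2 S) (L2_norm S) u"
  shows "C1_curve I (L2 S) (L2_norm S) u'"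
proof -
  obtain v where v: "C0_curve I (L2 S) (L2_norm S) v" "\<forall>t\<in>I. curve_has_deriv I (L2_norm S) u (v t) t"
    using u by (auto simp: C1_curve_def)
  have "u' t \<in> L2 S" if "t \<in> I" for t
    by (rule L2_AE_cong[OF S ae[OF that] C1_curveD[OF u that]])
  moreover have "curve_has_deriv I (L2_norm S) u' (v t) t" if "t \<in> I" for t
    by (rule curve_has_deriv_AE_cong[OF S ae that bspec[OF v(2) that]])
  ultimately show ?thesis
    unfolding C1_curve_def by (intro conjI ballI exI[of _ v] v(1))
qed

lemma C1_curve_time_deriv:
  assumes u: "C1_curve I (L2 S) (L2_norm S) u" and t: "t \<in> I"
  shows "time_deriv S I u t \<in> L2 S" and "curve_has_deriv I (L2_norm S) u (time_deriv S I u t) t"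
proof -
  obtain v where v: "C0_curve I (L2 S) (L2_norm S) v" "\<forall>t\<in>I. curve_has_deriv I (L2_norm S) u (v t) t"
    using u by (auto simp: C1_curve_def)
  have "v t \<in> L2 S \<and> curve_has_deriv I (L2_norm S) u (v t) t"
    using C0_curveD(1)[OF v(1) t] v(2) t by simp
  then have "time_deriv S I u t \<in> L2 S \<and> curve_has_deriv I (L2_norm S) u (time_deriv S I u t) t"
    unfolding time_deriv_def
    by (rule someI[where P="\<lambda>v. v \<in> L2 S \<and> curve_has_deriv I (L2_norm S) u v t"])
  then show "time_deriv S I u t \<in> L2 S" "curve_has_deriv I (L2_norm S) u (time_deriv S I u t) t"
    by simp_all
qed

text \<open>The difference quotients converge to both candidates, so the seminorm of
  \<open>v - v'\<close> is bounded by a quantity tending to 0 along a nontrivial filter.\<close>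

lemma curve_has_deriv_unique:
  assumes t: "t \<in> I" and bot: "at t within I \<noteq> bot" and u: "\<And>t. t \<in> I \<Longrightarrow> u t \<in> L2 S"
    and v: "v \<in> L2 S" "curve_has_deriv I (L2_norm S) u v t"
    and v': "v' \<in> L2 S" "curve_has_deriv I (L2_norm S) u v' t"
  shows "AE x in lebesgue_on S. v x = v' x"
proof -
  let ?q = "\<lambda>r x. (u r x - u t x) /\<^sub>R (r - t)"
  have "\<forall>\<^sub>F r in at t within I. L2_norm S (\<lambda>x. v x - v' x) \<le>
      L2_norm S (\<lambda>x. ?q r x - v x) + L2_norm S (\<lambda>x. ?q r x - v' x)"
    using eventually_in_within[of I t]
  proof eventually_elim
    case (elim r)
    have q: "?q r \<in> L2 S"
      using elim by (intro L2_scaleR L2_diff u t) simp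
    show ?case
      using L2_norm_triangle[OF L2_diff[OF v(1) q] L2_diff[OF q v'(1)]] L2_norm_minus_commute[of S v "?q r"]
      by simp
  qed
  moreover have "((\<lambda>r. L2_norm S (\<lambda>x. ?q r x - v x) + L2_norm S (\<lambda>x. ?q r x - v' x)) \<longlongrightarrow> 0 + 0) (at t within I)"
    using v(2) v'(2) unfolding curve_has_deriv_def by (rule tendsto_add)
  ultimately have "L2_norm S (\<lambda>x. v x - v' x) \<le> 0 + 0"
    by (intro tendsto_lowerbound[OF _ _ bot])
  then have "L2_norm S (\<lambda>x. v x - v' x) = 0"
    using L2_norm_nonneg[of S "\<lambda>x. v x - v' x"] by simp
  then show ?thesis
    using L2_norm_eq_0[OF L2_diff[OF v(1) v'(1)]] by simp
qed

text \<open>\<open>time_deriv\<close> chooses separately at every time. By uniqueness each choice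
  agrees almost everywhere with the continuous derivative that \<open>C1_curve\<close> provides, and
  continuity passes over.\<close>

lemma C0_curve_time_deriv:
  assumes S: "S \<in> sets lebesgue" and bot: "\<And>t. t \<in> I \<Longrightarrow> at t within I \<noteq> bot"
    and u: "C1_curve I (L2 S) (L2_norm S) u"
  shows "C0_curve I (L2 S) (L2_norm S) (time_deriv S I u)"
proof -
  obtain v where v: "C0_curve I (L2 S) (L2_norm S) v" "\<forall>t\<in>I. curve_has_deriv I (L2_norm S) u (v t) t"
    using u by (auto simp: C1_curve_def)
  have "AE x in lebesgue_on S. v t x = time_deriv S I u t x" if "t \<in> I" for t
    by (rule curve_has_deriv_unique[OF that bot[OF that] C1_curveD[OF u] C0_curveD(1)[OF v(1) that]
          bspec[OF v(2) that] C1_curve_time_deriv[OF u that]])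
  then show ?thesis
    by (rule C0_curve_L2_AE_cong[OF S _ v(1)])
qed

lemma C1_curve_imp_C0_curve:
  assumes u: "C1_curve I (L2 S) (L2_norm S) u"
  shows "C0_curve I (L2 S) (L2_norm S) u"
  unfolding C0_curve_def
proof (intro conjI ballI C1_curveD[OF u])
  fix t
  assume t: "t \<in> I"
  let ?v = "time_deriv S I u t"
  let ?q = "\<lambda>r x. (u r x - u t x) /\<^sub>R (r - t)"
  note v = C1_curve_time_deriv[OF u t]
  have "((\<lambda>r. \<bar>r - t\<bar> * (L2_norm S (\<lambda>x. ?q r x - ?v x) + L2_norm S ?v)) \<longlongrightarrow> \<bar>t - t\<bar> * (0 + L2_norm S ?v)) (at t within I)"
    using v(2) unfolding curve_has_deriv_def by (intro tendsto_intros)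
  then have "((\<lambda>r. \<bar>r - t\<bar> * (L2_norm S (\<lambda>x. ?q r x - ?v x) + L2_norm S ?v)) \<longlongrightarrow> 0) (at t within I)"
    by simp
  moreover have "\<forall>\<^sub>F r in at t within I. norm (L2_norm S (\<lambda>x. u r x - u t x)) \<le>
      \<bar>r - t\<bar> * (L2_norm S (\<lambda>x. ?q r x - ?v x) + L2_norm S ?v)"
    using eventually_in_within[of I t]
  proof eventually_elim
    case (elim r)
    have q: "?q r \<in> L2 S"
      using elim by (intro L2_scaleR L2_diff C1_curveD[OF u] t) simp
    have "L2_norm S (\<lambda>x. u r x - u t x) = L2_norm S (\<lambda>x. (r - t) *\<^sub>R ?q r x)"
      using elim by simp
    also have "\<dots> = \<bar>r - t\<bar> * L2_norm S (?q r)"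
      by (rule L2_norm_scaleR)
    also have "\<dots> \<le> \<bar>r - t\<bar> * (L2_norm S (\<lambda>x. ?q r x - ?v x) + L2_norm S ?v)"
      using L2_norm_triangle[OF L2_diff[OF q v(1)] v(1)] by (intro mult_left_mono) simp_all
    finally show ?case
      by (simp add: L2_norm_nonneg)
  qed
  ultimately show "((\<lambda>r. L2_norm S (\<lambda>x. u r x - u t x)) \<longlongrightarrow> 0) (at t within I)"
    by (rule Lim_null_comparison[rotated])
qed

lemma C0_curve_add:
  assumes u: "C0_curve I (L2 S) (L2_norm S) u" and v: "C0_curve I (L2 S) (L2_norm S) v"
  shows "C0_curve I (L2 S) (L2_norm S) (\<lambda>t x. u t x + v t x)"
  unfolding C0_curve_def
proof (intro conjI ballI)
  fix t
  assume t: "t \<in> I"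
  show "(\<lambda>x. u t x + v t x) \<in> L2 S"
    by (rule L2_add[OF C0_curveD(1)[OF u t] C0_curveD(1)[OF v t]])
  have "\<forall>\<^sub>F r in at t within I. norm (L2_norm S (\<lambda>x. (u r x + v r x) - (u t x + v t x))) \<le>
      L2_norm S (\<lambda>x. u r x - u t x) + L2_norm S (\<lambda>x. v r x - v t x)"
    using eventually_in_within[of I t]
  proof eventually_elim
    case (elim r)
    have "(\<lambda>x. u r x - u t x) \<in> L2 S" "(\<lambda>x. v r x - v t x) \<in> L2 S"
      using elim by (auto intro!: L2_diff C0_curveD(1)[OF u] C0_curveD(1)[OF v] t)
    note L2_norm_triangle[OF this]
    moreover have "(\<lambda>x. (u r x + v r x) - (u t x + v t x)) = (\<lambda>x. (u r x - u t x) + (v r x - v t x))"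
      by (rule ext) simp
    ultimately show ?case
      by (simp add: L2_norm_nonneg)
  qed
  moreover have "((\<lambda>r. L2_norm S (\<lambda>x. u r x - u t x) + L2_norm S (\<lambda>x. v r x - v t x)) \<longlongrightarrow> 0) (at t within I)"
    using tendsto_add[OF C0_curveD(2)[OF u t] C0_curveD(2)[OF v t]] by simp
  ultimately show "((\<lambda>r. L2_norm S (\<lambda>x. (u r x + v r x) - (u t x + v t x))) \<longlongrightarrow> 0) (at t within I)"
    by (rule Lim_null_comparison)
qed

lemma L2_norm_le_graph_norm: "L2_norm S u \<le> graph_norm S P u"
  unfolding graph_norm_def by (rule real_le_rsqrt) simp

lemma C0_curve_graph_imp_L2:
  assumes u: "C0_curve I (weak_dom S P) (graph_norm S P) u"
  shows "C0_curve I (L2 S) (L2_norm S) u"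
  unfolding C0_curve_def
proof (intro conjI ballI)
  fix t
  assume t: "t \<in> I"
  show "u t \<in> L2 S"
    by (rule weak_dom_L2(1)[OF C0_curveD(1)[OF u t]])
  have "\<forall>\<^sub>F r in at t within I. norm (L2_norm S (\<lambda>x. u r x - u t x)) \<le> graph_norm S P (\<lambda>x. u r x - u t x)"
    by (rule always_eventually) (simp add: L2_norm_nonneg L2_norm_le_graph_norm)
  then show "((\<lambda>r. L2_norm S (\<lambda>x. u r x - u t x)) \<longlongrightarrow> 0) (at t within I)"
    by (rule Lim_null_comparison) (rule C0_curveD(2)[OF u t])
qed

text \<open>Continuity of the graph norm can be checked on any given curve \<open>d\<close> of weak
  derivatives. It is used for H and D, whose curl and divergence are prescribed by Maxwell's
  equations as continuous curves.\<close>

lemma (in weak_operator) C0_curve_graphI: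
  assumes S: "open S" and u: "C0_curve I (L2 S) (L2_norm S) u" and d: "C0_curve I (L2 S) (L2_norm S) d"
    and ud: "\<And>t. t \<in> I \<Longrightarrow> has_weak S P (u t) (d t)"
  shows "C0_curve I (weak_dom S P) (graph_norm S P) u"
  unfolding C0_curve_def
proof (intro conjI ballI)
  have S': "S \<in> sets lebesgue"
    using S by simp
  fix t
  assume t: "t \<in> I"
  show "u t \<in> weak_dom S P"
    by (rule weak_domI[OF ud[OF t]])
  have "((\<lambda>r. sqrt ((L2_norm S (\<lambda>x. u r x - u t x))\<^sup>2 + (L2_norm S (\<lambda>x. d r x - d t x))\<^sup>2)) \<longlongrightarrow> sqrt (0\<^sup>2 + 0\<^sup>2)) (at t within I)"
    by (intro tendsto_intros C0_curveD(2)[OF u t] C0_curveD(2)[OF d t])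
  then have "((\<lambda>r. sqrt ((L2_norm S (\<lambda>x. u r x - u t x))\<^sup>2 + (L2_norm S (\<lambda>x. d r x - d t x))\<^sup>2)) \<longlongrightarrow> 0) (at t within I)"
    by simp
  moreover have "\<forall>\<^sub>F r in at t within I. sqrt ((L2_norm S (\<lambda>x. u r x - u t x))\<^sup>2 + (L2_norm S (\<lambda>x. d r x - d t x))\<^sup>2)
      = graph_norm S P (\<lambda>x. u r x - u t x)"
    using eventually_in_within[of I t]
  proof eventually_elim
    case (elim r)
    then have "has_weak S P (\<lambda>x. u r x - u t x) (\<lambda>x. d r x - d t x)"
      by (intro has_weak_diff[OF S'] ud t) simp
    from L2_norm_AE_cong[OF S' has_weak_AE_weak[OF this S]] show ?case
      by (simp add: graph_norm_def)
  qed
  ultimately show "((\<lambda>r. graph_norm S P (\<lambda>x. u r x - u t x)) \<longlongrightarrow> 0) (at t within I)"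
    by (rule Lim_transform_eventually)
qed

section \<open>Curves with zero trace versus broken curves with jump conditions\<close>

context green_mesh
begin

lemma C0_curve_weak_dom_0_iff:
  "C0_curve I (weak_dom_0 \<Omega> P Q s) (graph_norm \<Omega> P) u \<longleftrightarrow>
   C0_curve I (broken_dom \<Omega> \<T> P) (broken_norm \<Omega> \<T> P) u \<and>
   (\<forall>t\<in>I. \<forall>w\<in>weak_dom \<Omega> Q. (\<Sum>K\<in>\<T>. bdry (interior K) P Q s (u t) w) = 0)"
    (is "?L \<longleftrightarrow> ?R")
proof -
  have norm: "broken_norm \<Omega> \<T> P (\<lambda>x. u r x - u t x) = graph_norm \<Omega> P (\<lambda>x. u r x - u t x)"
    if "\<And>t. t \<in> I \<Longrightarrow> u t \<in> weak_dom_0 \<Omega> P Q s" "r \<in> I" "t \<in> I" for r t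
    by (rule PM.broken_norm_eq_graph_norm[OF P.weak_dom_diff[OF domain_measurable
          weak_dom_0D[OF that(1)[OF that(2)]] weak_dom_0D[OF that(1)[OF that(3)]]]])
  show ?thesis
  proof
    assume L: ?L
    have u: "u t \<in> weak_dom_0 \<Omega> P Q s" if "t \<in> I" for t
      by (rule C0_curveD(1)[OF L that])
    have "C0_curve I (broken_dom \<Omega> \<T> P) (broken_norm \<Omega> \<T> P) u"
      by (rule C0_curve_transfer[OF L]) (use u norm in \<open>simp_all add: weak_dom_0_iff\<close>)
    then show ?R
      using u by (simp add: weak_dom_0_iff)
  next
    assume R: ?R
    have u: "u t \<in> weak_dom_0 \<Omega> P Q s" if "t \<in> I" for t
      using R C0_curveD(1)[OF conjunct1[OF R] that] that by (simp add: weak_dom_0_iff)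
    show ?L
      by (rule C0_curve_transfer[OF conjunct1[OF R]]) (use u norm[OF u] in simp_all)
  qed
qed

text \<open>The jump conditions speak of \<open>u t\<close> alone, so from right to left the
  derivative is at first only a curve in the broken space. It enters the zero trace space as a limit
  of difference quotients, which is where \<open>bot\<close> is used.\<close>

lemma C1_curve_weak_dom_0_iff:
  assumes bot: "\<And>t. t \<in> I \<Longrightarrow> at t within I \<noteq> bot"
  shows "C1_curve I (weak_dom_0 \<Omega> P Q s) (graph_norm \<Omega> P) u \<longleftrightarrow>
   C1_curve I (broken_dom \<Omega> \<T> P) (broken_norm \<Omega> \<T> P) u \<and>
   (\<forall>t\<in>I. \<forall>w\<in>weak_dom \<Omega> Q. (\<Sum>K\<in>\<T>. bdry (interior K) P Q s (u t) w) = 0)"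
    (is "?L \<longleftrightarrow> ?R")
proof -
  have quot: "(\<lambda>x. (u r x - u t x) /\<^sub>R (r - t)) \<in> weak_dom_0 \<Omega> P Q s"
    if u: "\<And>t. t \<in> I \<Longrightarrow> u t \<in> weak_dom_0 \<Omega> P Q s" and rt: "r \<in> I" "t \<in> I" for r t
  proof -
    let ?c = "inverse (r - t)"
    have d: "(\<lambda>x. u r x - u t x) \<in> weak_dom_0 \<Omega> P Q s"
      using weak_dom_0_lincomb[OF open_domain u[OF rt(2)] u[OF rt(1)], of "-1"] by simp
    \<comment> \<open>The zero function is obtained as \<open>- d + d\<close>, to serve as second
      summand when \<open>d\<close> is merely scaled.\<close>
    have z: "(\<lambda>x. 0) \<in> weak_dom_0 \<Omega> P Q s"
      using weak_dom_0_lincomb[OF open_domain d d, of "-1"] by simp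
    show ?thesis
      using weak_dom_0_lincomb[OF open_domain d z, of ?c] by simp
  qed
  have norm: "broken_norm \<Omega> \<T> P (\<lambda>x. (u r x - u t x) /\<^sub>R (r - t) - v x) =
      graph_norm \<Omega> P (\<lambda>x. (u r x - u t x) /\<^sub>R (r - t) - v x)"
    if "\<And>t. t \<in> I \<Longrightarrow> u t \<in> weak_dom_0 \<Omega> P Q s" "v \<in> weak_dom_0 \<Omega> P Q s" "r \<in> I" "t \<in> I" for r t v
    by (rule PM.broken_norm_eq_graph_norm[OF P.weak_dom_diff[OF domain_measurable
          weak_dom_0D[OF quot[OF that(1,3,4)]] weak_dom_0D[OF that(2)]]])
  show ?thesis
  proof
    assume L: ?L
    then obtain v where v: "C0_curve I (weak_dom_0 \<Omega> P Q s) (graph_norm \<Omega> P) v"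
      "\<forall>t\<in>I. curve_has_deriv I (graph_norm \<Omega> P) u (v t) t"
      by (auto simp: C1_curve_def)
    have u: "u t \<in> weak_dom_0 \<Omega> P Q s" if "t \<in> I" for t
      by (rule C1_curveD[OF L that])
    have "curve_has_deriv I (broken_norm \<Omega> \<T> P) u (v t) t" if "t \<in> I" for t
      by (rule curve_has_deriv_transfer[OF bspec[OF v(2) that]])
         (rule norm[OF u C0_curveD(1)[OF v(1) that] _ that, symmetric])
    then show ?R
      using v(1) u unfolding C0_curve_weak_dom_0_iff weak_dom_0_iff C1_curve_def by auto
  next
    assume R: ?R
    then obtain v where v: "C0_curve I (broken_dom \<Omega> \<T> P) (broken_norm \<Omega> \<T> P) v"
      "\<forall>t\<in>I. curve_has_deriv I (broken_norm \<Omega> \<T> P) u (v t) t"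
      by (auto simp: C1_curve_def)
    have u: "u t \<in> weak_dom_0 \<Omega> P Q s" if "t \<in> I" for t
      using R C1_curveD[OF conjunct1[OF R] that] that by (simp add: weak_dom_0_iff)
    have v0: "v t \<in> weak_dom_0 \<Omega> P Q s" if "t \<in> I" for t
    proof (rule weak_dom_0_closed[OF bot[OF that] _ C0_curveD(1)[OF v(1) that]])
      show "\<forall>\<^sub>F r in at t within I. (\<lambda>x. (u r x - u t x) /\<^sub>R (r - t)) \<in> weak_dom_0 \<Omega> P Q s"
        using eventually_in_within[of I t] by eventually_elim (rule quot[OF u _ that], simp_all)
      show "((\<lambda>r. broken_norm \<Omega> \<T> P (\<lambda>x. (u r x - u t x) /\<^sub>R (r - t) - v t x)) \<longlongrightarrow> 0) (at t within I)"
        using bspec[OF v(2) that] by (simp only: curve_has_deriv_def)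
    qed
    have "C0_curve I (weak_dom_0 \<Omega> P Q s) (graph_norm \<Omega> P) v"
      using v(1) v0 by (simp add: C0_curve_weak_dom_0_iff weak_dom_0_iff)
    moreover have "curve_has_deriv I (graph_norm \<Omega> P) u (v t) t" if "t \<in> I" for t
      by (rule curve_has_deriv_transfer[OF bspec[OF v(2) that]]) (rule norm[OF u v0[OF that] _ that])
    ultimately show ?L
      using u unfolding C1_curve_def by (intro conjI ballI exI[of _ v])
  qed
qed

end

section \<open>Maxwell's equations\<close>

abbreviation (input) neg_div :: "(real^3 \<Rightarrow> real^3) \<Rightarrow> real^3 \<Rightarrow> real" where
  "neg_div \<equiv> \<lambda>\<psi> x. - classical_div \<psi> x"

abbreviation (input) neg_grad :: "(real^3 \<Rightarrow> real) \<Rightarrow> real^3 \<Rightarrow> real^3" where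
  "neg_grad \<equiv> \<lambda>\<psi> x. - classical_grad \<psi> x"

section \<open>Dictionary between the concrete spaces and the generic ones\<close>

lemma has_weak_curl_eq: "has_weak_curl S = has_weak S classical_curl"
  by (simp add: fun_eq_iff has_weak_curl_def has_weak_def)

lemma has_weak_grad_eq: "has_weak_grad S = has_weak S neg_div"
proof -
  have "a = - b \<longleftrightarrow> - a = b" for a b :: real
    by auto
  then show ?thesis
    by (simp add: fun_eq_iff has_weak_grad_def has_weak_def)
qed

lemma has_weak_div_eq: "has_weak_div S = has_weak S neg_grad"
proof -
  have "a = - b \<longleftrightarrow> - a = b" for a b :: real
    by auto
  then show ?thesis
    by (simp add: fun_eq_iff has_weak_div_def has_weak_def)
qed

lemma weak_curl_eq: "weak_curl S = weak S classical_curl"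
  by (simp add: fun_eq_iff weak_curl_def weak_def has_weak_curl_eq)

lemma weak_grad_eq: "weak_grad S = weak S neg_div"
  by (simp add: fun_eq_iff weak_grad_def weak_def has_weak_grad_eq)

lemma weak_div_eq: "weak_div S = weak S neg_grad"
  by (simp add: fun_eq_iff weak_div_def weak_def has_weak_div_eq)

lemma Hcurl_eq: "Hcurl S = weak_dom S classical_curl"
  by (simp add: Hcurl_def weak_dom_def has_weak_curl_eq)

lemma H1_eq: "H1 S = weak_dom S neg_div"
  by (simp add: H1_def weak_dom_def has_weak_grad_eq)

lemma Hdiv_eq: "Hdiv S = weak_dom S neg_grad"
  by (simp add: Hdiv_def weak_dom_def has_weak_div_eq)

lemma Hcurl_norm_eq: "Hcurl_norm S = graph_norm S classical_curl"
  by (simp add: fun_eq_iff Hcurl_norm_def graph_norm_def weak_curl_eq)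

lemma H1_norm_eq: "H1_norm S = graph_norm S neg_div"
  by (simp add: fun_eq_iff H1_norm_def graph_norm_def weak_grad_eq)

lemma Hdiv_norm_eq: "Hdiv_norm S = graph_norm S neg_grad"
  by (simp add: fun_eq_iff Hdiv_norm_def graph_norm_def weak_div_eq)

lemma bdry_cross_eq: "bdry_cross S = bdry S classical_curl classical_curl (- 1)"
  by (simp add: fun_eq_iff bdry_cross_def bdry_def weak_curl_eq)

lemma bdry_flux_eq: "bdry_flux S = bdry S neg_div neg_grad 1"
  by (simp add: fun_eq_iff bdry_flux_def bdry_def weak_grad_eq weak_div_eq)

lemma bdry_cross_swap: "bdry_cross S u v = - bdry_cross S v u"
  by (simp add: bdry_cross_def inner_commute flip: Bochner_Integration.integral_minus)

text \<open>In \<open>Hcurl_0\<close> the field stands in the second slot of the pairing, in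
  \<open>weak_dom_0\<close> in the first; antisymmetry of \<open>bdry_cross\<close> reconciles the
  two.\<close>

lemma Hcurl_0_eq: "Hcurl_0 S = weak_dom_0 S classical_curl classical_curl (- 1)"
proof (rule set_eqI)
  fix u
  have "bdry_cross S v u = 0 \<longleftrightarrow> bdry_cross S u v = 0" for v
    using bdry_cross_swap[of S v u] by simp
  then have "(\<forall>v\<in>V. bdry_cross S v u = 0) \<longleftrightarrow> (\<forall>v\<in>V. bdry_cross S u v = 0)" for V
    by simp
  then show "u \<in> Hcurl_0 S \<longleftrightarrow> u \<in> weak_dom_0 S classical_curl classical_curl (- 1)"
    by (simp add: Hcurl_0_def weak_dom_0_def tangential_trace_def Hcurl_eq flip: bdry_cross_eq)
qed

lemma H1_0_eq: "H1_0 S = weak_dom_0 S neg_div neg_grad 1"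
  by (simp add: H1_0_def weak_dom_0_def scalar_trace_def H1_eq Hdiv_eq bdry_flux_eq)

lemma tangential_trace_eq_iff:
  "tangential_trace S v = tangential_trace S v' \<longleftrightarrow>
   (\<forall>u\<in>weak_dom S classical_curl. bdry S classical_curl classical_curl (- 1) u v = bdry S classical_curl classical_curl (- 1) u v')"
  by (auto simp: tangential_trace_def Hcurl_eq bdry_cross_eq fun_eq_iff restrict_def)

lemma normal_trace_eq_iff:
  "normal_trace S w = normal_trace S w' \<longleftrightarrow>
   (\<forall>u\<in>weak_dom S neg_div. bdry S neg_div neg_grad 1 u w = bdry S neg_div neg_grad 1 u w')"
  by (auto simp: normal_trace_def H1_eq bdry_flux_eq fun_eq_iff restrict_def)

lemma broken_Hcurl_eq: "broken_Hcurl \<Omega> \<T> = broken_dom \<Omega> \<T> classical_curl"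
  by (simp add: broken_Hcurl_def broken_dom_def Hcurl_eq)

lemma broken_H1_eq: "broken_H1 \<Omega> \<T> = broken_dom \<Omega> \<T> neg_div"
  by (simp add: broken_H1_def broken_dom_def H1_eq)

lemma broken_curl_eq: "broken_curl \<T> = broken_weak \<T> classical_curl"
  by (simp add: fun_eq_iff broken_curl_def broken_weak_def weak_curl_eq)

lemma broken_grad_eq: "broken_grad \<T> = broken_weak \<T> neg_div"
  by (simp add: fun_eq_iff broken_grad_def broken_weak_def weak_grad_eq)

lemma broken_Hcurl_norm_eq: "broken_Hcurl_norm \<Omega> \<T> = broken_norm \<Omega> \<T> classical_curl"
  by (simp add: fun_eq_iff broken_Hcurl_norm_def broken_norm_def weak_curl_eq)

lemma broken_H1_norm_eq: "broken_H1_norm \<Omega> \<T> = broken_norm \<Omega> \<T> neg_div"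
  by (simp add: fun_eq_iff broken_H1_norm_def broken_norm_def weak_grad_eq)

lemmas generic_eqs = weak_curl_eq weak_grad_eq weak_div_eq Hcurl_eq H1_eq Hdiv_eq Hcurl_norm_eq H1_norm_eq
  Hdiv_norm_eq bdry_cross_eq bdry_flux_eq Hcurl_0_eq H1_0_eq broken_Hcurl_eq broken_H1_eq broken_curl_eq
  broken_grad_eq broken_Hcurl_norm_eq broken_H1_norm_eq

section \<open>Equivalence of the two problems on a mesh\<close>

context mesh
begin

interpretation curl: green_mesh classical_curl classical_curl "- 1" \<Omega> \<T> ..
interpretation flux: green_mesh neg_div neg_grad 1 \<Omega> \<T> ..

lemma D_field_AE:
  assumes "\<phi> t \<in> H1 \<Omega>"
  shows "AE x in lebesgue_on \<Omega>. D_field \<Omega> I \<epsilon> (broken_grad \<T>) A \<phi> t x = D_field \<Omega> I \<epsilon> (weak_grad \<Omega>) A \<phi> t x"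
  using flux.PM.broken_weak_AE[OF assms[unfolded H1_eq]]
  by eventually_elim (simp add: D_field_def E_field_def broken_grad_eq weak_grad_eq)

lemma H_field_AE:
  assumes "A t \<in> Hcurl \<Omega>"
  shows "AE x in lebesgue_on \<Omega>. H_field \<mu> (broken_curl \<T>) A t x = H_field \<mu> (weak_curl \<Omega>) A t x"
  using curl.PM.broken_weak_AE[OF assms[unfolded Hcurl_eq]]
  by eventually_elim (simp add: H_field_def broken_curl_eq weak_curl_eq)

lemma Hcurl_0_curve_iff:
  assumes "\<And>t. t \<in> I \<Longrightarrow> at t within I \<noteq> bot"
  shows "C1_curve I (Hcurl_0 \<Omega>) (Hcurl_norm \<Omega>) A \<longleftrightarrow>
    C1_curve I (broken_Hcurl \<Omega> \<T>) (broken_Hcurl_norm \<Omega> \<T>) A \<and>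
    (\<forall>t\<in>I. \<forall>H'\<in>Hcurl \<Omega>. (\<Sum>K\<in>\<T>. bdry_cross (interior K) (A t) H') = 0)"
  unfolding generic_eqs by (rule curl.C1_curve_weak_dom_0_iff[OF assms])

lemma H1_0_curve_iff:
  "C0_curve I (H1_0 \<Omega>) (H1_norm \<Omega>) \<phi> \<longleftrightarrow>
    C0_curve I (broken_H1 \<Omega> \<T>) (broken_H1_norm \<Omega> \<T>) \<phi> \<and>
    (\<forall>t\<in>I. \<forall>D'\<in>Hdiv \<Omega>. (\<Sum>K\<in>\<T>. bdry_flux (interior K) (\<phi> t) D') = 0)"
  unfolding generic_eqs by (rule flux.C0_curve_weak_dom_0_iff)

text \<open>\<open>G'\<close> and \<open>G\<close> are the elementwise and the global version of H,
  and \<open>F\<close> is the time derivative of D plus J. Moving the boundary term to the other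
  side reverses the signs and gives the form of \<open>equations_iff\<close> with
  \<open>s = -1\<close>.\<close>

lemma ampere_iff:
  assumes w: "w \<in> Hcurl \<Omega>" and F: "F \<in> L2 \<Omega>" and G: "G \<in> L2 \<Omega>"
    and ae: "AE x in lebesgue_on \<Omega>. G' x = G x"
  shows "(\<forall>K\<in>\<T>. \<forall>u\<in>Hcurl (interior K).
        (LINT x|lebesgue_on (interior K). u x \<bullet> F x - weak_curl (interior K) u x \<bullet> G' x)
        + bdry_cross (interior K) u w = 0) \<longleftrightarrow>
    (\<forall>u\<in>Hcurl_0 \<Omega>. (LINT x|lebesgue_on \<Omega>. u x \<bullet> F x - weak_curl \<Omega> u x \<bullet> G x) = 0) \<and>
    (\<forall>K\<in>\<T>. tangential_trace (interior K) w = tangential_trace (interior K) G)"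
proof -
  have neg: "(LINT x|lebesgue_on S. u x \<bullet> F x - v x \<bullet> G x) =
      - (LINT x|lebesgue_on S. v x \<bullet> G x + - 1 * (u x \<bullet> F x))" for S and u v :: "real^3 \<Rightarrow> real^3"
    by (simp flip: Bochner_Integration.integral_minus)
  have "(LINT x|lebesgue_on (interior K). u x \<bullet> F x - v x \<bullet> G' x) =
      (LINT x|lebesgue_on (interior K). u x \<bullet> F x - v x \<bullet> G x)" if "K \<in> \<T>" for K and u v :: "real^3 \<Rightarrow> real^3"
  proof (rule integral_AE_cong_lebesgue_on[OF interior_measurable])
    have "AE x in lebesgue_on (interior K). G' x = G x"
      by (rule AE_lebesgue_on_mono[OF ae interior_subset_domain[OF that] domain_measurable interior_measurable])
    then show "AE x in lebesgue_on (interior K). u x \<bullet> F x - v x \<bullet> G' x = u x \<bullet> F x - v x \<bullet> G x"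
      by eventually_elim simp
  qed
  then have "(\<forall>K\<in>\<T>. \<forall>u\<in>Hcurl (interior K).
        (LINT x|lebesgue_on (interior K). u x \<bullet> F x - weak_curl (interior K) u x \<bullet> G' x)
        + bdry_cross (interior K) u w = 0) \<longleftrightarrow>
      (\<forall>K\<in>\<T>. \<forall>u\<in>Hcurl (interior K). bdry_cross (interior K) u w =
        (LINT x|lebesgue_on (interior K). weak_curl (interior K) u x \<bullet> G x + - 1 * (u x \<bullet> F x)))"
    using neg by (intro ball_cong refl) auto
  also have "\<dots> \<longleftrightarrow>
    (\<forall>u\<in>Hcurl_0 \<Omega>. (LINT x|lebesgue_on \<Omega>. weak_curl \<Omega> u x \<bullet> G x + - 1 * (u x \<bullet> F x)) = 0) \<and>
    (\<forall>K\<in>\<T>. tangential_trace (interior K) w = tangential_trace (interior K) G)"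
    unfolding generic_eqs tangential_trace_eq_iff by (rule curl.equations_iff[OF w[unfolded Hcurl_eq] G F])
  finally show ?thesis
    unfolding neg by (simp only: neg_equal_0_iff_equal)
qed

lemma gauss_iff:
  assumes w: "w \<in> Hdiv \<Omega>" and F: "F \<in> L2 \<Omega>" and G: "G \<in> L2 \<Omega>"
    and ae: "AE x in lebesgue_on \<Omega>. G' x = G x"
  shows "(\<forall>K\<in>\<T>. \<forall>u\<in>H1 (interior K).
        (LINT x|lebesgue_on (interior K). weak_grad (interior K) u x \<bullet> G' x + u x * F x)
        - bdry_flux (interior K) u w = 0) \<longleftrightarrow>
    (\<forall>u\<in>H1_0 \<Omega>. (LINT x|lebesgue_on \<Omega>. weak_grad \<Omega> u x \<bullet> G x + u x * F x) = 0) \<and>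
    (\<forall>K\<in>\<T>. normal_trace (interior K) w = normal_trace (interior K) G)"
proof -
  have real: "1 * (a \<bullet> b) = a * b" for a b :: real
    by simp
  have "(LINT x|lebesgue_on (interior K). v x \<bullet> G' x + u x * F x) =
      (LINT x|lebesgue_on (interior K). v x \<bullet> G x + u x * F x)" if "K \<in> \<T>"
    for K and u :: "real^3 \<Rightarrow> real" and v :: "real^3 \<Rightarrow> real^3"
  proof (rule integral_AE_cong_lebesgue_on[OF interior_measurable])
    have "AE x in lebesgue_on (interior K). G' x = G x"
      by (rule AE_lebesgue_on_mono[OF ae interior_subset_domain[OF that] domain_measurable interior_measurable])
    then show "AE x in lebesgue_on (interior K). v x \<bullet> G' x + u x * F x = v x \<bullet> G x + u x * F x"
      by eventually_elim simp
  qed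
  then have "(\<forall>K\<in>\<T>. \<forall>u\<in>H1 (interior K).
        (LINT x|lebesgue_on (interior K). weak_grad (interior K) u x \<bullet> G' x + u x * F x)
        - bdry_flux (interior K) u w = 0) \<longleftrightarrow>
      (\<forall>K\<in>\<T>. \<forall>u\<in>H1 (interior K). bdry_flux (interior K) u w =
        (LINT x|lebesgue_on (interior K). weak_grad (interior K) u x \<bullet> G x + u x * F x))"
    by (intro ball_cong refl) auto
  also have "\<dots> \<longleftrightarrow>
    (\<forall>u\<in>H1_0 \<Omega>. (LINT x|lebesgue_on \<Omega>. weak_grad \<Omega> u x \<bullet> G x + u x * F x) = 0) \<and>
    (\<forall>K\<in>\<T>. normal_trace (interior K) w = normal_trace (interior K) G)"
    unfolding generic_eqs normal_trace_eq_iff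
    by (rule flux.equations_iff[OF w[unfolded Hdiv_eq] G F, unfolded real])
  finally show ?thesis .
qed

text \<open>The fields D and H of the two problems can be compared only once the potentials are
  known to lie in the global spaces. Hence the spaces are matched first, and curves and equations
  are compared under that assumption.\<close>

lemma maxwell_dd_iff:
  assumes bot: "\<And>t. t \<in> I \<Longrightarrow> at t within I \<noteq> bot"
    and J: "\<And>t. t \<in> I \<Longrightarrow> J t \<in> L2 \<Omega>" and \<rho>: "\<And>t. t \<in> I \<Longrightarrow> \<rho> t \<in> L2 \<Omega>"
    and Hh: "C0_curve I (Hcurl \<Omega>) (Hcurl_norm \<Omega>) Hh" and Dh: "C0_curve I (Hdiv \<Omega>) (Hdiv_norm \<Omega>) Dh"
  shows "maxwell_dd \<Omega> \<T> I \<epsilon> \<mu> J \<rho> A \<phi> Hh Dh \<longleftrightarrow>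
     maxwell_weak \<Omega> I \<epsilon> \<mu> J \<rho> A \<phi> \<and>
     (\<forall>K\<in>\<T>. \<forall>t\<in>I.
        tangential_trace (interior K) (Hh t) = tangential_trace (interior K) (H_field \<mu> (weak_curl \<Omega>) A t) \<and>
        normal_trace (interior K) (Dh t) = normal_trace (interior K) (D_field \<Omega> I \<epsilon> (weak_grad \<Omega>) A \<phi> t))"
proof -
  let ?D = "D_field \<Omega> I \<epsilon> (weak_grad \<Omega>) A \<phi>" and ?Db = "D_field \<Omega> I \<epsilon> (broken_grad \<T>) A \<phi>"
  let ?H = "H_field \<mu> (weak_curl \<Omega>) A" and ?Hb = "H_field \<mu> (broken_curl \<T>) A"
  let ?pot = "C1_curve I (Hcurl_0 \<Omega>) (Hcurl_norm \<Omega>) A \<and> C0_curve I (H1_0 \<Omega>) (H1_norm \<Omega>) \<phi>"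
  let ?ampere = "\<lambda>t. \<forall>K\<in>\<T>. \<forall>A'\<in>Hcurl (interior K).
      (LINT x|lebesgue_on (interior K).
         A' x \<bullet> (time_deriv \<Omega> I ?Db t x + J t x) - weak_curl (interior K) A' x \<bullet> ?Hb t x)
      + bdry_cross (interior K) A' (Hh t) = 0"
  let ?gauss = "\<lambda>t. \<forall>K\<in>\<T>. \<forall>\<phi>'\<in>H1 (interior K).
      (LINT x|lebesgue_on (interior K). weak_grad (interior K) \<phi>' x \<bullet> ?Db t x + \<phi>' x * \<rho> t x)
      - bdry_flux (interior K) \<phi>' (Dh t) = 0"
  let ?ampere_weak = "\<lambda>t. \<forall>A'\<in>Hcurl_0 \<Omega>. (LINT x|lebesgue_on \<Omega>.
      A' x \<bullet> (time_deriv \<Omega> I ?D t x + J t x) - weak_curl \<Omega> A' x \<bullet> ?H t x) = 0"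
  let ?gauss_weak = "\<lambda>t. \<forall>\<phi>'\<in>H1_0 \<Omega>. (LINT x|lebesgue_on \<Omega>. weak_grad \<Omega> \<phi>' x \<bullet> ?D t x + \<phi>' x * \<rho> t x) = 0"
  let ?tang = "\<lambda>t. \<forall>K\<in>\<T>. tangential_trace (interior K) (Hh t) = tangential_trace (interior K) (?H t)"
  let ?norm = "\<lambda>t. \<forall>K\<in>\<T>. normal_trace (interior K) (Dh t) = normal_trace (interior K) (?D t)"
  have dd: "maxwell_dd \<Omega> \<T> I \<epsilon> \<mu> J \<rho> A \<phi> Hh Dh \<longleftrightarrow>
      ?pot \<and> C1_curve I (L2 \<Omega>) (L2_norm \<Omega>) ?Db \<and> C0_curve I (L2 \<Omega>) (L2_norm \<Omega>) ?Hb \<and>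
      (\<forall>t\<in>I. ?ampere t \<and> ?gauss t)"
  proof -
    \<comment> \<open>Regrouping that puts each jump condition next to the broken curve it belongs
      to, so that the pair can be recognised as a curve of zero trace.\<close>
    have "(B1 \<and> B2 \<and> X \<and> Y \<and> C \<and> D \<and> (\<forall>t\<in>I. a t \<and> g t \<and> j t \<and> k t)) \<longleftrightarrow>
        ((B1 \<and> (\<forall>t\<in>I. j t)) \<and> (B2 \<and> (\<forall>t\<in>I. k t))) \<and> C \<and> D \<and> (\<forall>t\<in>I. a t \<and> g t)"
      if X Y for B1 B2 X Y C D and a g j k :: "real \<Rightarrow> bool"
      using that by blast
    note taut = this[OF Hh Dh]
    have A: "C1_curve I (Hcurl_0 \<Omega>) (Hcurl_norm \<Omega>) A \<longleftrightarrow>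
        C1_curve I (broken_Hcurl \<Omega> \<T>) (broken_Hcurl_norm \<Omega> \<T>) A \<and>
        (\<forall>t\<in>I. \<forall>H'\<in>Hcurl \<Omega>. (\<Sum>K\<in>\<T>. bdry_cross (interior K) (A t) H') = 0)"
      by (rule Hcurl_0_curve_iff) (rule bot)
    show ?thesis
      unfolding maxwell_dd_def Let_def A H1_0_curve_iff by (rule taut)
  qed
  have weak: "maxwell_weak \<Omega> I \<epsilon> \<mu> J \<rho> A \<phi> \<longleftrightarrow>
      ?pot \<and> C1_curve I (L2 \<Omega>) (L2_norm \<Omega>) ?D \<and> C0_curve I (L2 \<Omega>) (L2_norm \<Omega>) ?H \<and>
      (\<forall>t\<in>I. ?ampere_weak t \<and> ?gauss_weak t)"
    unfolding maxwell_weak_def Let_def by (simp only: conj_assoc)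
  have curves: "(C1_curve I (L2 \<Omega>) (L2_norm \<Omega>) ?Db \<longleftrightarrow> C1_curve I (L2 \<Omega>) (L2_norm \<Omega>) ?D) \<and>
      (C0_curve I (L2 \<Omega>) (L2_norm \<Omega>) ?Hb \<longleftrightarrow> C0_curve I (L2 \<Omega>) (L2_norm \<Omega>) ?H)"
    and equations: "t \<in> I \<Longrightarrow> C1_curve I (L2 \<Omega>) (L2_norm \<Omega>) ?D \<Longrightarrow> C0_curve I (L2 \<Omega>) (L2_norm \<Omega>) ?H \<Longrightarrow>
      (?ampere t \<and> ?gauss t) \<longleftrightarrow> (?ampere_weak t \<and> ?tang t) \<and> (?gauss_weak t \<and> ?norm t)"
    if pot: ?pot for t
  proof -
    have "A t \<in> Hcurl \<Omega>" if "t \<in> I" for t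
      using C1_curveD[OF conjunct1[OF pot] that] by (simp add: Hcurl_0_def)
    then have H: "AE x in lebesgue_on \<Omega>. ?Hb t x = ?H t x" if "t \<in> I" for t
      by (rule H_field_AE) (rule that)
    have "\<phi> t \<in> H1 \<Omega>" if "t \<in> I" for t
      using C0_curveD(1)[OF conjunct2[OF pot] that] by (simp add: H1_0_def)
    then have D: "AE x in lebesgue_on \<Omega>. ?Db t x = ?D t x" if "t \<in> I" for t
      by (rule D_field_AE) (rule that)
    have H': "AE x in lebesgue_on \<Omega>. ?H t x = ?Hb t x" and D': "AE x in lebesgue_on \<Omega>. ?D t x = ?Db t x"
      if "t \<in> I" for t
      using H[OF that] D[OF that] by (eventually_elim, simp)+
    show "(C1_curve I (L2 \<Omega>) (L2_norm \<Omega>) ?Db \<longleftrightarrow> C1_curve I (L2 \<Omega>) (L2_norm \<Omega>) ?D) \<and>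
        (C0_curve I (L2 \<Omega>) (L2_norm \<Omega>) ?Hb \<longleftrightarrow> C0_curve I (L2 \<Omega>) (L2_norm \<Omega>) ?H)"
    proof (intro conjI iffI)
      show "C1_curve I (L2 \<Omega>) (L2_norm \<Omega>) ?D" if "C1_curve I (L2 \<Omega>) (L2_norm \<Omega>) ?Db"
        by (rule C1_curve_L2_AE_cong[OF domain_measurable D that])
      show "C1_curve I (L2 \<Omega>) (L2_norm \<Omega>) ?Db" if "C1_curve I (L2 \<Omega>) (L2_norm \<Omega>) ?D"
        by (rule C1_curve_L2_AE_cong[OF domain_measurable D' that])
      show "C0_curve I (L2 \<Omega>) (L2_norm \<Omega>) ?H" if "C0_curve I (L2 \<Omega>) (L2_norm \<Omega>) ?Hb"
        by (rule C0_curve_L2_AE_cong[OF domain_measurable H that])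
      show "C0_curve I (L2 \<Omega>) (L2_norm \<Omega>) ?Hb" if "C0_curve I (L2 \<Omega>) (L2_norm \<Omega>) ?H"
        by (rule C0_curve_L2_AE_cong[OF domain_measurable H' that])
    qed
    assume t: "t \<in> I" and C1: "C1_curve I (L2 \<Omega>) (L2_norm \<Omega>) ?D" and C0: "C0_curve I (L2 \<Omega>) (L2_norm \<Omega>) ?H"
    \<comment> \<open>The elementwise and the global D are different representatives, yet their
      chosen time derivatives are the same function, so this can be rewritten.\<close>
    have td: "time_deriv \<Omega> I ?Db t = time_deriv \<Omega> I ?D t"
      by (rule time_deriv_AE_cong[OF domain_measurable D t])
    have F: "(\<lambda>x. time_deriv \<Omega> I ?D t x + J t x) \<in> L2 \<Omega>"
      by (rule L2_add[OF C1_curve_time_deriv(1)[OF C1 t] J[OF t]])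
    show "(?ampere t \<and> ?gauss t) \<longleftrightarrow> (?ampere_weak t \<and> ?tang t) \<and> (?gauss_weak t \<and> ?norm t)"
      unfolding td
      by (rule arg_cong2[where f="(\<and>)", OF
            ampere_iff[OF C0_curveD(1)[OF Hh t] F C0_curveD(1)[OF C0 t] H[OF t]]
            gauss_iff[OF C0_curveD(1)[OF Dh t] \<rho>[OF t] C1_curveD[OF C1 t] D[OF t]]])
  qed
  have "maxwell_dd \<Omega> \<T> I \<epsilon> \<mu> J \<rho> A \<phi> Hh Dh \<longleftrightarrow>
      ?pot \<and> C1_curve I (L2 \<Omega>) (L2_norm \<Omega>) ?D \<and> C0_curve I (L2 \<Omega>) (L2_norm \<Omega>) ?H \<and>
      (\<forall>t\<in>I. ?ampere t \<and> ?gauss t)"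
    unfolding dd by (rule conj_cong[OF refl]) (simp only: curves)
  \<comment> \<open>Each use of \<open>conj_cong\<close> makes the preceding conjunct available,
    until \<open>equations\<close> has the potentials and the regularity of D and H that it asks
    for.\<close>
  also have "\<dots> \<longleftrightarrow> ?pot \<and> C1_curve I (L2 \<Omega>) (L2_norm \<Omega>) ?D \<and> C0_curve I (L2 \<Omega>) (L2_norm \<Omega>) ?H \<and>
      (\<forall>t\<in>I. (?ampere_weak t \<and> ?tang t) \<and> (?gauss_weak t \<and> ?norm t))"
    by (rule conj_cong[OF refl], rule conj_cong[OF refl], rule conj_cong[OF refl], rule ball_cong[OF refl])
       (rule equations)
  finally show ?thesis
    unfolding weak by auto
qed

text \<open>The weak equations say that H has weak curl \<open>?F\<close> and D has weak divergence
  \<open>\<rho>\<close>. Both right sides are continuous in the L2 seminorm, which makes H and D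
  admissible as hatted unknowns.\<close>

lemma maxwell_weak_curves:
  assumes bot: "\<And>t. t \<in> I \<Longrightarrow> at t within I \<noteq> bot"
    and J: "C0_curve I (L2 \<Omega>) (L2_norm \<Omega>) J" and \<rho>: "C0_curve I (L2 \<Omega>) (L2_norm \<Omega>) \<rho>"
    and W: "maxwell_weak \<Omega> I \<epsilon> \<mu> J \<rho> A \<phi>"
  shows "C0_curve I (Hcurl \<Omega>) (Hcurl_norm \<Omega>) (H_field \<mu> (weak_curl \<Omega>) A)"
    and "C0_curve I (Hdiv \<Omega>) (Hdiv_norm \<Omega>) (D_field \<Omega> I \<epsilon> (weak_grad \<Omega>) A \<phi>)"
proof -
  let ?D = "D_field \<Omega> I \<epsilon> (weak_grad \<Omega>) A \<phi>" and ?H = "H_field \<mu> (weak_curl \<Omega>) A"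
  let ?F = "\<lambda>t x. time_deriv \<Omega> I ?D t x + J t x"
  have C1: "C1_curve I (L2 \<Omega>) (L2_norm \<Omega>) ?D" and C0: "C0_curve I (L2 \<Omega>) (L2_norm \<Omega>) ?H"
    and ampere: "\<And>t A'. t \<in> I \<Longrightarrow> A' \<in> Hcurl_0 \<Omega> \<Longrightarrow>
      (LINT x|lebesgue_on \<Omega>. A' x \<bullet> ?F t x - weak_curl \<Omega> A' x \<bullet> ?H t x) = 0"
    and gauss: "\<And>t \<phi>'. t \<in> I \<Longrightarrow> \<phi>' \<in> H1_0 \<Omega> \<Longrightarrow>
      (LINT x|lebesgue_on \<Omega>. weak_grad \<Omega> \<phi>' x \<bullet> ?D t x + \<phi>' x * \<rho> t x) = 0"
    using W by (simp_all add: maxwell_weak_def Let_def)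
  have F: "C0_curve I (L2 \<Omega>) (L2_norm \<Omega>) ?F"
    by (rule C0_curve_add[OF C0_curve_time_deriv[OF domain_measurable bot C1] J])
  have "has_weak \<Omega> classical_curl (?H t) (?F t)" if t: "t \<in> I" for t
  proof (rule curl.global_equation_imp_has_weak[OF open_domain C0_curveD(1)[OF C0 t] C0_curveD(1)[OF F t]])
    fix u
    assume "u \<in> weak_dom_0 \<Omega> classical_curl classical_curl (- 1)"
    then have "(LINT x|lebesgue_on \<Omega>. u x \<bullet> ?F t x - weak_curl \<Omega> u x \<bullet> ?H t x) = 0"
      using ampere[OF t] by (simp add: Hcurl_0_eq)
    then have "- (LINT x|lebesgue_on \<Omega>. u x \<bullet> ?F t x - weak_curl \<Omega> u x \<bullet> ?H t x) = 0"
      by simp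
    then show "(LINT x|lebesgue_on \<Omega>. weak \<Omega> classical_curl u x \<bullet> ?H t x + - 1 * (u x \<bullet> ?F t x)) = 0"
      by (simp add: weak_curl_eq flip: Bochner_Integration.integral_minus)
  qed
  then show "C0_curve I (Hcurl \<Omega>) (Hcurl_norm \<Omega>) ?H"
    unfolding Hcurl_eq Hcurl_norm_eq by (rule curl_op.C0_curve_graphI[OF open_domain C0 F])
  have "has_weak \<Omega> neg_grad (?D t) (\<rho> t)" if t: "t \<in> I" for t
  proof (rule flux.global_equation_imp_has_weak[OF open_domain C1_curveD[OF C1 t] C0_curveD(1)[OF \<rho> t]])
    fix u
    assume "u \<in> weak_dom_0 \<Omega> neg_div neg_grad 1"
    then show "(LINT x|lebesgue_on \<Omega>. weak \<Omega> neg_div u x \<bullet> ?D t x + 1 * (u x \<bullet> \<rho> t x)) = 0"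
      using gauss[OF t, of u] by (simp add: H1_0_eq weak_grad_eq)
  qed
  then show "C0_curve I (Hdiv \<Omega>) (Hdiv_norm \<Omega>) ?D"
    unfolding Hdiv_eq Hdiv_norm_eq by (rule grad_op.C0_curve_graphI[OF open_domain C1_curve_imp_C0_curve[OF C1] \<rho>])
qed

end

theorem proposition3p3:
  fixes \<Omega> :: "(real^3) set" and \<T> :: "(real^3) set set" and I :: "real set"
    and \<epsilon> \<mu> :: "real \<Rightarrow> real^3 \<Rightarrow> real^3^3"
    and J :: "real \<Rightarrow> real^3 \<Rightarrow> real^3" and \<rho> :: "real \<Rightarrow> real^3 \<Rightarrow> real"
  assumes "lipschitz_domain \<Omega>" and "tetrahedral_mesh \<T> \<Omega>"
    and "is_interval I" and "interior I \<noteq> {}"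
    and "material_tensor \<Omega> I \<epsilon>" and "material_tensor \<Omega> I \<mu>"
    and "C0_curve I (Hdiv \<Omega>) (Hdiv_norm \<Omega>) J"
    and "C1_curve I (L2 \<Omega>) (L2_norm \<Omega>) \<rho>"
    and "\<forall>t\<in>I. AE x in lebesgue_on \<Omega>. time_deriv \<Omega> I \<rho> t x + weak_div \<Omega> (J t) x = 0"
  shows "(\<forall>A \<phi> Hh Dh.
            C0_curve I (Hcurl \<Omega>) (Hcurl_norm \<Omega>) Hh \<longrightarrow>
            C0_curve I (Hdiv \<Omega>) (Hdiv_norm \<Omega>) Dh \<longrightarrow>
            (maxwell_dd \<Omega> \<T> I \<epsilon> \<mu> J \<rho> A \<phi> Hh Dh \<longleftrightarrow>
             maxwell_weak \<Omega> I \<epsilon> \<mu> J \<rho> A \<phi> \<and>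
             (\<forall>K\<in>\<T>. \<forall>t\<in>I.
                tangential_trace (interior K) (Hh t) =
                  tangential_trace (interior K) (H_field \<mu> (weak_curl \<Omega>) A t) \<and>
                normal_trace (interior K) (Dh t) =
                  normal_trace (interior K) (D_field \<Omega> I \<epsilon> (weak_grad \<Omega>) A \<phi> t)))) \<and>
         (\<forall>A \<phi>. maxwell_weak \<Omega> I \<epsilon> \<mu> J \<rho> A \<phi> \<longrightarrow>
            maxwell_dd \<Omega> \<T> I \<epsilon> \<mu> J \<rho> A \<phi>
              (H_field \<mu> (weak_curl \<Omega>) A) (D_field \<Omega> I \<epsilon> (weak_grad \<Omega>) A \<phi>))"
proof -
  interpret mesh \<Omega> \<T>
    by (rule mesh_tetrahedral_mesh[OF assms(1,2)])
  have bot: "at t within I \<noteq> bot" if "t \<in> I" for t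
    by (rule at_within_interval_neq_bot[OF assms(3,4) that])
  have J: "C0_curve I (L2 \<Omega>) (L2_norm \<Omega>) J"
    by (rule C0_curve_graph_imp_L2[OF assms(7)[unfolded Hdiv_eq Hdiv_norm_eq]])
  have \<rho>: "C0_curve I (L2 \<Omega>) (L2_norm \<Omega>) \<rho>"
    by (rule C1_curve_imp_C0_curve[OF assms(8)])
  note iff = maxwell_dd_iff[OF bot C0_curveD(1)[OF J] C0_curveD(1)[OF \<rho>]]
  show ?thesis
  proof (intro conjI allI impI)
    fix A \<phi> Hh Dh
    assume Hh: "C0_curve I (Hcurl \<Omega>) (Hcurl_norm \<Omega>) Hh" and Dh: "C0_curve I (Hdiv \<Omega>) (Hdiv_norm \<Omega>) Dh"
    show "maxwell_dd \<Omega> \<T> I \<epsilon> \<mu> J \<rho> A \<phi> Hh Dh \<longleftrightarrow>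
        maxwell_weak \<Omega> I \<epsilon> \<mu> J \<rho> A \<phi> \<and>
        (\<forall>K\<in>\<T>. \<forall>t\<in>I.
          tangential_trace (interior K) (Hh t) = tangential_trace (interior K) (H_field \<mu> (weak_curl \<Omega>) A t) \<and>
          normal_trace (interior K) (Dh t) = normal_trace (interior K) (D_field \<Omega> I \<epsilon> (weak_grad \<Omega>) A \<phi> t))"
      by (rule iff[OF _ _ _ Hh Dh])
  next
    fix A \<phi>
    assume W: "maxwell_weak \<Omega> I \<epsilon> \<mu> J \<rho> A \<phi>"
    let ?H = "H_field \<mu> (weak_curl \<Omega>) A" and ?D = "D_field \<Omega> I \<epsilon> (weak_grad \<Omega>) A \<phi>"
    have H: "C0_curve I (Hcurl \<Omega>) (Hcurl_norm \<Omega>) ?H" and D: "C0_curve I (Hdiv \<Omega>) (Hdiv_norm \<Omega>) ?D"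
      by (rule maxwell_weak_curves[OF bot J \<rho> W]; assumption)+
    \<comment> \<open>With H and D themselves as hatted unknowns, the trace conditions become
      reflexive.\<close>
    have "maxwell_dd \<Omega> \<T> I \<epsilon> \<mu> J \<rho> A \<phi> ?H ?D \<longleftrightarrow>
        maxwell_weak \<Omega> I \<epsilon> \<mu> J \<rho> A \<phi> \<and>
        (\<forall>K\<in>\<T>. \<forall>t\<in>I. tangential_trace (interior K) (?H t) = tangential_trace (interior K) (?H t) \<and>
          normal_trace (interior K) (?D t) = normal_trace (interior K) (?D t))"
      by (rule iff[OF _ _ _ H D])
    then show "maxwell_dd \<Omega> \<T> I \<epsilon> \<mu> J \<rho> A \<phi> ?H ?D"
      using W by simp
  qed
qed

end
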